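(* Let $\mathcal{X}$ be a set and let $\mathcal{R}$ and $\mathcal{S}$ be $C^{*}$-relations on $\mathcal{X}$. Suppose that $\mathcal{R}$ is residually finite dimensional, that $\mathcal{S}$ is closed, and that every finite-dimensional representation of $\mathcal{R}$ is a representation of $\mathcal{S}$. Then every representation of $\mathcal{R}$ is a representation of $\mathcal{S}$.
   Context: $C^{*}$-algebras are not assumed unital. A statement $R$ about functions $f:\mathcal{X}\to A$ into various $C^{*}$-algebras is a $C^{*}$-relation on $\mathcal{X}$ if: (R1) the unique function $\mathcal{X}\to\{0\}$ satisfies $R$; (R2) if $\varphi:A\to B$ is an injective $*$-homomorphism and $\varphi\circ f:\mathcal{X}\to B$ satisfies $R$ for some $f:\mathcal{X}\to A$, then $f$ satisfies $R$; (R3) if $\varphi:A\to B$ is a $*$-homomorphism and $f:\mathcal{X}\to A$ satisfies $R$, then $\varphi\circ f$ satisfies $R$; (R4f) if $f_j:\mathcal{X}\to A_j$ satisfy $R$ for $j=1,\dots,n$, then so does $\prod f_j:\mathcal{X}\to\prod_{j=1}^n A_j$, $x\mapsto\langle f_1(x),\dots,f_n(x)\rangle$. A function $f:\mathcal{X}\to A$ is a representation (in $A$) of a set of $C^{*}$-relations if it satisfies every statement in the set; a set of $C^{*}$-relations is identified with the single relation that is its conjunction. For a Hilbert space $\mathbb{H}$, $\mathrm{rep}_{\mathcal{R}}(\mathcal{X},\mathbb{H})$ is the set of representations of $\mathcal{R}$ in $\mathbb{B}(\mathbb{H})$. Closed: $\prod_{\lambda}A_\lambda$ denotes the $C^{*}$-algebra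 of bounded families $\langle a_\lambda\rangle$ with $a_\lambda\in A_\lambda$. A family $f_\lambda:\mathcal{X}\to A_\lambda$ is bounded if $\sup_\lambda\|f_\lambda(x)\|<\infty$ for each $x\in\mathcal{X}$. A set of $C^{*}$-relations is closed if for every bounded family $f_\lambda:\mathcal{X}\to A_\lambda$ of representations, the product function $\mathcal{X}\to\prod_\lambda A_\lambda$, $x\mapsto\langle f_\lambda(x)\rangle$, is a representation. Finite dimensional: for $f:\mathcal{X}\to\mathbb{B}(\mathbb{H})$ the essential subspace is $\{\xi\in\mathbb{H} : f(x)\xi=f(x)^{*}\xi=0\ \forall x\in\mathcal{X}\}^{\perp}$; $f$ is finite dimensional if its essential subspace is finite dimensional. Residually finite dimensional (RFD): $\mathcal{R}$ is RFD if there are finite constants $C(x,r)$ ($x\in\mathcal{X}$, $r\in[0,\infty)$) such that for every Hilbert space $\mathbb{H}$ and every choice of nonnegative constants $r_x$ ($x\in\mathcal{X}$), every $f\in\mathrm{rep}_{\mathcal{R}}(\mathcal{X},\mathbb{H})$ with $\|f(x)\|\le r_x$ for all $x$ lies in the closure, in the pointwise $*$-strong topology, of the set of finite dimensional $g\in\mathrm{rep}_{\mathcal{R}}(\mathcal{X},\mathbb{H})$ with $\|g(x)\|\le C(x,r_x)$ for all $x$. *)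

theory Defs
  imports "HOL-Analysis.Analysis"
begin

section \<open>Complex vector spaces, Hilbert spaces and C*-algebras with explicit carriers\<close>

text \<open>
  A C*-relation speaks about all C*-algebras at once, so algebras and Hilbert spaces are
  records with an explicit carrier set.  The values of the operations outside the carrier are
  irrelevant.
\<close>

record 'a cvs =
  vcarrier :: "'a set"
  vzero :: 'a
  vadd :: "'a \<Rightarrow> 'a \<Rightarrow> 'a"
  vscale :: "complex \<Rightarrow> 'a \<Rightarrow> 'a"

locale complex_vector_space =
  fixes V :: "('a, 'm) cvs_scheme"
  assumes zero_closed: "vzero V \<in> vcarrier V"
    and add_closed: "\<lbrakk>x \<in> vcarrier V; y \<in> vcarrier V\<rbrakk> \<Longrightarrow> vadd V x y \<in> vcarrier V"
    and scale_closed: "x \<in> vcarrier V \<Longrightarrow> vscale V c x \<in> vcarrier V"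
    and add_assoc: "\<lbrakk>x \<in> vcarrier V; y \<in> vcarrier V; z \<in> vcarrier V\<rbrakk>
      \<Longrightarrow> vadd V (vadd V x y) z = vadd V x (vadd V y z)"
    and add_commute: "\<lbrakk>x \<in> vcarrier V; y \<in> vcarrier V\<rbrakk> \<Longrightarrow> vadd V x y = vadd V y x"
    and add_zero: "x \<in> vcarrier V \<Longrightarrow> vadd V x (vzero V) = x"
    and add_inverse: "x \<in> vcarrier V \<Longrightarrow> vadd V x (vscale V (-1) x) = vzero V"
    and scale_add_right: "\<lbrakk>x \<in> vcarrier V; y \<in> vcarrier V\<rbrakk>
      \<Longrightarrow> vscale V c (vadd V x y) = vadd V (vscale V c x) (vscale V c y)"
    and scale_add_left: "x \<in> vcarrier V
      \<Longrightarrow> vscale V (c + d) x = vadd V (vscale V c x) (vscale V d x)"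
    and scale_scale: "x \<in> vcarrier V \<Longrightarrow> vscale V c (vscale V d x) = vscale V (c * d) x"
    and scale_one: "x \<in> vcarrier V \<Longrightarrow> vscale V 1 x = x"

definition vdiff :: "('a, 'm) cvs_scheme \<Rightarrow> 'a \<Rightarrow> 'a \<Rightarrow> 'a" where
  "vdiff V x y = vadd V x (vscale V (-1) y)"

definition complete_wrt :: "('a, 'm) cvs_scheme \<Rightarrow> ('a \<Rightarrow> real) \<Rightarrow> bool" where
  "complete_wrt V nrm \<longleftrightarrow>
    (\<forall>s :: nat \<Rightarrow> 'a.
      (\<forall>n. s n \<in> vcarrier V) \<and>
      (\<forall>e>0. \<exists>N. \<forall>m\<ge>N. \<forall>n\<ge>N. nrm (vdiff V (s m) (s n)) < e) \<longrightarrow>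
      (\<exists>l\<in>vcarrier V. (\<lambda>n. nrm (vdiff V (s n) l)) \<longlonglongrightarrow> 0))"

definition vsubspace :: "('a, 'm) cvs_scheme \<Rightarrow> 'a set \<Rightarrow> bool" where
  "vsubspace V U \<longleftrightarrow> U \<subseteq> vcarrier V \<and> vzero V \<in> U \<and>
    (\<forall>x\<in>U. \<forall>y\<in>U. vadd V x y \<in> U) \<and> (\<forall>c. \<forall>x\<in>U. vscale V c x \<in> U)"

definition vspan :: "('a, 'm) cvs_scheme \<Rightarrow> 'a set \<Rightarrow> 'a set" where
  "vspan V B = \<Inter>{U. vsubspace V U \<and> B \<subseteq> U}"

record 'a hilb = "'a cvs" +
  hinner :: "'a \<Rightarrow> 'a \<Rightarrow> complex"

definition hnorm :: "('a, 'm) hilb_scheme \<Rightarrow> 'a \<Rightarrow> real" where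
  "hnorm H x = sqrt (Re (hinner H x x))"

locale hilbert_space = complex_vector_space H
  for H :: "('a, 'm) hilb_scheme" +
  assumes inner_add_right: "\<lbrakk>x \<in> vcarrier H; y \<in> vcarrier H; z \<in> vcarrier H\<rbrakk>
      \<Longrightarrow> hinner H x (vadd H y z) = hinner H x y + hinner H x z"
    and inner_scale_right: "\<lbrakk>x \<in> vcarrier H; y \<in> vcarrier H\<rbrakk>
      \<Longrightarrow> hinner H x (vscale H c y) = c * hinner H x y"
    and inner_commute: "\<lbrakk>x \<in> vcarrier H; y \<in> vcarrier H\<rbrakk>
      \<Longrightarrow> hinner H y x = cnj (hinner H x y)"
    and inner_nonneg: "x \<in> vcarrier H \<Longrightarrow> 0 \<le> Re (hinner H x x)"
    and inner_definite: "\<lbrakk>x \<in> vcarrier H; hinner H x x = 0\<rbrakk> \<Longrightarrow> x = vzero H"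
    and complete: "complete_wrt H (hnorm H)"

record 'a calg = "'a cvs" +
  amult :: "'a \<Rightarrow> 'a \<Rightarrow> 'a"
  astar :: "'a \<Rightarrow> 'a"
  anorm :: "'a \<Rightarrow> real"

locale cstar_algebra = complex_vector_space A
  for A :: "('a, 'm) calg_scheme" +
  assumes mult_closed: "\<lbrakk>x \<in> vcarrier A; y \<in> vcarrier A\<rbrakk> \<Longrightarrow> amult A x y \<in> vcarrier A"
    and star_closed: "x \<in> vcarrier A \<Longrightarrow> astar A x \<in> vcarrier A"
    and mult_assoc: "\<lbrakk>x \<in> vcarrier A; y \<in> vcarrier A; z \<in> vcarrier A\<rbrakk>
      \<Longrightarrow> amult A (amult A x y) z = amult A x (amult A y z)"
    and mult_add_right: "\<lbrakk>x \<in> vcarrier A; y \<in> vcarrier A; z \<in> vcarrier A\<rbrakk>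
      \<Longrightarrow> amult A x (vadd A y z) = vadd A (amult A x y) (amult A x z)"
    and mult_add_left: "\<lbrakk>x \<in> vcarrier A; y \<in> vcarrier A; z \<in> vcarrier A\<rbrakk>
      \<Longrightarrow> amult A (vadd A x y) z = vadd A (amult A x z) (amult A y z)"
    and mult_scale_right: "\<lbrakk>x \<in> vcarrier A; y \<in> vcarrier A\<rbrakk>
      \<Longrightarrow> amult A x (vscale A c y) = vscale A c (amult A x y)"
    and mult_scale_left: "\<lbrakk>x \<in> vcarrier A; y \<in> vcarrier A\<rbrakk>
      \<Longrightarrow> amult A (vscale A c x) y = vscale A c (amult A x y)"
    and star_star: "x \<in> vcarrier A \<Longrightarrow> astar A (astar A x) = x"
    and star_add: "\<lbrakk>x \<in> vcarrier A; y \<in> vcarrier A\<rbrakk>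
      \<Longrightarrow> astar A (vadd A x y) = vadd A (astar A x) (astar A y)"
    and star_scale: "x \<in> vcarrier A \<Longrightarrow> astar A (vscale A c x) = vscale A (cnj c) (astar A x)"
    and star_mult: "\<lbrakk>x \<in> vcarrier A; y \<in> vcarrier A\<rbrakk>
      \<Longrightarrow> astar A (amult A x y) = amult A (astar A y) (astar A x)"
    and norm_nonneg: "x \<in> vcarrier A \<Longrightarrow> 0 \<le> anorm A x"
    and norm_eq_zero: "x \<in> vcarrier A \<Longrightarrow> anorm A x = 0 \<longleftrightarrow> x = vzero A"
    and norm_triangle: "\<lbrakk>x \<in> vcarrier A; y \<in> vcarrier A\<rbrakk>
      \<Longrightarrow> anorm A (vadd A x y) \<le> anorm A x + anorm A y"
    and norm_scale: "x \<in> vcarrier A \<Longrightarrow> anorm A (vscale A c x) = cmod c * anorm A x"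
    and norm_mult: "\<lbrakk>x \<in> vcarrier A; y \<in> vcarrier A\<rbrakk>
      \<Longrightarrow> anorm A (amult A x y) \<le> anorm A x * anorm A y"
    and norm_star_mult: "x \<in> vcarrier A \<Longrightarrow> anorm A (amult A (astar A x) x) = (anorm A x)\<^sup>2"
    and complete: "complete_wrt A (anorm A)"

definition star_hom :: "('a \<Rightarrow> 'b) \<Rightarrow> 'a calg \<Rightarrow> 'b calg \<Rightarrow> bool" where
  "star_hom \<phi> A B \<longleftrightarrow>
    \<phi> \<in> vcarrier A \<rightarrow> vcarrier B \<and>
    (\<forall>x\<in>vcarrier A. \<forall>y\<in>vcarrier A. \<phi> (vadd A x y) = vadd B (\<phi> x) (\<phi> y)) \<and>
    (\<forall>c. \<forall>x\<in>vcarrier A. \<phi> (vscale A c x) = vscale B c (\<phi> x)) \<and>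
    (\<forall>x\<in>vcarrier A. \<forall>y\<in>vcarrier A. \<phi> (amult A x y) = amult B (\<phi> x) (\<phi> y)) \<and>
    (\<forall>x\<in>vcarrier A. \<phi> (astar A x) = astar B (\<phi> x))"

definition star_iso :: "('a \<Rightarrow> 'b) \<Rightarrow> 'a calg \<Rightarrow> 'b calg \<Rightarrow> bool" where
  "star_iso \<phi> A B \<longleftrightarrow> star_hom \<phi> A B \<and> bij_betw \<phi> (vcarrier A) (vcarrier B)"


section \<open>Products and bounded operators\<close>

text \<open>The element 0 is inserted for the sake of the empty product, whose norm is then 0.\<close>

definition prod_alg :: "'i set \<Rightarrow> ('i \<Rightarrow> 'a calg) \<Rightarrow> ('i \<Rightarrow> 'a) calg" where
  "prod_alg I A =
    \<lparr>vcarrier = {a \<in> \<Pi>\<^sub>E i\<in>I. vcarrier (A i). bdd_above ((\<lambda>i. anorm (A i) (a i)) ` I)},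
     vzero = (\<lambda>i\<in>I. vzero (A i)),
     vadd = (\<lambda>a b. \<lambda>i\<in>I. vadd (A i) (a i) (b i)),
     vscale = (\<lambda>c a. \<lambda>i\<in>I. vscale (A i) c (a i)),
     amult = (\<lambda>a b. \<lambda>i\<in>I. amult (A i) (a i) (b i)),
     astar = (\<lambda>a. \<lambda>i\<in>I. astar (A i) (a i)),
     anorm = (\<lambda>a. Sup (insert 0 ((\<lambda>i. anorm (A i) (a i)) ` I)))\<rparr>"

definition bounded_operators :: "('a, 'm) hilb_scheme \<Rightarrow> ('a \<Rightarrow> 'a) set" where
  "bounded_operators H =
    {T \<in> vcarrier H \<rightarrow>\<^sub>E vcarrier H.
      (\<forall>\<xi>\<in>vcarrier H. \<forall>\<eta>\<in>vcarrier H. T (vadd H \<xi> \<eta>) = vadd H (T \<xi>) (T \<eta>)) \<and>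
      (\<forall>c. \<forall>\<xi>\<in>vcarrier H. T (vscale H c \<xi>) = vscale H c (T \<xi>)) \<and>
      (\<exists>K. \<forall>\<xi>\<in>vcarrier H. hnorm H (T \<xi>) \<le> K * hnorm H \<xi>)}"

definition adjoint_op :: "('a, 'm) hilb_scheme \<Rightarrow> ('a \<Rightarrow> 'a) \<Rightarrow> 'a \<Rightarrow> 'a" where
  "adjoint_op H T = (THE S. S \<in> bounded_operators H \<and>
    (\<forall>\<xi>\<in>vcarrier H. \<forall>\<eta>\<in>vcarrier H. hinner H (S \<xi>) \<eta> = hinner H \<xi> (T \<eta>)))"

definition BH :: "('a, 'm) hilb_scheme \<Rightarrow> ('a \<Rightarrow> 'a) calg" where
  "BH H =
    \<lparr>vcarrier = bounded_operators H,
     vzero = (\<lambda>\<xi>\<in>vcarrier H. vzero H),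
     vadd = (\<lambda>S T. \<lambda>\<xi>\<in>vcarrier H. vadd H (S \<xi>) (T \<xi>)),
     vscale = (\<lambda>c T. \<lambda>\<xi>\<in>vcarrier H. vscale H c (T \<xi>)),
     amult = (\<lambda>S T. \<lambda>\<xi>\<in>vcarrier H. S (T \<xi>)),
     astar = adjoint_op H,
     anorm = (\<lambda>T. Sup {hnorm H (T \<xi>) |\<xi>. \<xi> \<in> vcarrier H \<and> hnorm H \<xi> \<le> 1})\<rparr>"

text \<open>
  The \<open>*\<close>-strong topology on the bounded operators: the coarsest topology making
  \<open>T \<mapsto> T \<xi>\<close> and \<open>T \<mapsto> T\<^sup>* \<xi>\<close> norm continuous for every vector \<open>\<xi>\<close>.
\<close>

definition star_strong_topology :: "('a, 'm) hilb_scheme \<Rightarrow> ('a \<Rightarrow> 'a) topology" where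
  "star_strong_topology H = topology_generated_by
    ({{T \<in> bounded_operators H. hnorm H (vdiff H (T \<xi>) \<zeta>) < e} |\<xi> \<zeta> e.
        \<xi> \<in> vcarrier H \<and> \<zeta> \<in> vcarrier H \<and> 0 < e} \<union>
     {{T \<in> bounded_operators H. hnorm H (vdiff H (adjoint_op H T \<xi>) \<zeta>) < e} |\<xi> \<zeta> e.
        \<xi> \<in> vcarrier H \<and> \<zeta> \<in> vcarrier H \<and> 0 < e})"

definition essential_subspace ::
    "'x set \<Rightarrow> ('a, 'm) hilb_scheme \<Rightarrow> ('x \<Rightarrow> 'a \<Rightarrow> 'a) \<Rightarrow> 'a set" where
  "essential_subspace X H f =
    {\<eta> \<in> vcarrier H. \<forall>\<xi>\<in>vcarrier H.
      (\<forall>x\<in>X. f x \<xi> = vzero H \<and> adjoint_op H (f x) \<xi> = vzero H) \<longrightarrow> hinner H \<xi> \<eta> = 0}"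

definition finite_dimensional ::
    "'x set \<Rightarrow> ('a, 'm) hilb_scheme \<Rightarrow> ('x \<Rightarrow> 'a \<Rightarrow> 'a) \<Rightarrow> bool" where
  "finite_dimensional X H f \<longleftrightarrow>
    (\<exists>B. finite B \<and> B \<subseteq> vcarrier H \<and> essential_subspace X H f = vspan H B)"


section \<open>C*-relations\<close>

text \<open>
  HOL has no type containing all C*-algebras, so a statement about functions into
  ``various C*-algebras'' is a predicate on algebras whose carrier lies in one type, the
  universe.  The parameter \<open>'k\<close> is arbitrary, so the universe can be made to contain isomorphic
  copies of any prescribed C*-algebras.  It always has room for the operators on a Hilbert space
  whose dimension is at most the cardinality of \<open>'x + nat + 'k\<close>, and for products of at most that
  many of its own algebras.  Hilbert spaces and index sets, too, are taken from the universe.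
\<close>

type_synonym ('x, 'k) universe = "('x + nat + 'k) set"

type_synonym ('x, 'k) relation =
  "('x, 'k) universe calg \<Rightarrow> ('x \<Rightarrow> ('x, 'k) universe) \<Rightarrow> bool"

text \<open>
  Algebras such as products or operator algebras live in other types than the universe; a function
  into one of them is a representation if it is one after passing to an isomorphic copy in the
  universe.  For a relation closed under homomorphic images the choice of the copy does not
  matter, and on algebras in the universe this agrees with the relation itself.
\<close>

definition is_representation ::
    "('x, 'k) relation \<Rightarrow> 'x set \<Rightarrow> 'a calg \<Rightarrow> ('x \<Rightarrow> 'a) \<Rightarrow> bool" where
  "is_representation R X A f \<longleftrightarrow>
    cstar_algebra A \<and> f \<in> X \<rightarrow>\<^sub>E vcarrier A \<and>
    (\<exists>A' \<psi>. cstar_algebra A' \<and> star_iso \<psi> A A' \<and> R A' (\<lambda>x\<in>X. \<psi> (f x)))"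

definition cstar_relation :: "'x set \<Rightarrow> ('x, 'k) relation \<Rightarrow> bool" where
  "cstar_relation X R \<longleftrightarrow>
    (\<forall>A. cstar_algebra A \<and> vcarrier A = {vzero A} \<longrightarrow> R A (\<lambda>x\<in>X. vzero A)) \<and>
    (\<forall>A B \<phi> f. cstar_algebra A \<and> cstar_algebra B \<and> star_hom \<phi> A B \<and> inj_on \<phi> (vcarrier A) \<and>
      f \<in> X \<rightarrow>\<^sub>E vcarrier A \<and> R B (\<lambda>x\<in>X. \<phi> (f x)) \<longrightarrow> R A f) \<and>
    (\<forall>A B \<phi> f. cstar_algebra A \<and> cstar_algebra B \<and> star_hom \<phi> A B \<and>
      f \<in> X \<rightarrow>\<^sub>E vcarrier A \<and> R A f \<longrightarrow> R B (\<lambda>x\<in>X. \<phi> (f x))) \<and>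
    (\<forall>n::nat. \<forall>A f. (\<forall>j\<in>{1..n}. cstar_algebra (A j) \<and> f j \<in> X \<rightarrow>\<^sub>E vcarrier (A j) \<and>
        R (A j) (f j)) \<longrightarrow>
      is_representation R X (prod_alg {1..n} A) (\<lambda>x\<in>X. \<lambda>j\<in>{1..n}. f j x))"

text \<open>
  The families considered are those whose product exists in the universe, up to isomorphism.
\<close>

definition closed_relation :: "'x set \<Rightarrow> ('x, 'k) relation \<Rightarrow> bool" where
  "closed_relation X R \<longleftrightarrow>
    (\<forall>(I :: ('x, 'k) universe set) A f.
      (\<forall>i\<in>I. is_representation R X (A i :: ('x, 'k) universe calg) (f i)) \<and>
      (\<forall>x\<in>X. bdd_above ((\<lambda>i. anorm (A i) (f i x)) ` I)) \<and>
      (\<exists>(P :: ('x, 'k) universe calg) \<psi>. cstar_algebra P \<and> star_iso \<psi> (prod_alg I A) P) \<longrightarrow>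
      is_representation R X (prod_alg I A) (\<lambda>x\<in>X. \<lambda>i\<in>I. f i x))"

definition rfd_relation :: "'x set \<Rightarrow> ('x, 'k) relation \<Rightarrow> bool" where
  "rfd_relation X R \<longleftrightarrow>
    (\<exists>C :: 'x \<Rightarrow> real \<Rightarrow> real.
      \<forall>(H :: ('x, 'k) universe hilb) (r :: 'x \<Rightarrow> real) f.
        hilbert_space H \<and> (\<forall>x\<in>X. 0 \<le> r x) \<and>
        is_representation R X (BH H) f \<and> (\<forall>x\<in>X. anorm (BH H) (f x) \<le> r x) \<longrightarrow>
        f \<in> product_topology (\<lambda>_. star_strong_topology H) X closure_of
          {g. is_representation R X (BH H) g \<and> finite_dimensional X H g \<and>
            (\<forall>x\<in>X. anorm (BH H) (g x) \<le> C x (r x))})"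

end

theory Submission
  imports Defs
begin

text \<open>
  By (R2) it suffices to treat a representation \<open>f\<close> of \<open>R\<close> in the C*-algebra generated by its
  values. This algebra has a dense subset no larger than \<open>'x + nat\<close>, namely the values of
  \<open>*\<close>-polynomials with rational coefficients, so that the GNS spaces \<open>H\<close> of its states, the
  algebras \<open>B(H)\<close> and the products below all have isomorphic copies in the universe. Let \<open>\<pi>\<close> be the
  GNS representation of a state. As \<open>R\<close> is RFD, \<open>\<pi> \<circ> f\<close> is the \<open>*\<close>-strong limit of a
  pointwise bounded net of finite-dimensional representations \<open>g\<^sub>i\<close>. These satisfy \<open>S\<close>, and by
  closedness so does \<open>x \<mapsto> (g\<^sub>i x)\<^sub>i\<close>. This function takes values in the C*-subalgebra of the
  \<open>*\<close>-strongly convergent families, and the limit is a \<open>*\<close>-homomorphism from there to \<open>B(H)\<close>,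
  whence \<open>\<pi> \<circ> f\<close> satisfies \<open>S\<close>. Using closedness once more for a separating family of states, one
  sees that \<open>f\<close> itself satisfies \<open>S\<close>.

  That the states separate the points is the Gelfand--Naimark theorem. It is proved without spectral
  theory: \<open>b\<^sup>* b\<close> is a square by an algebraic form of the Kelley--Vaught argument, and a state norming
  \<open>a\<^sup>* a\<close> is a linear functional dominated by the sublinear functional \<open>inf\<^sub>t (\<parallel>t + x\<parallel> - t)\<close>.
\<close>

section \<open>Positivity and states in unital C*-algebras\<close>

text \<open>The obstacle is size. Relations speak only about algebras with carrier in the universe,
  the power set of the index type. Such an algebra can have as many orthogonal projections as the
  universe has elements, and then no Hilbert space with a dense family indexed by the index type
  represents it faithfully. The algebra generated by the values of one function is small enough,
  since terms can be coded by indices. From there on an object is coded by the set of its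
  approximations from a dense family to precision 1/(n+1), so that vectors, operators and bounded
  families all become sets of indices. The constants \<open>C x r\<close> do two things. They make
  the approximating net a bounded family, so that closedness applies, and they make products
  converge, since multiplication is jointly *-strongly continuous on bounded sets but not in
  general. Records with carriers come without analysis, and a state is built from the norms of t +
  x, which needs a unit. Therefore every algebra is unitized and embedded in one Banach algebra
  type, \<open>all_alg\<close>.\<close>

locale unital_cstar =
  fixes star :: "'b::{real_normed_algebra_1,banach} \<Rightarrow> 'b"
    and \<iota> :: 'b
  assumes star_star [simp]: "star (star x) = x"
    and star_add [simp]: "star (x + y) = star x + star y"
    and star_scaleR [simp]: "star (c *\<^sub>R x) = c *\<^sub>R star x"
    and star_mult [simp]: "star (x * y) = star y * star x"
    and norm_star_mult: "norm (star x * x) = (norm x)\<^sup>2"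
    \<comment> \<open>The type class has only real scalars. A central skew-adjoint
      \<open>\<iota>\<close> with square -1 supplies the imaginary unit, so that the locale
      describes complex C*-algebras.\<close>
    and iota_sq [simp]: "\<iota> * \<iota> = -1"
    and star_iota [simp]: "star \<iota> = - \<iota>"
    and iota_commute: "x * \<iota> = \<iota> * x"
begin

lemma star_zero [simp]: "star 0 = 0"
  using star_scaleR[of 0 0] by simp

lemma star_minus [simp]: "star (- x) = - star x"
  using star_scaleR[of "-1" x] by simp

lemma star_diff [simp]: "star (x - y) = star x - star y"
  by (simp only: diff_conv_add_uminus star_add star_minus)

lemma star_one [simp]: "star 1 = 1"
  by (metis mult_1 star_mult star_star)

lemma star_power [simp]: "star (x ^ n) = star x ^ n"
  by (induction n) (auto simp: power_commutes)

lemma star_of_real [simp]: "star (of_real c) = of_real c"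
  by (simp add: of_real_def)

lemma norm_star [simp]: "norm (star x) = norm x"
proof -
  have le: "norm x \<le> norm (star x)" for x
  proof (cases "norm x = 0")
    case False
    have "norm x * norm x \<le> norm (star x) * norm x"
      using norm_star_mult[of x] norm_mult_ineq[of "star x" x] by (simp add: power2_eq_square)
    then show ?thesis using False by (simp add: mult_le_cancel_right)
  qed simp
  show ?thesis using le[of x] le[of "star x"] by simp
qed

lemma bounded_linear_star: "bounded_linear star"
  by (rule bounded_linear_intro[where K = 1]) auto

lemmas tendsto_star = bounded_linear.tendsto[OF bounded_linear_star]

lemma iota_iota [simp]: "\<iota> * (\<iota> * x) = - x"
  by (simp add: mult.assoc[symmetric])

lemma iota_right: "x * (\<iota> * y) = \<iota> * (x * y)"
  by (metis iota_commute mult.assoc)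

lemma norm_self_adjoint_sq: "star x = x \<Longrightarrow> norm (x * x) = (norm x)\<^sup>2"
  using norm_star_mult[of x] by simp

lemma star_mult_self_eq_0: "star x * x = 0 \<Longrightarrow> x = 0"
  using norm_star_mult[of x] by simp

text \<open>\<open>1 - w\<close> is the square root of \<open>1 - z\<close>; iterating \<open>w = (z + w\<^sup>2) / 2\<close> from 0 is dominated
  by the same iteration for the number 1 in place of \<open>z\<close>, which converges.\<close>

lemma sqrt_one_minus:
  assumes sz: "star z = z" and nz: "norm z \<le> 1"
  obtains w where "star w = w" "norm w \<le> 1" "(1 - w) * (1 - w) = 1 - z"
    "\<And>u. u * z = z * u \<Longrightarrow> u * w = w * u"
proof -
  define w where "w = rec_nat (0::'b) (\<lambda>_ v. (1/2) *\<^sub>R (z + v * v))"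
  define a where "a = rec_nat (0::real) (\<lambda>_ v. (1 + v * v) / 2)"
  have w0: "w 0 = 0" and wS: "w (Suc n) = (1/2) *\<^sub>R (z + w n * w n)" for n
    by (simp_all add: w_def)
  have a0: "a 0 = 0" and aS: "a (Suc n) = (1 + a n * a n) / 2" for n
    by (simp_all add: a_def)
  have a_bd: "0 \<le> a n \<and> a n \<le> 1" for n
    by (induction n) (auto simp: a0 aS mult_le_one)
  have a_inc: "a n \<le> a (Suc n)" for n
  proof -
    have "0 \<le> (1 - a n) * (1 - a n)" by simp
    then show ?thesis by (simp add: aS algebra_simps)
  qed
  have "convergent a"
  proof (rule Bseq_monoseq_convergent)
    show "Bseq a" by (rule BseqI'[where K = 1]) (use a_bd in auto)
    show "monoseq a" using a_inc by (simp add: monoseq_Suc)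
  qed
  then obtain \<alpha> where \<alpha>: "a \<longlonglongrightarrow> \<alpha>" by (auto simp: convergent_def)
  have ws: "star (w n) = w n" for n
    by (induction n) (auto simp: w0 wS sz)
  have wc: "u * w n = w n * u" if "u * z = z * u" for u n
    using that
  proof (induction n)
    case (Suc n)
    then have "u * (w n * w n) = (w n * w n) * u" by (metis mult.assoc)
    then show ?case using Suc by (simp add: wS algebra_simps)
  qed (simp add: w0)
  have ww: "w m * w n = w n * w m" for m n
    using wc[of "w m" n] wc[of z m] by simp
  have wn: "norm (w n) \<le> a n" for n
  proof (induction n)
    case (Suc n)
    have "norm (w n * w n) \<le> a n * a n"
      by (rule order_trans[OF norm_mult_ineq]) (use Suc a_bd in \<open>auto intro: mult_mono\<close>)
    then have "norm (z + w n * w n) \<le> 1 + a n * a n"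
      using nz norm_triangle_ineq[of z "w n * w n"] by linarith
    then show ?case by (simp add: wS aS)
  qed (simp add: w0 a0)
  \<comment> \<open>Both recursions turn an increment into half the product of the previous
    increment and the sum of the two terms. Factoring the difference of squares uses that the
    iterates commute; the increments of \<open>a\<close> telescope to a convergent sum.\<close>
  have wd: "norm (w (Suc n) - w n) \<le> a (Suc n) - a n" for n
  proof (induction n)
    case 0
    then show ?case using nz by (simp add: wS w0 aS a0)
  next
    case (Suc n)
    have sq: "(w (Suc n) - w n) * (w (Suc n) + w n) = w (Suc n) * w (Suc n) - w n * w n"
      by (simp add: ring_distribs ww[of n "Suc n"])
    have "w (Suc (Suc n)) - w (Suc n) = (1/2) *\<^sub>R (z + w (Suc n) * w (Suc n)) - (1/2) *\<^sub>R (z + w n * w n)"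
      by (simp only: wS[symmetric])
    also have "\<dots> = (1/2) *\<^sub>R ((w (Suc n) - w n) * (w (Suc n) + w n))"
      unfolding sq by (simp add: scaleR_diff_right[symmetric])
    also have "norm \<dots> \<le> (1/2) * ((a (Suc n) - a n) * (a (Suc n) + a n))"
      using Suc wn[of n] wn[of "Suc n"] a_inc[of n]
      by (auto intro!: order_trans[OF norm_mult_ineq] mult_mono norm_triangle_le)
    also have "\<dots> = a (Suc (Suc n)) - a (Suc n)"
    proof -
      have "a (Suc (Suc n)) - a (Suc n) = (1 + a (Suc n) * a (Suc n)) / 2 - (1 + a n * a n) / 2"
        by (simp only: aS[symmetric])
      then show ?thesis by (simp add: field_simps)
    qed
    finally show ?case .
  qed
  have "summable (\<lambda>n. w (Suc n) - w n)"
    by (rule summable_comparison_test'[where g = "\<lambda>n. a (Suc n) - a n" and N = 0])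
      (use telescope_summable[OF \<alpha>] wd in auto)
  then have "(\<lambda>n. \<Sum>k<n. w (Suc k) - w k) \<longlonglongrightarrow> (\<Sum>k. w (Suc k) - w k)"
    by (rule summable_LIMSEQ)
  then obtain l where l: "w \<longlonglongrightarrow> l"
    by (auto simp: sum_lessThan_telescope w0)
  have "(\<lambda>n. w (Suc n)) \<longlonglongrightarrow> (1/2) *\<^sub>R (z + l * l)"
    unfolding wS by (intro tendsto_intros l)
  then have eq: "l = (1/2) *\<^sub>R (z + l * l)"
    using LIMSEQ_unique[OF LIMSEQ_Suc[OF l]] by blast
  show thesis
  proof
    show "star l = l"
      using LIMSEQ_unique[OF tendsto_star[OF l]] l ws by simp
    show "norm l \<le> 1"
      by (rule LIMSEQ_le_const2[OF tendsto_norm[OF l]]) (use wn a_bd order_trans in blast)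
    have "l + l = z + l * l"
      using arg_cong[OF eq, of "\<lambda>v. v + v"] by (simp flip: scaleR_add_left)
    then show "(1 - l) * (1 - l) = 1 - z" by (simp add: algebra_simps)
    show "u * l = l * u" if "u * z = z * u" for u
    proof (rule LIMSEQ_unique)
      show "(\<lambda>n. u * w n) \<longlonglongrightarrow> u * l" by (intro tendsto_intros l)
      show "(\<lambda>n. u * w n) \<longlonglongrightarrow> l * u" unfolding wc[OF that] by (intro tendsto_intros l)
    qed
  qed
qed

text \<open>Rescaling of \<open>sqrt_one_minus\<close> with z = 1 - h/t and root sqrt t (1 - w). The
  norm hypothesis stands for the spectrum of \<open>h\<close> lying in [0, 2t]. The root satisfies
  the same kind of bound with s = sqrt t, so it has a root itself.\<close>

lemma sqrt_self_adjoint: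
  assumes sh: "star h = h" and nh: "norm (of_real t - h) \<le> t"
  obtains y s where "star y = y" "y * y = h" "norm (of_real s - y) \<le> s"
    "\<And>u. u * h = h * u \<Longrightarrow> u * y = y * u"
proof (cases "t = 0")
  case True
  then show thesis using nh that[of 0 0] by simp
next
  case False
  then have t: "t > 0" using nh norm_ge_zero[of "of_real t - h"] by linarith
  define z where "z = (1/t) *\<^sub>R (of_real t - h)"
  have "norm z \<le> 1" using nh t by (simp add: z_def)
  moreover have "star z = z" by (simp add: z_def sh)
  ultimately obtain w where w: "star w = w" "norm w \<le> 1" "(1 - w) * (1 - w) = 1 - z"
    "\<And>u. u * z = z * u \<Longrightarrow> u * w = w * u"
    using sqrt_one_minus[of z] by metis
  define y where "y = sqrt t *\<^sub>R (1 - w)"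
  show thesis
  proof
    show "star y = y" by (simp add: y_def w)
    have "y * y = t *\<^sub>R ((1 - w) * (1 - w))" using t by (simp add: y_def)
    also have "\<dots> = h" using t by (simp add: w z_def scaleR_diff_right of_real_def)
    finally show "y * y = h" .
    have "of_real (sqrt t) - y = sqrt t *\<^sub>R w"
      by (simp add: y_def of_real_def scaleR_diff_right)
    then show "norm (of_real (sqrt t) - y) \<le> sqrt t"
      using w(2) t by (simp add: mult_left_le)
    show "u * y = y * u" if "u * h = h * u" for u
    proof -
      have "u * z = z * u" using that by (simp add: z_def algebra_simps of_real_def)
      then show ?thesis using w(4)[of u] by (simp add: y_def algebra_simps)
    qed
  qed
qed

section \<open>Positive elements and their order, with real parts of elements of known norm in place
  of functional calculus\<close>

lemma star_Re_Im: "star h = h \<Longrightarrow> star q = q \<Longrightarrow> star (h + \<iota> * q) = h - \<iota> * q"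
  by (simp add: iota_commute)

text \<open>The counterpart of |a + ib|^2 = a^2 + b^2. It stands in for functional calculus: if h^2
  + q^2 is a scalar, the norm of h + iq is known, and it bounds the norm of the real part
  \<open>h\<close>.\<close>

lemma star_mult_Re_Im:
  assumes "star h = h" "star q = q" "h * q = q * h"
  shows "star (h + \<iota> * q) * (h + \<iota> * q) = h * h + q * q"
proof -
  have "star (h + \<iota> * q) * (h + \<iota> * q) = (h - \<iota> * q) * (h + \<iota> * q)"
    by (simp only: star_Re_Im assms)
  also have "\<dots> = h * h + q * q"
    by (simp add: algebra_simps iota_right[of h] iota_right[of q] mult.assoc assms(3))
  finally show ?thesis .
qed

lemma Re_Im_decomposition:
  obtains u v where "star u = u" "star v = v" "x = u + \<iota> * v"
proof
  show "star ((1/2) *\<^sub>R (x + star x)) = (1/2) *\<^sub>R (x + star x)" by simp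
  show "star ((1/2) *\<^sub>R (\<iota> * (star x - x))) = (1/2) *\<^sub>R (\<iota> * (star x - x))"
    by (simp add: iota_commute algebra_simps)
  show "x = (1/2) *\<^sub>R (x + star x) + \<iota> * ((1/2) *\<^sub>R (\<iota> * (star x - x)))"
    by (simp add: algebra_simps flip: scaleR_add_left)
qed

text \<open>Think of \<open>k\<close> as cos x. Then w = k + i sqrt(1 - k^2) has norm 1, and sin^2 x
  = (1 - cos 2x)/2 becomes 1 - k^2 = (1 - Re(w^2))/2, which has norm at most 1. The root exists
  because 1 - k^2 is within distance 1 of 1.\<close>

lemma norm_one_minus_square:
  assumes sk: "star k = k" and nk: "norm k \<le> 1"
  shows "norm (1 - k * k) \<le> 1"
proof -
  have "norm (of_real 1 - (1 - k * k)) \<le> 1"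
    using nk by (simp add: norm_self_adjoint_sq sk power_le_one)
  moreover have "star (1 - k * k) = 1 - k * k" by (simp add: sk)
  ultimately obtain y where y: "star y = y" "y * y = 1 - k * k"
    "\<And>u. u * (1 - k * k) = (1 - k * k) * u \<Longrightarrow> u * y = y * u"
    using sqrt_self_adjoint[of "1 - k * k" 1] by metis
  have ky: "k * y = y * k" by (rule y(3)) (simp add: algebra_simps)
  define w where "w = k + \<iota> * y"
  have "star w * w = 1" using star_mult_Re_Im[OF sk y(1) ky] by (simp add: w_def y)
  then have "(norm w)\<^sup>2 = 1\<^sup>2" using norm_star_mult[of w] by simp
  then have nw: "norm w = 1" by (rule power2_eq_imp_eq) auto
  have "star w = k - \<iota> * y" unfolding w_def by (rule star_Re_Im[OF sk y(1)])
  then have "w * w + star w * star w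
      = (k + \<iota> * y) * (k + \<iota> * y) + (k - \<iota> * y) * (k - \<iota> * y)"
    by (simp only: w_def)
  also have "\<dots> = 2 *\<^sub>R (k * k - y * y)"
    by (simp add: algebra_simps iota_right[of k] iota_right[of y] mult.assoc scaleR_2)
  also have "\<dots> = 2 *\<^sub>R (2 *\<^sub>R (k * k) - 1)" by (simp add: y(2) scaleR_2)
  finally have "(1/2) *\<^sub>R (w * w + star w * star w) = 2 *\<^sub>R (k * k) - 1" by simp
  then have "1 - (1/2) *\<^sub>R (w * w + star w * star w) = 2 *\<^sub>R (1 - k * k)"
    by (simp add: scaleR_2)
  then have eq: "1 - k * k = (1/2) *\<^sub>R (1 - (1/2) *\<^sub>R (w * w + star w * star w))"
    by simp
  have "norm (w * w) \<le> 1" "norm (star w * star w) \<le> 1"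
    using norm_mult_ineq[of w w] norm_mult_ineq[of "star w" "star w"] nw by simp_all
  then have "norm (w * w + star w * star w) \<le> 2" by (intro norm_triangle_le) simp
  then have "norm (1 - (1/2) *\<^sub>R (w * w + star w * star w)) \<le> 2"
    using norm_triangle_ineq4[of 1 "(1/2) *\<^sub>R (w * w + star w * star w)"] by simp
  then show ?thesis by (subst eq) simp
qed

text \<open>For self-adjoint \<open>h\<close> this amounts to
  \<open>norm (of_real t - h) \<le> t\<close> for some \<open>t\<close>, and then for every
  \<open>t\<close> not below the norm of \<open>h\<close> (\<open>pos_iff_norm\<close>,
  \<open>pos_norm_diff\<close>). The square form provides roots, the norm form provides
  sums.\<close>

definition pos :: "'b \<Rightarrow> bool" where
  "pos h \<longleftrightarrow> (\<exists>y. star y = y \<and> h = y * y)"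

lemma pos_square: "star y = y \<Longrightarrow> pos (y * y)"
  by (auto simp: pos_def)

lemma pos_self_adjoint: "pos h \<Longrightarrow> star h = h"
  by (auto simp: pos_def)

lemma pos_scaleR: "pos h \<Longrightarrow> 0 \<le> c \<Longrightarrow> pos (c *\<^sub>R h)"
  unfolding pos_def
proof (elim exE conjE)
  fix y assume "star y = y" "h = y * y" "0 \<le> c"
  then show "\<exists>y. star y = y \<and> c *\<^sub>R h = y * y"
    by (intro exI[of _ "sqrt c *\<^sub>R y"]) simp
qed

lemma pos_of_real: "0 \<le> c \<Longrightarrow> pos (of_real c)"
  using pos_scaleR[of 1 c] pos_square[of 1] by (simp add: of_real_def)

lemma pos_zero [simp]: "pos 0"
  using pos_of_real[of 0] by simp

lemma pos_iff_norm: "star h = h \<Longrightarrow> norm (of_real t - h) \<le> t \<Longrightarrow> pos h"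
  using sqrt_self_adjoint[of h t] unfolding pos_def by metis

text \<open>Division by \<open>t\<close> turns \<open>h\<close> into a square k^2 with |k| <= 1, the
  case of \<open>norm_one_minus_square\<close>.\<close>

lemma pos_norm_diff:
  assumes "pos h" "norm h \<le> t"
  shows "norm (of_real t - h) \<le> t"
proof (cases "t = 0")
  case False
  then have t: "t > 0" using assms norm_ge_zero[of h] by linarith
  obtain y where y: "star y = y" "h = y * y" using assms by (auto simp: pos_def)
  define k where "k = (1 / sqrt t) *\<^sub>R y"
  have kk: "k * k = (1/t) *\<^sub>R h" using t by (simp add: k_def y(2) real_sqrt_mult_self)
  have sk: "star k = k" by (simp add: k_def y)
  have "(norm k)\<^sup>2 = norm h / t" using t norm_self_adjoint_sq[OF sk] by (simp add: kk)
  then have "(norm k)\<^sup>2 \<le> 1\<^sup>2" using assms t by simp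
  then have "norm k \<le> 1" by (rule power2_le_imp_le) simp
  then have "norm (1 - k * k) \<le> 1" using norm_one_minus_square[OF sk] by simp
  moreover have "of_real t - h = t *\<^sub>R (1 - k * k)"
    using t by (simp add: kk of_real_def scaleR_diff_right)
  ultimately show ?thesis using t by (simp add: mult_left_le)
qed (use assms in simp)

text \<open>A sum of two squares has no evident root, but the norm form of positivity adds up by the
  triangle inequality, with t = |a| + |b|.\<close>

lemma pos_add: "pos a \<Longrightarrow> pos b \<Longrightarrow> pos (a + b)"
proof -
  assume a: "pos a" "pos b"
  have "norm (of_real (norm a + norm b) - (a + b))
      = norm ((of_real (norm a) - a) + (of_real (norm b) - b))"
    by (simp add: algebra_simps)
  also have "\<dots> \<le> norm a + norm b"
    using a by (intro norm_triangle_mono pos_norm_diff) auto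
  finally show ?thesis
    using a by (intro pos_iff_norm[of _ "norm a + norm b"]) (auto simp: pos_self_adjoint)
qed

lemma pos_sqrt:
  assumes "pos h"
  obtains y where "star y = y" "y * y = h" "pos y" "\<And>u. u * h = h * u \<Longrightarrow> u * y = y * u"
  using sqrt_self_adjoint[OF pos_self_adjoint[OF assms] pos_norm_diff[OF assms order_refl]]
    pos_iff_norm by metis

text \<open>The roots a, b of x and -x commute, so (ab)^2 = -x^2, and x + i ab has the square
  modulus x^2 + (ab)^2 = 0. Hence it vanishes, and with it its real part x.\<close>

lemma pos_uminus_eq_0:
  assumes "pos x" "pos (- x)"
  shows "x = 0"
proof -
  obtain a where a: "star a = a" "a * a = x" "\<And>u. u * x = x * u \<Longrightarrow> u * a = a * u"
    using pos_sqrt[OF assms(1)] by metis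
  obtain b where b: "star b = b" "b * b = - x" "\<And>u. u * (- x) = (- x) * u \<Longrightarrow> u * b = b * u"
    using pos_sqrt[OF assms(2)] by metis
  have "a * x = x * a" by (simp add: a(2)[symmetric] mult.assoc)
  then have ab: "a * b = b * a" by (intro b(3)) simp
  have "(a * b) * (a * b) = (a * a) * (b * b)" by (metis ab mult.assoc)
  then have sq: "(a * b) * (a * b) = - (x * x)" by (simp add: a(2) b(2))
  have "b * (b * b) = (b * b) * b" by (simp add: mult.assoc)
  then have "b * x = x * b" by (simp add: b(2))
  with \<open>a * x = x * a\<close> have xab: "x * (a * b) = (a * b) * x" by (metis mult.assoc)
  have sx: "star x = x" "star (a * b) = a * b" using assms(1) by (simp_all add: pos_self_adjoint ab a(1) b(1))
  have "x + \<iota> * (a * b) = 0"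
    by (rule star_mult_self_eq_0) (simp add: star_mult_Re_Im[OF sx xab] sq del: star_add star_mult)
  then have "star (x + \<iota> * (a * b)) = 0" by simp
  moreover note star_Re_Im[OF sx]
  ultimately have "x + \<iota> * (a * b) + (x - \<iota> * (a * b)) = 0"
    using \<open>x + \<iota> * (a * b) = 0\<close> by simp
  then have "2 *\<^sub>R x = 0" by (simp add: scaleR_2)
  then show "x = 0" by simp
qed

text \<open>With commuting roots y, z of m - h and m + h one has h^2 + (yz)^2 = m^2, so
  \<open>h\<close> is the real part of an element of norm m.\<close>

lemma norm_le_pos:
  assumes sh: "star h = h" and "pos (of_real m - h)" "pos (of_real m + h)" "0 \<le> m"
  shows "norm h \<le> m"
proof -
  obtain y where y: "star y = y" "y * y = of_real m - h"
    "\<And>u. u * (of_real m - h) = (of_real m - h) * u \<Longrightarrow> u * y = y * u"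
    using pos_sqrt[OF assms(2)] by metis
  obtain z where z: "star z = z" "z * z = of_real m + h"
    "\<And>u. u * (of_real m + h) = (of_real m + h) * u \<Longrightarrow> u * z = z * u"
    using pos_sqrt[OF assms(3)] by metis
  have hy: "h * y = y * h" by (rule y(3)) (simp add: algebra_simps of_real_def)
  have hz: "h * z = z * h" by (rule z(3)) (simp add: algebra_simps of_real_def)
  have yz: "y * z = z * y"
    by (rule z(3)) (use hy in \<open>simp add: algebra_simps of_real_def\<close>)
  have "(y * z) * (y * z) = (y * y) * (z * z)" by (metis yz mult.assoc)
  also have "\<dots> = of_real (m * m) - h * h" by (simp add: y(2) z(2) algebra_simps of_real_def)
  finally have sq: "h * h + (y * z) * (y * z) = of_real (m * m)" by simp
  have sq': "star (y * z) = y * z" "h * (y * z) = (y * z) * h"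
    by (simp_all add: yz y(1) z(1)) (metis hy hz mult.assoc yz)
  define w where "w = h + \<iota> * (y * z)"
  have "star w * w = of_real (m * m)"
    using star_mult_Re_Im[OF sh sq'] sq by (simp only: w_def)
  then have "norm (star w * w) = m * m" by (simp only: norm_of_real) simp
  then have "norm w = m" using norm_star_mult[of w] \<open>0 \<le> m\<close>
    by (metis norm_ge_zero power2_eq_imp_eq power2_eq_square)
  have "star w = h - \<iota> * (y * z)"
    unfolding w_def by (rule star_Re_Im[OF sh sq'(1)])
  then have "h = (1/2) *\<^sub>R (w + star w)" by (simp add: w_def flip: scaleR_2)
  moreover have "norm (w + star w) \<le> 2 * m"
    using norm_triangle_ineq[of w "star w"] \<open>norm w = m\<close> by simp
  ultimately show ?thesis by simp
qed

text \<open>For x = u + iv the cross terms of the two products cancel and 2 u^2 + 2 v^2 remains,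
  whether or not u and v commute.\<close>

lemma pos_star_mult_add_mult_star:
  "star x * x + x * star x = y \<Longrightarrow> pos y"
proof -
  assume y: "star x * x + x * star x = y"
  obtain u v where u: "star u = u" "star v = v" "x = u + \<iota> * v" by (rule Re_Im_decomposition)
  have "star x = u - \<iota> * v" unfolding u(3) by (rule star_Re_Im[OF u(1,2)])
  then have "y = (u - \<iota> * v) * (u + \<iota> * v) + (u + \<iota> * v) * (u - \<iota> * v)"
    using y by (simp only: u(3))
  also have "\<dots> = 2 *\<^sub>R (u * u) + 2 *\<^sub>R (v * v)"
    by (simp add: algebra_simps iota_right[of u] iota_right[of v] mult.assoc scaleR_2)
  finally show "pos y" using u by (auto intro!: pos_add pos_scaleR pos_square)
qed

text \<open>The core of the Kelley-Vaught argument, in place of a comparison of the spectra of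
  \<open>star c * c\<close> and \<open>c * star c\<close>. With N = \<open>c * star c\<close> and e
  = cq, \<open>e * star e\<close> is -N^2 and \<open>star e * e\<close> is -q^4. Their sum is
  positive, so -q^4 is positive, and q^4 = 0 by \<open>pos_uminus_eq_0\<close>.\<close>

lemma star_mult_uminus_square_eq_0:
  assumes "star c * c = - (q * q)" "star q = q"
  shows "c = 0"
proof -
  define N where "N = c * star c"
  have sN: "star N = N" by (simp add: N_def)
  have "N + - (q * q) = star c * c + c * star c" by (simp add: assms N_def)
  then have "pos (N + - (q * q))" by (intro pos_star_mult_add_mult_star[of c]) simp
  then have "pos (N + - (q * q) + q * q)" using assms pos_add pos_square by blast
  then have "pos N" by simp
  define e where "e = c * q"
  have e1: "e * star e = - (N * N)"
  proof -
    have "e * star e = c * (q * q) * star c" by (simp add: e_def assms mult.assoc)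
    also have "\<dots> = - (c * (star c * c) * star c)" by (simp add: assms)
    finally show ?thesis by (simp add: N_def mult.assoc)
  qed
  have e2: "star e * e = - ((q * q) * (q * q))"
  proof -
    have "star e * e = q * (star c * c) * q" by (simp add: e_def assms(2) mult.assoc)
    then show ?thesis by (simp add: assms mult.assoc)
  qed
  have "pos (- ((q * q) * (q * q)) + - (N * N))"
    using pos_star_mult_add_mult_star[of e] e1 e2 by simp
  from pos_add[OF this pos_square[OF sN]] have "pos (- ((q * q) * (q * q)))" by simp
  moreover have sq: "star (q * q) = q * q" using assms by simp
  ultimately have "(q * q) * (q * q) = 0" using pos_uminus_eq_0 pos_square by blast
  then have "star (q * q) * (q * q) = 0" using sq by simp
  then have "q * q = 0" by (rule star_mult_self_eq_0)
  with assms(1) have "star c * c = 0" by simp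
  then show "c = 0" by (rule star_mult_self_eq_0)
qed

text \<open>With \<open>d\<close> twice the negative part of \<open>h = b\<^sup>* b\<close> and \<open>c = b d\<close>, the element \<open>c\<^sup>* c\<close> is minus a
  square, which forces \<open>c = 0\<close> and then \<open>d = 0\<close>.\<close>

lemma pos_star_mult: "pos (star b * b)"
proof -
  define h where "h = star b * b"
  have sh: "star h = h" by (simp add: h_def)
  obtain y where y: "star y = y" "y * y = h * h" "pos y"
    "\<And>u. u * (h * h) = (h * h) * u \<Longrightarrow> u * y = y * u"
    using pos_sqrt[OF pos_square[OF sh]] by metis
  \<comment> \<open>\<open>y\<close> is the absolute value of \<open>h\<close>. Its root
    \<open>z\<close> serves to write dyd as the square of the self-adjoint element dz.\<close>
  obtain z where z: "star z = z" "z * z = y" "\<And>u. u * y = y * u \<Longrightarrow> u * z = z * u"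
    using pos_sqrt[OF y(3)] by metis
  have hy: "h * y = y * h" by (rule y(4)) (simp add: mult.assoc)
  define d where "d = y - h"
  have sd: "star d = d" by (simp add: d_def y(1) sh)
  have dy: "d * y = y * d" by (simp add: d_def algebra_simps hy)
  have dz: "d * z = z * d" by (rule z(3)[OF dy])
  have hd: "h * d = - (y * d)" by (simp add: d_def algebra_simps hy y(2))
  have "star (b * d) * (b * d) = d * (h * d)" by (simp add: sd h_def mult.assoc)
  also have "\<dots> = - (d * (z * z) * d)" by (simp add: hd z(2) mult.assoc)
  also have "\<dots> = - ((d * z) * (z * d))" by (simp add: mult.assoc)
  also have "\<dots> = - ((d * z) * (d * z))" by (simp only: dz)
  finally have "b * d = 0"
    by (rule star_mult_uminus_square_eq_0) (simp add: sd z(1) dz)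
  then have hd0: "h * d = 0" by (simp add: h_def mult.assoc)
  \<comment> \<open>d^2 = yd - hd, and yd = -hd, so both terms vanish.\<close>
  then have "d * d = 0" using hd by (simp add: d_def algebra_simps)
  then have "star d * d = 0" using sd by simp
  then have "d = 0" by (rule star_mult_self_eq_0)
  then show ?thesis using y(3) by (simp add: d_def h_def)
qed

end

section \<open>The Hahn-Banach theorem via minimal sublinear functionals\<close>

definition sublinear :: "('v::real_vector \<Rightarrow> real) \<Rightarrow> bool" where
  "sublinear p \<longleftrightarrow> (\<forall>x y. p (x + y) \<le> p x + p y) \<and> (\<forall>c>0. \<forall>x. p (c *\<^sub>R x) = c * p x)"

lemma sublinear_zero: "sublinear p \<Longrightarrow> p 0 = 0"
  unfolding sublinear_def by (metis mult_2 scaleR_zero_right zero_less_numeral add_cancel_right_right)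

lemma sublinear_scaleR: "sublinear p \<Longrightarrow> 0 \<le> c \<Longrightarrow> p (c *\<^sub>R x) = c * p x"
  using sublinear_zero[of p] by (cases "c = 0") (auto simp: sublinear_def)

lemma sublinear_lower: "sublinear p \<Longrightarrow> - p (- x) \<le> p x"
  using sublinear_zero[of p] unfolding sublinear_def
  by (metis add.right_inverse add.commute diff_0 diff_le_eq)

text \<open>If \<open>q = p\<close> then \<open>p (x + y) = p x + p y\<close>, so that minimal sublinear functionals are linear.\<close>

lemma sublinear_improve:
  fixes p :: "'v::real_vector \<Rightarrow> real"
  assumes p: "sublinear p"
  obtains q where "sublinear q" "\<And>x. q x \<le> p x" "\<And>x. q x \<le> p (x + y) - p y"
proof -
  \<comment> \<open>The infimum over t >= 0 is again sublinear in x; t = 0 gives q <= p and t = 1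
    gives the last bound. It is finite because subadditivity keeps \<open>g x t\<close> above
    -p(-x).\<close>
  define g where "g x t = p (x + t *\<^sub>R y) - t * p y" for x t
  define q where "q x = (INF t\<in>{0..}. g x t)" for x
  have sub: "p (u + v) \<le> p u + p v" for u v using p by (auto simp: sublinear_def)
  have lower: "- p (- x) \<le> g x t" if "t \<ge> 0" for x t
    using sub[of "x + t *\<^sub>R y" "- x"] sublinear_scaleR[OF p that] by (simp add: g_def)
  have bdd: "bdd_below (g x ` {0..})" for x
    by (rule bdd_belowI[of _ "- p (- x)"]) (use lower in auto)
  have qle: "q x \<le> g x t" if "t \<ge> 0" for x t
    unfolding q_def by (rule cINF_lower[OF bdd]) (use that in auto)
  have qge: "m \<le> q x" if "\<And>t. t \<ge> 0 \<Longrightarrow> m \<le> g x t" for m x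
    unfolding q_def by (rule cINF_greatest) (use that in auto)
  have "sublinear q"
    unfolding sublinear_def
  proof (intro conjI allI impI)
    fix x z
    have *: "q (x + z) \<le> g x s + g z t" if "s \<ge> 0" "t \<ge> 0" for s t
    proof -
      have "q (x + z) \<le> g (x + z) (s + t)" using that by (intro qle) simp
      also have "\<dots> \<le> g x s + g z t"
        using sub[of "x + s *\<^sub>R y" "z + t *\<^sub>R y"] by (simp add: g_def algebra_simps)
      finally show ?thesis .
    qed
    have "q (x + z) - g z t \<le> q x" if "t \<ge> 0" for t
      by (rule qge) (use *[OF _ that] in \<open>simp add: algebra_simps\<close>)
    then have "q (x + z) - q x \<le> q z" by (intro qge) (simp add: algebra_simps)
    then show "q (x + z) \<le> q x + q z" by simp
  next
    fix c :: real and x assume c: "c > 0"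
    have gc: "g (c *\<^sub>R x) (c * t) = c * g x t" for t
      using sublinear_scaleR[OF p, of c "x + t *\<^sub>R y"] c by (simp add: g_def algebra_simps)
    show "q (c *\<^sub>R x) = c * q x"
    proof (rule antisym)
      have "q (c *\<^sub>R x) / c \<le> q x"
      proof (rule qge)
        fix t :: real assume "t \<ge> 0"
        then have "q (c *\<^sub>R x) \<le> c * g x t" using qle[of "c * t" "c *\<^sub>R x"] c gc by simp
        then show "q (c *\<^sub>R x) / c \<le> g x t" using c by (simp add: field_simps)
      qed
      then show "q (c *\<^sub>R x) \<le> c * q x" using c by (simp add: field_simps)
      show "c * q x \<le> q (c *\<^sub>R x)"
      proof (rule qge)
        fix t :: real assume "t \<ge> 0"
        then show "c * q x \<le> g (c *\<^sub>R x) t"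
          using qle[of "t / c" x] gc[of "t / c"] c by (simp add: field_simps)
      qed
    qed
  qed
  moreover have "q x \<le> p x" for x using qle[of 0 x] by (simp add: g_def)
  moreover have "q x \<le> p (x + y) - p y" for x using qle[of 1 x] by (simp add: g_def)
  ultimately show thesis using that by blast
qed

text \<open>Zorn's lemma for the reversed pointwise order. The infimum of a chain is finite, as r x
  >= -r(-x) >= -p(-x) for every sublinear r <= p, and it is subadditive because any two members of a
  chain lie above a common member.\<close>

lemma minimal_sublinear:
  fixes p :: "'v::real_vector \<Rightarrow> real"
  assumes p: "sublinear p"
  obtains q where "sublinear q" "q \<le> p" "\<And>r. sublinear r \<Longrightarrow> r \<le> q \<Longrightarrow> r = q"
proof -
  define \<A> where "\<A> = {q. sublinear q \<and> q \<le> p}"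
  have "\<exists>m\<in>\<A>. \<forall>a\<in>\<A>. a \<le> m \<longrightarrow> a = m"
  proof (rule predicate_Zorn[where P = "\<lambda>a b. b \<le> a"])
    show "partial_order_on \<A> (relation_of (\<lambda>a b. b \<le> a) \<A>)"
      by (rule partial_order_on_relation_ofI) auto
  next
    fix C assume "C \<in> Chains (relation_of (\<lambda>a b. b \<le> a) \<A>)"
    then have CA: "C \<subseteq> \<A>" and chain: "\<And>a b. a \<in> C \<Longrightarrow> b \<in> C \<Longrightarrow> a \<le> b \<or> b \<le> a"
      by (auto simp: Chains_def relation_of_def)
    show "\<exists>u\<in>\<A>. \<forall>a\<in>C. u \<le> a"
    proof (cases "C = {}")
      case True
      then show ?thesis using p by (auto simp: \<A>_def)
    next
      case False
      define q where "q x = (INF r\<in>C. r x)" for x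
      have r: "sublinear r" "r \<le> p" if "r \<in> C" for r using CA that by (auto simp: \<A>_def)
      have bdd: "bdd_below ((\<lambda>r. r x) ` C)" for x
      proof (rule bdd_belowI2[of _ "- p (- x)"])
        fix q assume "q \<in> C"
        then show "- p (- x) \<le> q x"
          using sublinear_lower[of q x] r[of q] by (metis le_funD neg_le_iff_le order_trans)
      qed
      have qle: "q x \<le> r x" if "r \<in> C" for x r
        unfolding q_def by (rule cINF_lower[OF bdd that])
      have qge: "m \<le> q x" if "\<And>r. r \<in> C \<Longrightarrow> m \<le> r x" for m x
        unfolding q_def by (rule cINF_greatest[OF False]) (use that in auto)
      have "sublinear q"
        unfolding sublinear_def
      proof (intro conjI allI impI)
        fix x y
        have *: "q (x + y) \<le> r x + r' y" if rr: "r \<in> C" "r' \<in> C" for r r'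
        proof -
          obtain s where s: "s \<in> C" "s \<le> r" "s \<le> r'" using chain[OF rr] rr by auto
          have "q (x + y) \<le> s (x + y)" by (rule qle[OF s(1)])
          also have "\<dots> \<le> s x + s y" using r(1)[OF s(1)] by (simp add: sublinear_def)
          also have "\<dots> \<le> r x + r' y" using s by (intro add_mono) (auto simp: le_fun_def)
          finally show ?thesis .
        qed
        have "q (x + y) - r' y \<le> q x" if "r' \<in> C" for r'
          by (rule qge) (use *[OF _ that] in \<open>simp add: algebra_simps\<close>)
        then have "q (x + y) - q x \<le> q y" by (intro qge) (simp add: algebra_simps)
        then show "q (x + y) \<le> q x + q y" by simp
      next
        fix c :: real and x assume c: "c > 0"
        have rc: "r (c *\<^sub>R x) = c * r x" if "r \<in> C" for r
          using r(1)[OF that] c by (simp add: sublinear_def)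
        show "q (c *\<^sub>R x) = c * q x"
        proof (rule antisym)
          have "q (c *\<^sub>R x) / c \<le> q x"
            by (rule qge) (use qle[of _ "c *\<^sub>R x"] rc c in \<open>simp add: field_simps\<close>)
          then show "q (c *\<^sub>R x) \<le> c * q x" using c by (simp add: field_simps)
          show "c * q x \<le> q (c *\<^sub>R x)"
            by (rule qge) (simp add: qle rc c)
        qed
      qed
      moreover have "q \<le> p"
        using False qle r by (metis all_not_in_conv le_funD le_funI order_trans)
      ultimately show ?thesis using qle by (auto simp: \<A>_def le_fun_def intro!: bexI[of _ q])
    qed
  qed
  then obtain m where "m \<in> \<A>" "\<forall>a\<in>\<A>. a \<le> m \<longrightarrow> a = m" by blast
  then show thesis using that[of m] by (auto simp: \<A>_def)
qed

text \<open>A minimal sublinear functional is not lowered by \<open>sublinear_improve\<close> in any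
  direction, so it is linear. To reach the value \<open>p h\<close>, \<open>p\<close> is first
  improved in the direction \<open>h\<close>: at -h the improved functional is at most p 0 - p h =
  -p h, whence f h >= p h.\<close>

lemma Hahn_Banach_sublinear:
  fixes p :: "'v::real_vector \<Rightarrow> real"
  assumes p: "sublinear p"
  obtains f where "linear f" "\<And>x. f x \<le> p x" "f h = p h"
proof -
  obtain p' where p': "sublinear p'" "\<And>x. p' x \<le> p x" "\<And>x. p' x \<le> p (x + h) - p h"
    using sublinear_improve[OF p] by metis
  obtain f where f: "sublinear f" "f \<le> p'" "\<And>r. sublinear r \<Longrightarrow> r \<le> f \<Longrightarrow> r = f"
    using minimal_sublinear[OF p'(1)] by metis
  have add: "f (x + y) = f x + f y" for x y
  proof -
    obtain q where q: "sublinear q" "\<And>x. q x \<le> f x" "\<And>x. q x \<le> f (x + y) - f y"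
      using sublinear_improve[OF f(1)] by metis
    have "q = f" using q f(3)[of q] by (simp add: le_fun_def)
    then have "f x + f y \<le> f (x + y)" using q(3)[of x] by simp
    then show ?thesis using f(1) by (simp add: sublinear_def antisym)
  qed
  have neg: "f (- x) = - f x" for x
    using add[of x "- x"] sublinear_zero[OF f(1)] by simp
  have "linear f"
  proof (rule linearI)
    show "f (c *\<^sub>R x) = c *\<^sub>R f x" for c x
    proof (cases "c \<ge> 0")
      case False
      then show ?thesis
        using sublinear_scaleR[OF f(1), of "- c" x] neg[of "c *\<^sub>R x"] by simp
    qed (simp add: sublinear_scaleR[OF f(1)])
  qed (fact add)
  moreover have "f x \<le> p x" for x
    using f(2) p'(2)[of x] by (meson le_funD order_trans)
  moreover have "f h = p h"
  proof (rule antisym)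
    have "f (- h) \<le> p 0 - p h" using f(2) p'(3)[of "- h"] by (metis add.left_inverse le_funD order_trans)
    then show "p h \<le> f h" using neg sublinear_zero[OF p] by simp
  qed fact
  ultimately show thesis using that by blast
qed

text \<open>A complex-linear, hermitian, positive functional. \<open>func_bound\<close> is the
  normalisation, in the form that keeps the GNS seminorm below the norm.\<close>

locale positive_functional = unital_cstar +
  fixes \<Phi> :: "'a \<Rightarrow> complex"
  assumes func_add: "\<Phi> (x + y) = \<Phi> x + \<Phi> y"
    and func_scaleR: "\<Phi> (c *\<^sub>R x) = of_real c * \<Phi> x"
    and func_iota: "\<Phi> (\<iota> * x) = \<i> * \<Phi> x"
    and func_star: "\<Phi> (star x) = cnj (\<Phi> x)"
    and func_pos: "0 \<le> Re (\<Phi> (star x * x))"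
    and func_bound: "Re (\<Phi> (star x * x)) \<le> (norm x)\<^sup>2"

section \<open>States that norm a given element\<close>

context unital_cstar
begin

text \<open>For self-adjoint x, \<open>p x\<close> is the largest value of a state at x. A linear f
  below \<open>p\<close> is nonnegative at positive h because \<open>p (- h)\<close> <= 0, seen at t
  = |h|; it is bounded by the norm, seen at t = 0.\<close>

lemma norming_functional:
  obtains \<Phi> where "positive_functional star \<iota> \<Phi>" "Re (\<Phi> (star a * a)) = (norm a)\<^sup>2"
proof -
  define g where "g x t = norm (of_real t + x) - t" for x :: 'b and t :: real
  define p where "p x = (INF t\<in>{0..}. g x t)" for x
  have bdd: "bdd_below (g x ` {0..})" for x
  proof (rule bdd_belowI2[of _ "- norm x"])
    fix t :: real assume "t \<in> {0..}"
    then show "- norm x \<le> g x t"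
      using norm_triangle_ineq2[of "of_real t" "- x"] by (simp add: g_def)
  qed
  have ple: "p x \<le> g x t" if "t \<ge> 0" for x t
    unfolding p_def by (rule cINF_lower[OF bdd]) (use that in auto)
  have pge: "m \<le> p x" if "\<And>t. t \<ge> 0 \<Longrightarrow> m \<le> g x t" for m x
    unfolding p_def by (rule cINF_greatest) (use that in auto)
  have p: "sublinear p"
    unfolding sublinear_def
  proof (intro conjI allI impI)
    fix x y
    have *: "p (x + y) \<le> g x s + g y t" if "s \<ge> 0" "t \<ge> 0" for s t
    proof -
      have "p (x + y) \<le> g (x + y) (s + t)" using that by (intro ple) simp
      also have "\<dots> \<le> g x s + g y t"
        using norm_triangle_ineq[of "of_real s + x" "of_real t + y"] by (simp add: g_def algebra_simps)
      finally show ?thesis .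
    qed
    have "p (x + y) - g y t \<le> p x" if "t \<ge> 0" for t
      by (rule pge) (use *[OF _ that] in \<open>simp add: algebra_simps\<close>)
    then have "p (x + y) - p x \<le> p y" by (intro pge) (simp add: algebra_simps)
    then show "p (x + y) \<le> p x + p y" by simp
  next
    fix c :: real and x assume c: "c > 0"
    have gc: "g (c *\<^sub>R x) (c * t) = c * g x t" for t
    proof -
      have "of_real (c * t) + c *\<^sub>R x = c *\<^sub>R (of_real t + x)"
        by (simp add: of_real_def scaleR_add_right)
      then have "norm (of_real (c * t) + c *\<^sub>R x) = c * norm (of_real t + x)"
        using c by (simp only: norm_scaleR abs_of_pos)
      then show ?thesis by (simp only: g_def right_diff_distrib)
    qed
    show "p (c *\<^sub>R x) = c * p x"
    proof (rule antisym)
      have "p (c *\<^sub>R x) / c \<le> p x"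
      proof (rule pge)
        fix t :: real assume "t \<ge> 0"
        then have "p (c *\<^sub>R x) \<le> c * g x t" using ple[of "c * t" "c *\<^sub>R x"] c gc by simp
        then show "p (c *\<^sub>R x) / c \<le> g x t" using c by (simp add: field_simps)
      qed
      then show "p (c *\<^sub>R x) \<le> c * p x" using c by (simp add: field_simps)
      show "c * p x \<le> p (c *\<^sub>R x)"
      proof (rule pge)
        fix t :: real assume "t \<ge> 0"
        then show "c * p x \<le> g (c *\<^sub>R x) t"
          using ple[of "t / c" x] gc[of "t / c"] c by (simp add: field_simps)
      qed
    qed
  qed
  have p_neg: "p (- h) \<le> 0" if "pos h" for h
    using ple[of "norm h" "- h"] pos_norm_diff[OF that order_refl] by (simp add: g_def)
  define a' where "a' = star a * a"
  \<comment> \<open>For s = |t + a'| the element s - t - a' is positive, so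
    \<open>norm_le_pos\<close> gives |a'| <= s - t. This needs t <= s: otherwise s - t, a sum of the
    positive elements s - t - a' and a', would be a negative scalar.\<close>
  have pa: "(norm a)\<^sup>2 \<le> p a'"
  proof (rule pge)
    fix t :: real assume t: "t \<ge> 0"
    define s where "s = norm (of_real t + a')"
    have pa': "pos a'" by (simp add: a'_def pos_star_mult)
    have st: "pos (of_real s - (of_real t + a'))"
      by (rule pos_iff_norm[of _ s]) (simp_all add: s_def pos_self_adjoint[OF pa'] add.commute)
    have "t \<le> s"
    proof (rule ccontr)
      assume "\<not> t \<le> s"
      have "pos (of_real s - (of_real t + a') + a')" by (rule pos_add[OF st pa'])
      then have "pos (- of_real (t - s))" by simp
      moreover have "pos (of_real (t - s))" by (rule pos_of_real) (use \<open>\<not> t \<le> s\<close> in simp)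
      ultimately have "of_real (t - s) = (0::'b)" by (rule pos_uminus_eq_0[rotated])
      then show False using \<open>\<not> t \<le> s\<close> by (simp add: of_real_eq_0_iff del: of_real_diff)
    qed
    have "norm a' \<le> s - t"
    proof (rule norm_le_pos)
      show "star a' = a'" using pa' by (rule pos_self_adjoint)
      show "pos (of_real (s - t) - a')" using st by (simp add: algebra_simps)
      show "pos (of_real (s - t) + a')" by (rule pos_add[OF pos_of_real pa']) (use \<open>t \<le> s\<close> in simp)
    qed (use \<open>t \<le> s\<close> in simp)
    then show "(norm a)\<^sup>2 \<le> g a' t" by (simp add: g_def s_def a'_def norm_star_mult)
  qed
  obtain f where f: "linear f" "\<And>x. f x \<le> p x" "f a' = p a'"
    using Hahn_Banach_sublinear[OF p] by metis
  have f_norm: "f x \<le> norm x" for x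
    using f(2)[of x] ple[of 0 x] by (simp add: g_def)
  have f_pos: "0 \<le> f h" if "pos h" for h
    using f(2)[of "- h"] p_neg[OF that] linear_neg[OF f(1)] by force
  \<comment> \<open>\<open>f\<close> is only real-linear and need not be hermitian.
    \<open>re\<close> symmetrises it, and re x - i re(ix) is the usual complex functional with real
    part \<open>re\<close>.\<close>
  define re where "re x = (1/2) * f (x + star x)" for x
  define \<Phi> where "\<Phi> x = Complex (re x) (- re (\<iota> * x))" for x
  have re_add: "re (x + y) = re x + re y" for x y
    unfolding re_def by (simp add: linear_add[OF f(1)] algebra_simps)
  have re_scale: "re (c *\<^sub>R x) = c * re x" for c x
    unfolding re_def by (simp add: linear_cmul[OF f(1)] flip: scaleR_add_right)
  have re_star: "re (star x) = re x" for x by (simp add: re_def add.commute)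
  have re_neg: "re (- x) = - re x" for x using re_scale[of "-1" x] by simp
  have re_sa: "re x = f x" if "star x = x" for x
    using that by (simp add: re_def linear_cmul[OF f(1)] flip: scaleR_2)
  have rp: "re (star x * x) = f (star x * x)" for x by (rule re_sa) simp
  have "positive_functional star \<iota> \<Phi>"
  proof unfold_locales
    show "\<Phi> (star x) = cnj (\<Phi> x)" for x
      using re_star[of "\<iota> * x"] by (simp add: \<Phi>_def complex_eq_iff re_star iota_commute re_neg)
    show "\<Phi> (\<iota> * x) = \<i> * \<Phi> x" for x by (simp add: \<Phi>_def complex_eq_iff re_neg)
    show "0 \<le> Re (\<Phi> (star x * x))" for x
      using f_pos[OF pos_star_mult] by (simp add: \<Phi>_def rp)
    show "Re (\<Phi> (star x * x)) \<le> (norm x)\<^sup>2" for x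
      using f_norm[of "star x * x"] by (simp add: \<Phi>_def rp norm_star_mult)
  qed (auto simp: \<Phi>_def complex_eq_iff re_add re_scale algebra_simps)
  moreover have "Re (\<Phi> (star a * a)) = (norm a)\<^sup>2"
    using pa f(3) f_norm[of a'] by (simp add: \<Phi>_def rp a'_def norm_star_mult)
  ultimately show thesis using that by blast
qed

end

section \<open>Subalgebras, isomorphic copies and products\<close>

lemma complete_wrtD:
  assumes "complete_wrt V nrm" "\<And>n. s n \<in> vcarrier V"
    "\<And>e. e > 0 \<Longrightarrow> \<exists>N. \<forall>m\<ge>N. \<forall>n\<ge>N. nrm (vdiff V (s m) (s n)) < e"
  obtains l where "l \<in> vcarrier V" "(\<lambda>n. nrm (vdiff V (s n) l)) \<longlonglongrightarrow> 0"
proof -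
  have "(\<forall>n. s n \<in> vcarrier V) \<and>
      (\<forall>e>0. \<exists>N. \<forall>m\<ge>N. \<forall>n\<ge>N. nrm (vdiff V (s m) (s n)) < e)"
    using assms(2,3) by blast
  from assms(1)[unfolded complete_wrt_def, THEN spec, THEN mp, OF this]
  show thesis using that by blast
qed

context complex_vector_space
begin

lemma vdiff_closed: "\<lbrakk>x \<in> vcarrier V; y \<in> vcarrier V\<rbrakk> \<Longrightarrow> vdiff V x y \<in> vcarrier V"
  by (simp add: vdiff_def add_closed scale_closed)

lemmas closed = zero_closed add_closed scale_closed vdiff_closed

lemma add_left_commute: "\<lbrakk>x \<in> vcarrier V; y \<in> vcarrier V; z \<in> vcarrier V\<rbrakk>
    \<Longrightarrow> vadd V x (vadd V y z) = vadd V y (vadd V x z)"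
  by (metis add_assoc add_commute)

lemmas add_ac = add_assoc add_commute add_left_commute

lemma zero_add: "x \<in> vcarrier V \<Longrightarrow> vadd V (vzero V) x = x"
  using add_zero add_commute zero_closed by simp

lemma scale_zero_left: "x \<in> vcarrier V \<Longrightarrow> vscale V 0 x = vzero V"
  using scale_add_left[of x 1 "-1"] by (simp add: scale_one add_inverse)

lemma scale_zero_right: "vscale V c (vzero V) = vzero V"
  using scale_scale[OF zero_closed, of c 0] by (simp add: scale_zero_left zero_closed)

lemma vdiff_self: "x \<in> vcarrier V \<Longrightarrow> vdiff V x x = vzero V"
  by (simp add: vdiff_def add_inverse)

lemma vdiff_add_cancel: "\<lbrakk>x \<in> vcarrier V; y \<in> vcarrier V\<rbrakk> \<Longrightarrow> vadd V (vdiff V x y) y = x"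
  using add_inverse[of y] by (simp add: vdiff_def closed add_ac add_zero)

lemma vdiff_add_vdiff: "\<lbrakk>x \<in> vcarrier V; y \<in> vcarrier V; z \<in> vcarrier V\<rbrakk>
    \<Longrightarrow> vadd V (vdiff V x y) (vdiff V y z) = vdiff V x z"
proof -
  assume a: "x \<in> vcarrier V" "y \<in> vcarrier V" "z \<in> vcarrier V"
  have "vadd V (vdiff V x y) (vdiff V y z) = vadd V (vadd V (vdiff V x y) y) (vscale V (-1) z)"
    using a by (simp add: vdiff_def[of V y z] closed add_assoc)
  then show ?thesis using a by (simp add: vdiff_add_cancel) (simp add: vdiff_def)
qed

lemma vdiff_eq_zero_iff: "\<lbrakk>x \<in> vcarrier V; y \<in> vcarrier V\<rbrakk> \<Longrightarrow> vdiff V x y = vzero V \<longleftrightarrow> x = y"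
  using vdiff_add_cancel[of x y] by (auto simp: vdiff_self zero_add)

lemma scale_vdiff: "\<lbrakk>x \<in> vcarrier V; y \<in> vcarrier V\<rbrakk>
    \<Longrightarrow> vscale V c (vdiff V x y) = vdiff V (vscale V c x) (vscale V c y)"
  by (simp add: vdiff_def scale_add_right closed scale_scale mult.commute)

lemma vdiff_swap: "\<lbrakk>x \<in> vcarrier V; y \<in> vcarrier V\<rbrakk> \<Longrightarrow> vscale V (-1) (vdiff V x y) = vdiff V y x"
  by (simp add: vdiff_def scale_add_right closed scale_scale scale_one add_commute)

lemma vdiff_add_add: "\<lbrakk>x \<in> vcarrier V; y \<in> vcarrier V; z \<in> vcarrier V; w \<in> vcarrier V\<rbrakk>
    \<Longrightarrow> vdiff V (vadd V x y) (vadd V z w) = vadd V (vdiff V x z) (vdiff V y w)"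
  by (simp add: vdiff_def scale_add_right closed add_ac)

end

context cstar_algebra
begin

lemmas vector_space_axioms = complex_vector_space_axioms

lemmas algebra_closed = closed mult_closed star_closed

lemma norm_zero: "anorm A (vzero A) = 0"
  using norm_eq_zero zero_closed by blast

lemma norm_star: "x \<in> vcarrier A \<Longrightarrow> anorm A (astar A x) = anorm A x"
proof -
  have le: "anorm A x \<le> anorm A (astar A x)" if x: "x \<in> vcarrier A" for x
  proof (cases "anorm A x = 0")
    case False
    have "anorm A x * anorm A x \<le> anorm A (astar A x) * anorm A x"
      using norm_star_mult[OF x] norm_mult[OF star_closed[OF x] x] by (simp add: power2_eq_square)
    then show ?thesis using False norm_nonneg[OF x] by (simp add: mult_le_cancel_right)
  qed (use norm_nonneg star_closed that in simp)
  assume "x \<in> vcarrier A"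
  then show ?thesis using le[of x] le[of "astar A x"] by (simp add: star_closed star_star)
qed

lemma norm_mult_star: "x \<in> vcarrier A \<Longrightarrow> anorm A (amult A x (astar A x)) = (anorm A x)\<^sup>2"
  using norm_star_mult[of "astar A x"] by (simp add: star_closed star_star norm_star)

lemma norm_vdiff_triangle: "\<lbrakk>x \<in> vcarrier A; y \<in> vcarrier A; z \<in> vcarrier A\<rbrakk>
    \<Longrightarrow> anorm A (vdiff A x z) \<le> anorm A (vdiff A x y) + anorm A (vdiff A y z)"
  using norm_triangle[of "vdiff A x y" "vdiff A y z"] by (simp add: vdiff_add_vdiff closed)

lemma norm_vdiff_commute: "\<lbrakk>x \<in> vcarrier A; y \<in> vcarrier A\<rbrakk>
    \<Longrightarrow> anorm A (vdiff A x y) = anorm A (vdiff A y x)"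
  using norm_scale[of "vdiff A y x" "-1"] by (simp add: vdiff_swap closed)

lemma norm_le_vdiff: "\<lbrakk>x \<in> vcarrier A; y \<in> vcarrier A\<rbrakk>
    \<Longrightarrow> anorm A x \<le> anorm A (vdiff A x y) + anorm A y"
  using norm_triangle[of "vdiff A x y" y] by (simp add: vdiff_add_cancel closed)

lemma norm_vdiff_le: "\<lbrakk>x \<in> vcarrier A; y \<in> vcarrier A\<rbrakk>
    \<Longrightarrow> anorm A (vdiff A x y) \<le> anorm A x + anorm A y"
  using norm_triangle[of x "vscale A (-1) y"] norm_scale[of y "-1"] by (simp add: vdiff_def closed)

lemma star_vdiff: "\<lbrakk>x \<in> vcarrier A; y \<in> vcarrier A\<rbrakk>
    \<Longrightarrow> astar A (vdiff A x y) = vdiff A (astar A x) (astar A y)"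
  by (simp add: vdiff_def star_add star_scale algebra_closed)

lemma cstar_subalgebra:
  assumes "Z \<subseteq> vcarrier A" "vzero A \<in> Z"
    and "\<And>x y. x \<in> Z \<Longrightarrow> y \<in> Z \<Longrightarrow> vadd A x y \<in> Z"
    and "\<And>c x. x \<in> Z \<Longrightarrow> vscale A c x \<in> Z"
    and "\<And>x y. x \<in> Z \<Longrightarrow> y \<in> Z \<Longrightarrow> amult A x y \<in> Z"
    and "\<And>x. x \<in> Z \<Longrightarrow> astar A x \<in> Z"
    and lim: "\<And>s l. (\<And>n. s n \<in> Z) \<Longrightarrow> l \<in> vcarrier A
      \<Longrightarrow> (\<lambda>n. anorm A (vdiff A (s n) l)) \<longlonglongrightarrow> 0 \<Longrightarrow> l \<in> Z"
  shows "cstar_algebra (A\<lparr>vcarrier := Z\<rparr>)"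
proof -
  have Z: "x \<in> vcarrier A" if "x \<in> Z" for x using assms(1) that by blast
  have vd: "vdiff (A\<lparr>vcarrier := Z\<rparr>) = vdiff A" by (simp add: vdiff_def fun_eq_iff)
  show ?thesis
  proof unfold_locales
    show "complete_wrt (A\<lparr>vcarrier := Z\<rparr>) (anorm (A\<lparr>vcarrier := Z\<rparr>))"
      unfolding complete_wrt_def vd
    proof (intro allI impI, elim conjE)
      fix s :: "nat \<Rightarrow> 'a"
      assume s: "\<forall>n. s n \<in> vcarrier (A\<lparr>vcarrier := Z\<rparr>)"
        "\<forall>e>0. \<exists>N. \<forall>m\<ge>N. \<forall>n\<ge>N. anorm (A\<lparr>vcarrier := Z\<rparr>) (vdiff A (s m) (s n)) < e"
      then have "s n \<in> vcarrier A" "e > 0 \<Longrightarrow> \<exists>N. \<forall>m\<ge>N. \<forall>n\<ge>N. anorm A (vdiff A (s m) (s n)) < e" for n e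
        using Z by auto
      then obtain l where "l \<in> vcarrier A" "(\<lambda>n. anorm A (vdiff A (s n) l)) \<longlonglongrightarrow> 0"
        by (rule complete_wrtD[OF complete]) blast+
      with lim[of s l] s show "\<exists>l\<in>vcarrier (A\<lparr>vcarrier := Z\<rparr>).
          (\<lambda>n. anorm (A\<lparr>vcarrier := Z\<rparr>) (vdiff A (s n) l)) \<longlonglongrightarrow> 0" by auto
    qed
  qed (auto simp: assms(2-6) Z add_ac add_zero add_inverse scale_add_right
      scale_add_left scale_scale scale_one mult_assoc mult_add_right mult_add_left mult_scale_right
      mult_scale_left star_star star_add star_scale star_mult norm_nonneg norm_eq_zero
      norm_triangle norm_scale norm_mult norm_star_mult)
qed

end

text \<open>Transport of structure along an injective code: to place an algebra in the universe it
  is enough to inject its carrier.\<close>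

definition copy_alg :: "('a \<Rightarrow> 'b) \<Rightarrow> 'a calg \<Rightarrow> 'b calg" where
  "copy_alg c A = (let d = inv_into (vcarrier A) c in
    \<lparr>vcarrier = c ` vcarrier A,
     vzero = c (vzero A),
     vadd = (\<lambda>x y. c (vadd A (d x) (d y))),
     vscale = (\<lambda>k x. c (vscale A k (d x))),
     amult = (\<lambda>x y. c (amult A (d x) (d y))),
     astar = (\<lambda>x. c (astar A (d x))),
     anorm = (\<lambda>x. anorm A (d x))\<rparr>)"

lemma copy_alg:
  assumes "cstar_algebra A" and inj: "inj_on c (vcarrier A)"
  shows "cstar_algebra (copy_alg c A)" "star_iso c A (copy_alg c A)"
proof -
  interpret cstar_algebra A by fact
  note d = inv_into_f_f[OF inj]
  have vd: "vdiff (copy_alg c A) (c x) (c y) = c (vdiff A x y)"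
    if "x \<in> vcarrier A" "y \<in> vcarrier A" for x y
    using that by (simp add: vdiff_def copy_alg_def Let_def d algebra_closed)
  show "star_iso c A (copy_alg c A)"
    using inj by (auto simp: star_iso_def star_hom_def copy_alg_def Let_def d algebra_closed bij_betw_def)
  show "cstar_algebra (copy_alg c A)"
  proof unfold_locales
    show "complete_wrt (copy_alg c A) (anorm (copy_alg c A))"
      unfolding complete_wrt_def
    proof (intro allI impI, elim conjE)
      fix s :: "nat \<Rightarrow> 'b"
      assume s: "\<forall>n. s n \<in> vcarrier (copy_alg c A)"
        "\<forall>e>0. \<exists>N. \<forall>m\<ge>N. \<forall>n\<ge>N. anorm (copy_alg c A) (vdiff (copy_alg c A) (s m) (s n)) < e"
      then have "\<forall>n. \<exists>x\<in>vcarrier A. s n = c x" by (auto simp: copy_alg_def Let_def)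
      then obtain t where t: "\<And>n. t n \<in> vcarrier A" "\<And>n. s n = c (t n)" by metis
      have an: "anorm (copy_alg c A) (c x) = anorm A x" if "x \<in> vcarrier A" for x
        using that by (simp add: copy_alg_def Let_def d)
      have "\<forall>e>0. \<exists>N. \<forall>m\<ge>N. \<forall>n\<ge>N. anorm A (vdiff A (t m) (t n)) < e"
        using s(2) by (simp add: t vd an closed)
      then obtain l where l: "l \<in> vcarrier A" "(\<lambda>n. anorm A (vdiff A (t n) l)) \<longlonglongrightarrow> 0"
        using complete_wrtD[OF complete, of t] t(1) by blast
      show "\<exists>l\<in>vcarrier (copy_alg c A).
          (\<lambda>n. anorm (copy_alg c A) (vdiff (copy_alg c A) (s n) l)) \<longlonglongrightarrow> 0"
        using l t by (intro bexI[of _ "c l"]) (auto simp: vd an closed, auto simp: copy_alg_def Let_def)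
    qed
  qed (auto simp: copy_alg_def Let_def d algebra_closed add_ac add_zero add_inverse scale_add_right
      scale_add_left scale_scale scale_one mult_assoc mult_add_right mult_add_left mult_scale_right
      mult_scale_left star_star star_add star_scale star_mult norm_nonneg norm_eq_zero inj_on_eq_iff[OF inj]
      norm_triangle norm_scale norm_mult norm_star_mult)
qed

lemma star_hom_compose:
  "star_hom \<phi> A B \<Longrightarrow> star_hom \<psi> B C \<Longrightarrow> star_hom (\<lambda>x. \<psi> (\<phi> x)) A C"
  by (auto simp: star_hom_def Pi_iff)

lemma star_hom_closed: "star_hom \<phi> A B \<Longrightarrow> x \<in> vcarrier A \<Longrightarrow> \<phi> x \<in> vcarrier B"
  by (auto simp: star_hom_def)

lemma star_iso_hom: "star_iso \<phi> A B \<Longrightarrow> star_hom \<phi> A B"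
  by (simp add: star_iso_def)

lemma star_iso_inj: "star_iso \<phi> A B \<Longrightarrow> inj_on \<phi> (vcarrier A)"
  by (simp add: star_iso_def bij_betw_def)

lemma star_iso_inverse:
  assumes "cstar_algebra A" "star_iso \<phi> A B"
  shows "star_hom (inv_into (vcarrier A) \<phi>) B A"
proof -
  interpret cstar_algebra A by fact
  have bij: "bij_betw \<phi> (vcarrier A) (vcarrier B)" and hom: "star_hom \<phi> A B"
    using assms by (auto simp: star_iso_def)
  have img: "vcarrier B = \<phi> ` vcarrier A" and inj: "inj_on \<phi> (vcarrier A)"
    using bij by (auto simp: bij_betw_def)
  let ?d = "inv_into (vcarrier A) \<phi>"
  have d: "?d (\<phi> x) = x" if "x \<in> vcarrier A" for x
    using inj that by simp
  have h: "vadd B (\<phi> x) (\<phi> y) = \<phi> (vadd A x y)" "vscale B c (\<phi> x) = \<phi> (vscale A c x)"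
    "amult B (\<phi> x) (\<phi> y) = \<phi> (amult A x y)" "astar B (\<phi> x) = \<phi> (astar A x)"
    if "x \<in> vcarrier A" "y \<in> vcarrier A" for x y c
    using hom that by (auto simp: star_hom_def)
  show ?thesis
    unfolding star_hom_def img by (auto simp: h d algebra_closed)
qed

lemma star_iso_inv_apply:
  "star_iso \<phi> A B \<Longrightarrow> x \<in> vcarrier A \<Longrightarrow> inv_into (vcarrier A) \<phi> (\<phi> x) = x"
  by (simp add: star_iso_inj)

lemma cstar_relation_hom:
  assumes "cstar_relation X R" "cstar_algebra A" "cstar_algebra B" "star_hom \<phi> A B"
    "f \<in> X \<rightarrow>\<^sub>E vcarrier A" "R A f"
  shows "R B (\<lambda>x\<in>X. \<phi> (f x))"
  by (rule assms(1)[unfolded cstar_relation_def, THEN conjunct2, THEN conjunct2, THEN conjunct1, THEN spec[of _ A], THEN spec[of _ B],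
        THEN spec[of _ \<phi>], THEN spec[of _ f], THEN mp]) (intro conjI assms(2-))

text \<open>(R3) across types. The homomorphism between the two copies in the universe goes back
  through the inverse of the coding of \<open>A\<close>, along \<open>\<phi>\<close>, and out
  through the code \<open>c\<close>, which supplies the copy of \<open>B\<close>.\<close>

lemma is_representation_hom:
  fixes R :: "('x, 'k) relation" and c :: "'b \<Rightarrow> ('x, 'k) universe"
  assumes R: "cstar_relation X R" and f: "is_representation R X A f"
    and B: "cstar_algebra B" and \<phi>: "star_hom \<phi> A B" and c: "inj_on c (vcarrier B)"
  shows "is_representation R X B (\<lambda>x\<in>X. \<phi> (f x))"
proof -
  obtain A' \<psi> where A': "cstar_algebra A'" "star_iso \<psi> A A'" "R A' (\<lambda>x\<in>X. \<psi> (f x))"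
    and A: "cstar_algebra A" and fA: "f \<in> X \<rightarrow>\<^sub>E vcarrier A"
    using f by (auto simp: is_representation_def)
  note B' = copy_alg[OF B c]
  let ?h = "\<lambda>y. c (\<phi> (inv_into (vcarrier A) \<psi> y))"
  have hom: "star_hom ?h A' (copy_alg c B)"
    using star_hom_compose[OF star_hom_compose[OF star_iso_inverse[OF A A'(2)] \<phi>] star_iso_hom[OF B'(2)]] .
  have fA': "(\<lambda>x\<in>X. \<psi> (f x)) \<in> X \<rightarrow>\<^sub>E vcarrier A'"
    using star_hom_closed[OF star_iso_hom[OF A'(2)]] fA by (auto simp: PiE_iff)
  have "R (copy_alg c B) (\<lambda>x\<in>X. ?h ((\<lambda>x\<in>X. \<psi> (f x)) x))"
    by (rule cstar_relation_hom[OF R A'(1) B'(1) hom fA' A'(3)])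
  moreover have "(\<lambda>x\<in>X. ?h ((\<lambda>x\<in>X. \<psi> (f x)) x)) = (\<lambda>x\<in>X. c ((\<lambda>x\<in>X. \<phi> (f x)) x))"
    using fA by (auto simp: fun_eq_iff PiE_iff star_iso_inv_apply[OF A'(2)])
  ultimately show ?thesis
    using B B' fA star_hom_closed[OF \<phi>] unfolding is_representation_def by (auto simp: PiE_iff)
qed

lemma cstar_relation_inj:
  assumes "cstar_relation X R" "cstar_algebra A" "cstar_algebra B" "star_hom \<phi> A B"
    "inj_on \<phi> (vcarrier A)" "f \<in> X \<rightarrow>\<^sub>E vcarrier A" "R B (\<lambda>x\<in>X. \<phi> (f x))"
  shows "R A f"
  by (rule assms(1)[unfolded cstar_relation_def, THEN conjunct2, THEN conjunct1, THEN spec[of _ A], THEN spec[of _ B],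
        THEN spec[of _ \<phi>], THEN spec[of _ f], THEN mp]) (intro conjI assms(2-))

text \<open>(R2) across types. No code for \<open>A\<close> has to be given: the injection
  \<open>\<phi>\<close> followed by the coding of \<open>B\<close> is one.\<close>

lemma is_representation_inj:
  fixes R :: "('x, 'k) relation"
  assumes R: "cstar_relation X R" and f: "is_representation R X B (\<lambda>x\<in>X. \<phi> (f x))"
    and A: "cstar_algebra A" and \<phi>: "star_hom \<phi> A B" "inj_on \<phi> (vcarrier A)"
    and fA: "f \<in> X \<rightarrow>\<^sub>E vcarrier A"
  shows "is_representation R X A f"
proof -
  obtain B' \<psi> where B': "cstar_algebra B'" "star_iso \<psi> B B'" "R B' (\<lambda>x\<in>X. \<psi> ((\<lambda>x\<in>X. \<phi> (f x)) x))"
    using f by (auto simp: is_representation_def)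
  let ?c = "\<lambda>a. \<psi> (\<phi> a)"
  have hom: "star_hom ?c A B'" using star_hom_compose[OF \<phi>(1) star_iso_hom[OF B'(2)]] .
  have inj: "inj_on ?c (vcarrier A)"
    using \<phi> star_iso_inj[OF B'(2)] by (auto simp: inj_on_def star_hom_closed)
  note A' = copy_alg[OF A inj]
  let ?h = "\<lambda>y. ?c (inv_into (vcarrier A) ?c y)"
  have h: "?h (?c a) = ?c a" if "a \<in> vcarrier A" for a
    using inv_into_f_f[OF inj that] by simp
  have "star_hom ?h (copy_alg ?c A) B'"
    using star_hom_compose[OF star_iso_inverse[OF A A'(2)] hom] .
  moreover have "inj_on ?h (vcarrier (copy_alg ?c A))"
    by (rule inj_onI) (auto simp: copy_alg_def Let_def h)
  moreover have "(\<lambda>x\<in>X. ?c (f x)) \<in> X \<rightarrow>\<^sub>E vcarrier (copy_alg ?c A)"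
    using fA by (auto simp: PiE_iff copy_alg_def Let_def)
  moreover have "(\<lambda>x\<in>X. ?h ((\<lambda>x\<in>X. ?c (f x)) x)) = (\<lambda>x\<in>X. \<psi> ((\<lambda>x\<in>X. \<phi> (f x)) x))"
    using fA h by (auto simp: fun_eq_iff PiE_iff)
  ultimately have "R (copy_alg ?c A) (\<lambda>x\<in>X. ?c (f x))"
    using B'(3) by (intro cstar_relation_inj[OF R A'(1) B'(1), of ?h]) simp_all
  then show ?thesis
    using A A' fA unfolding is_representation_def by auto
qed

section \<open>Products of C*-algebras\<close>

lemma prod_alg_norm_upper:
  assumes "a \<in> vcarrier (prod_alg I A)" "i \<in> I"
  shows "anorm (A i) (a i) \<le> anorm (prod_alg I A) a"
  using assms by (auto simp: prod_alg_def intro!: cSup_upper)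

lemma prod_alg_norm_least:
  assumes "0 \<le> K" "\<And>i. i \<in> I \<Longrightarrow> anorm (A i) (a i) \<le> K"
  shows "anorm (prod_alg I A) a \<le> K"
  using assms by (auto simp: prod_alg_def intro!: cSup_least)

lemma prod_alg_norm_nonneg:
  "a \<in> vcarrier (prod_alg I A) \<Longrightarrow> 0 \<le> anorm (prod_alg I A) a"
  by (auto simp: prod_alg_def intro!: cSup_upper)

lemma prod_alg_carrierI:
  assumes "a \<in> (\<Pi>\<^sub>E i\<in>I. vcarrier (A i))" "\<And>i. i \<in> I \<Longrightarrow> anorm (A i) (a i) \<le> K"
  shows "a \<in> vcarrier (prod_alg I A)"
  using assms by (auto simp: prod_alg_def intro!: bdd_aboveI2)

lemma prod_alg_component: "a \<in> vcarrier (prod_alg I A) \<Longrightarrow> i \<in> I \<Longrightarrow> a i \<in> vcarrier (A i)"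
  by (auto simp: prod_alg_def)

lemma prod_alg_ops [simp]:
  "vzero (prod_alg I A) = (\<lambda>i\<in>I. vzero (A i))"
  "vadd (prod_alg I A) a b = (\<lambda>i\<in>I. vadd (A i) (a i) (b i))"
  "vscale (prod_alg I A) c a = (\<lambda>i\<in>I. vscale (A i) c (a i))"
  "amult (prod_alg I A) a b = (\<lambda>i\<in>I. amult (A i) (a i) (b i))"
  "astar (prod_alg I A) a = (\<lambda>i\<in>I. astar (A i) (a i))"
  by (auto simp: prod_alg_def)

lemma vdiff_prod_alg: "vdiff (prod_alg I A) a b = (\<lambda>i\<in>I. vdiff (A i) (a i) (b i))"
  by (auto simp: vdiff_def)

lemma cstar_prod_alg:
  assumes A: "\<And>i. i \<in> I \<Longrightarrow> cstar_algebra (A i)"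
  shows "cstar_algebra (prod_alg I A)"
proof -
  let ?P = "prod_alg I A"
  note cvs = cstar_algebra.vector_space_axioms[OF A]
  note closed = complex_vector_space.closed[OF cvs] cstar_algebra.mult_closed[OF A] cstar_algebra.star_closed[OF A]
  note up = prod_alg_norm_upper[of _ I A] and comp = prod_alg_component[of _ I A]
  have eqI: "a = b" if "a \<in> vcarrier ?P" "b \<in> vcarrier ?P" "\<And>i. i \<in> I \<Longrightarrow> a i = b i" for a b
    using that by (intro PiE_ext[of a I "\<lambda>i. vcarrier (A i)" b]) (auto simp: prod_alg_def)
  have zc: "vzero ?P \<in> vcarrier ?P"
    by (rule prod_alg_carrierI[where K = 0]) (auto simp: closed cstar_algebra.norm_zero[OF A])
  have ac: "vadd ?P a b \<in> vcarrier ?P" if "a \<in> vcarrier ?P" "b \<in> vcarrier ?P" for a b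
  proof (rule prod_alg_carrierI[where K = "anorm ?P a + anorm ?P b"])
    show "anorm (A i) (vadd ?P a b i) \<le> anorm ?P a + anorm ?P b" if i: "i \<in> I" for i
      using cstar_algebra.norm_triangle[OF A[OF i], of "a i" "b i"] up[OF _ i] comp[OF _ i]
        \<open>a \<in> _\<close> \<open>b \<in> _\<close> i by (smt (verit) prod_alg_ops(2) restrict_apply')
  qed (use that comp in \<open>auto simp: closed\<close>)
  have sc: "vscale ?P c a \<in> vcarrier ?P" if a: "a \<in> vcarrier ?P" for a c
    by (rule prod_alg_carrierI[where K = "cmod c * anorm ?P a"])
      (use a comp in \<open>auto simp: closed cstar_algebra.norm_scale[OF A] intro!: mult_left_mono up\<close>)
  have mc: "amult ?P a b \<in> vcarrier ?P" and mn: "anorm ?P (amult ?P a b) \<le> anorm ?P a * anorm ?P b"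
    if a: "a \<in> vcarrier ?P" and b: "b \<in> vcarrier ?P" for a b
  proof -
    have *: "anorm (A i) (amult ?P a b i) \<le> anorm ?P a * anorm ?P b" if i: "i \<in> I" for i
    proof -
      have "anorm (A i) (amult (A i) (a i) (b i)) \<le> anorm (A i) (a i) * anorm (A i) (b i)"
        using cstar_algebra.norm_mult[OF A[OF i]] comp[OF _ i] a b by blast
      also have "\<dots> \<le> anorm ?P a * anorm ?P b"
        by (intro mult_mono up a b i prod_alg_norm_nonneg cstar_algebra.norm_nonneg[OF A[OF i]] comp)
      finally show ?thesis using i by simp
    qed
    show "amult ?P a b \<in> vcarrier ?P"
      by (rule prod_alg_carrierI[OF _ *]) (use a b comp in \<open>auto simp: closed\<close>)
    show "anorm ?P (amult ?P a b) \<le> anorm ?P a * anorm ?P b"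
      by (rule prod_alg_norm_least[OF _ *]) (use a b prod_alg_norm_nonneg in \<open>blast intro: mult_nonneg_nonneg\<close>)
  qed
  have stc: "astar ?P a \<in> vcarrier ?P" and stn: "anorm ?P (astar ?P a) \<le> anorm ?P a"
    if a: "a \<in> vcarrier ?P" for a
  proof -
    have *: "anorm (A i) (astar ?P a i) \<le> anorm ?P a" if i: "i \<in> I" for i
      using cstar_algebra.norm_star[OF A[OF i] comp[OF a i]] up[OF a i] i by simp
    show "astar ?P a \<in> vcarrier ?P"
      by (rule prod_alg_carrierI[OF _ *]) (use a comp in \<open>auto simp: closed\<close>)
    show "anorm ?P (astar ?P a) \<le> anorm ?P a"
      by (rule prod_alg_norm_least[OF _ *]) (use a prod_alg_norm_nonneg in auto)
  qed
  show ?thesis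
  proof unfold_locales
    show "complete_wrt ?P (anorm ?P)"
      unfolding complete_wrt_def
    proof (intro allI impI, elim conjE)
      fix s :: "nat \<Rightarrow> 'a \<Rightarrow> 'b"
      assume s: "\<forall>n. s n \<in> vcarrier ?P"
        and Cauchy: "\<forall>e>0. \<exists>N. \<forall>m\<ge>N. \<forall>n\<ge>N. anorm ?P (vdiff ?P (s m) (s n)) < e"
      have dc: "vdiff ?P (s m) (s n) \<in> vcarrier ?P" for m n
        using s by (simp add: vdiff_def ac sc del: prod_alg_ops)
      have Ci: "anorm (A i) (vdiff (A i) (s m i) (s n i)) \<le> anorm ?P (vdiff ?P (s m) (s n))"
        if "i \<in> I" for i m n
        using up[OF dc that, of m n] that by (simp add: vdiff_prod_alg)
      have "\<exists>l\<in>vcarrier (A i). (\<lambda>n. anorm (A i) (vdiff (A i) (s n i) l)) \<longlonglongrightarrow> 0" if i: "i \<in> I" for i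
      proof -
        have C: "\<exists>N. \<forall>m\<ge>N. \<forall>n\<ge>N. anorm (A i) (vdiff (A i) (s m i) (s n i)) < e" if "e > 0" for e
          using Cauchy[rule_format, OF that] Ci[OF i] by (meson le_less_trans)
        have "s n i \<in> vcarrier (A i)" for n
          using comp[OF s[rule_format] i] .
        then show ?thesis
          by (rule complete_wrtD[OF cstar_algebra.complete[OF A[OF i]], of "\<lambda>n. s n i", OF _ C]) blast+
      qed
      then obtain l where l: "\<And>i. i \<in> I \<Longrightarrow> l i \<in> vcarrier (A i)"
        "\<And>i. i \<in> I \<Longrightarrow> (\<lambda>n. anorm (A i) (vdiff (A i) (s n i) (l i))) \<longlonglongrightarrow> 0" by metis
      \<comment> \<open>The coordinatewise limits are attained uniformly in \<open>i\<close>, since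
        the Cauchy estimate in the product norm does not depend on \<open>i\<close>; let m tend to
        infinity in the triangle inequality.\<close>
      have unif: "\<exists>N. \<forall>n\<ge>N. \<forall>i\<in>I. anorm (A i) (vdiff (A i) (s n i) (l i)) \<le> e" if "e > 0" for e
      proof -
        obtain N where N: "\<And>m n. m \<ge> N \<Longrightarrow> n \<ge> N \<Longrightarrow> anorm ?P (vdiff ?P (s m) (s n)) < e"
          using Cauchy[rule_format, OF \<open>e > 0\<close>] by blast
        have "anorm (A i) (vdiff (A i) (s n i) (l i)) \<le> e" if n: "n \<ge> N" and i: "i \<in> I" for n i
        proof (rule tendsto_le[OF trivial_limit_sequentially])
          show "(\<lambda>m. e + anorm (A i) (vdiff (A i) (s m i) (l i))) \<longlonglongrightarrow> e"
            using tendsto_add[OF tendsto_const l(2)[OF i], of e] by simp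
          show "\<forall>\<^sub>F m in sequentially. anorm (A i) (vdiff (A i) (s n i) (l i))
              \<le> e + anorm (A i) (vdiff (A i) (s m i) (l i))"
            using eventually_ge_at_top[of N]
          proof eventually_elim
            case (elim m)
            have "anorm (A i) (vdiff (A i) (s n i) (l i))
                \<le> anorm (A i) (vdiff (A i) (s n i) (s m i)) + anorm (A i) (vdiff (A i) (s m i) (l i))"
              using cstar_algebra.norm_vdiff_triangle[OF A[OF i]] comp[OF _ i] s l(1)[OF i] by blast
            then show ?case using Ci[OF i, of n m] N[OF n elim] by linarith
          qed
        qed (rule tendsto_const)
        then show ?thesis by blast
      qed
      define L where "L = (\<lambda>i\<in>I. l i)"
      obtain N where N: "\<forall>n\<ge>N. \<forall>i\<in>I. anorm (A i) (vdiff (A i) (s n i) (l i)) \<le> 1"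
        using unif[of 1] by auto
      have "L \<in> vcarrier ?P"
      proof (rule prod_alg_carrierI[where K = "1 + anorm ?P (s N)"])
        fix i assume i: "i \<in> I"
        have "anorm (A i) (l i) \<le> anorm (A i) (vdiff (A i) (l i) (s N i)) + anorm (A i) (s N i)"
          using cstar_algebra.norm_le_vdiff[OF A[OF i]] comp[OF _ i] s l(1)[OF i] by blast
        moreover have "anorm (A i) (vdiff (A i) (l i) (s N i)) = anorm (A i) (vdiff (A i) (s N i) (l i))"
          using cstar_algebra.norm_vdiff_commute[OF A[OF i]] comp[OF _ i] s l(1)[OF i] by blast
        ultimately show "anorm (A i) (L i) \<le> 1 + anorm ?P (s N)"
          using N i up[OF s[rule_format] i, of N] by (fastforce simp: L_def)
      qed (auto simp: L_def l)
      moreover have "(\<lambda>n. anorm ?P (vdiff ?P (s n) L)) \<longlonglongrightarrow> 0"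
      proof (rule LIMSEQ_I)
        fix r :: real assume "r > 0"
        obtain N where N: "\<forall>n\<ge>N. \<forall>i\<in>I. anorm (A i) (vdiff (A i) (s n i) (l i)) \<le> r/2"
          using unif[of "r/2"] \<open>r > 0\<close> by auto
        have "norm (anorm ?P (vdiff ?P (s n) L) - 0) < r" if "n \<ge> N" for n
        proof -
          have "anorm ?P (vdiff ?P (s n) L) \<le> r/2"
            by (rule prod_alg_norm_least) (use N that \<open>r > 0\<close> in \<open>auto simp: vdiff_prod_alg L_def\<close>)
          moreover have "0 \<le> anorm ?P (vdiff ?P (s n) L)"
            using s \<open>L \<in> _\<close> by (intro prod_alg_norm_nonneg) (simp add: vdiff_def ac sc del: prod_alg_ops)
          ultimately show ?thesis using \<open>r > 0\<close> by simp
        qed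
        then show "\<exists>no. \<forall>n\<ge>no. norm (anorm ?P (vdiff ?P (s n) L) - 0) < r" by blast
      qed
      ultimately show "\<exists>l\<in>vcarrier ?P. (\<lambda>n. anorm ?P (vdiff ?P (s n) l)) \<longlonglongrightarrow> 0" by blast
    qed
  next
    fix a assume a: "a \<in> vcarrier ?P"
    show "anorm ?P a = 0 \<longleftrightarrow> a = vzero ?P"
    proof
      assume n: "anorm ?P a = 0"
      have "a i = vzero (A i)" if i: "i \<in> I" for i
        using up[OF a i] n cstar_algebra.norm_nonneg[OF A[OF i] comp[OF a i]]
          cstar_algebra.norm_eq_zero[OF A[OF i] comp[OF a i]] by linarith
      then show "a = vzero ?P" by (intro eqI a zc) simp
    next
      assume "a = vzero ?P"
      then have "anorm ?P a \<le> 0"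
        by (intro prod_alg_norm_least) (auto simp: cstar_algebra.norm_zero[OF A])
      then show "anorm ?P a = 0" using prod_alg_norm_nonneg[OF a] by simp
    qed
    show "anorm ?P (vscale ?P c a) = cmod c * anorm ?P a" for c
    proof (rule antisym)
      have le: "anorm ?P (vscale ?P c a) \<le> cmod c * anorm ?P a" if a: "a \<in> vcarrier ?P" for a c
        by (rule prod_alg_norm_least) (use a comp prod_alg_norm_nonneg[OF a] in
            \<open>auto simp: cstar_algebra.norm_scale[OF A] intro!: mult_left_mono up\<close>)
      show "anorm ?P (vscale ?P c a) \<le> cmod c * anorm ?P a" by (rule le[OF a])
      show "cmod c * anorm ?P a \<le> anorm ?P (vscale ?P c a)"
      proof (cases "c = 0")
        case True
        then show ?thesis using prod_alg_norm_nonneg[OF sc[OF a]] by simp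
      next
        case False
        have "vscale ?P (1/c) (vscale ?P c a) = a"
          using a comp False by (intro eqI sc) (auto simp: complex_vector_space.scale_scale[OF cvs]
              complex_vector_space.scale_one[OF cvs])
        then have "anorm ?P a \<le> cmod (1/c) * anorm ?P (vscale ?P c a)"
          using le[OF sc[OF a], of "1/c"] by metis
        then show ?thesis using False by (simp add: norm_divide field_simps)
      qed
    qed
    show "anorm ?P (amult ?P (astar ?P a) a) = (anorm ?P a)\<^sup>2"
    proof (rule antisym)
      show "anorm ?P (amult ?P (astar ?P a) a) \<le> (anorm ?P a)\<^sup>2"
        using mn[OF stc[OF a] a] mult_right_mono[OF stn[OF a] prod_alg_norm_nonneg[OF a]]
        by (simp add: power2_eq_square)
      have nn: "0 \<le> anorm ?P (amult ?P (astar ?P a) a)"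
        by (intro prod_alg_norm_nonneg mc stc a)
      have "anorm ?P a \<le> sqrt (anorm ?P (amult ?P (astar ?P a) a))"
      proof (rule prod_alg_norm_least)
        fix i assume i: "i \<in> I"
        have "(anorm (A i) (a i))\<^sup>2 = anorm (A i) (amult ?P (astar ?P a) a i)"
          using cstar_algebra.norm_star_mult[OF A[OF i] comp[OF a i]] i by simp
        also have "\<dots> \<le> anorm ?P (amult ?P (astar ?P a) a)" by (intro up mc stc a i)
        finally show "anorm (A i) (a i) \<le> sqrt (anorm ?P (amult ?P (astar ?P a) a))"
          by (rule real_le_rsqrt)
      qed (use nn in simp)
      then show "(anorm ?P a)\<^sup>2 \<le> anorm ?P (amult ?P (astar ?P a) a)"
        using nn prod_alg_norm_nonneg[OF a] by (metis power_mono real_sqrt_pow2)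
    qed
  next
    fix a b assume a: "a \<in> vcarrier ?P" and b: "b \<in> vcarrier ?P"
    show "anorm ?P (vadd ?P a b) \<le> anorm ?P a + anorm ?P b"
    proof (rule prod_alg_norm_least)
      fix i assume i: "i \<in> I"
      have "anorm (A i) (vadd (A i) (a i) (b i)) \<le> anorm (A i) (a i) + anorm (A i) (b i)"
        using cstar_algebra.norm_triangle[OF A[OF i]] comp[OF _ i] a b by blast
      then show "anorm (A i) (vadd ?P a b i) \<le> anorm ?P a + anorm ?P b"
        using up[OF a i] up[OF b i] i by simp
    qed (use prod_alg_norm_nonneg[OF a] prod_alg_norm_nonneg[OF b] in simp)
  \<comment> \<open>What remains is either one of the closure and norm facts above or an identity,
    which \<open>eqI\<close> reduces to the coordinates.\<close>
  qed (rule zc ac sc mc mn stc prod_alg_norm_nonneg; assumption |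
      (rule eqI; (intro zc ac sc mc stc; assumption)?;
        simp add: comp closed complex_vector_space.add_ac[OF cvs] complex_vector_space.add_zero[OF cvs]
          complex_vector_space.add_inverse[OF cvs] complex_vector_space.scale_add_right[OF cvs]
          complex_vector_space.scale_add_left[OF cvs] complex_vector_space.scale_scale[OF cvs]
          complex_vector_space.scale_one[OF cvs] cstar_algebra.mult_assoc[OF A]
          cstar_algebra.mult_add_right[OF A] cstar_algebra.mult_add_left[OF A]
          cstar_algebra.mult_scale_right[OF A] cstar_algebra.mult_scale_left[OF A]
          cstar_algebra.star_star[OF A] cstar_algebra.star_add[OF A] cstar_algebra.star_scale[OF A]
          cstar_algebra.star_mult[OF A]))+
qed

section \<open>Unitization\<close>

definition unit_act :: "('a, 'm) calg_scheme \<Rightarrow> 'a \<times> complex \<Rightarrow> 'a \<Rightarrow> 'a" where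
  "unit_act A x b = vadd A (amult A (fst x) b) (vscale A (snd x) b)"

text \<open>The norm of left multiplication on \<open>A\<close> alone may be degenerate: if
  \<open>A\<close> has a unit u, the element (-u, 1) acts as 0. Inserting the modulus of the scalar
  part, itself a C*-seminorm, makes the supremum a C*-norm whether or not \<open>A\<close> is
  unital.\<close>

definition unit_alg :: "('a, 'm) calg_scheme \<Rightarrow> ('a \<times> complex) calg" where
  "unit_alg A =
    \<lparr>vcarrier = vcarrier A \<times> UNIV,
     vzero = (vzero A, 0),
     vadd = (\<lambda>x y. (vadd A (fst x) (fst y), snd x + snd y)),
     vscale = (\<lambda>c x. (vscale A c (fst x), c * snd x)),
     amult = (\<lambda>x y. (vadd A (amult A (fst x) (fst y))
       (vadd A (vscale A (snd x) (fst y)) (vscale A (snd y) (fst x))), snd x * snd y)),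
     astar = (\<lambda>x. (astar A (fst x), cnj (snd x))),
     anorm = (\<lambda>x. Sup (insert (cmod (snd x))
       {anorm A (unit_act A x b) |b. b \<in> vcarrier A \<and> anorm A b \<le> 1}))\<rparr>"

lemma unit_alg_ops [simp]:
  "x \<in> vcarrier (unit_alg A) \<longleftrightarrow> fst x \<in> vcarrier A"
  "vzero (unit_alg A) = (vzero A, 0)"
  "vadd (unit_alg A) x y = (vadd A (fst x) (fst y), snd x + snd y)"
  "vscale (unit_alg A) c x = (vscale A c (fst x), c * snd x)"
  "amult (unit_alg A) x y = (vadd A (amult A (fst x) (fst y))
       (vadd A (vscale A (snd x) (fst y)) (vscale A (snd y) (fst x))), snd x * snd y)"
  "astar (unit_alg A) x = (astar A (fst x), cnj (snd x))"
  by (cases x) (auto simp: unit_alg_def)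

lemma vdiff_unit_alg: "vdiff (unit_alg A) x y = (vdiff A (fst x) (fst y), snd x - snd y)"
  by (simp add: vdiff_def)

context cstar_algebra
begin

lemma act_closed: "\<lbrakk>fst x \<in> vcarrier A; b \<in> vcarrier A\<rbrakk> \<Longrightarrow> unit_act A x b \<in> vcarrier A"
  by (simp add: unit_act_def algebra_closed)

lemma act_norm_le: "\<lbrakk>fst x \<in> vcarrier A; b \<in> vcarrier A\<rbrakk>
    \<Longrightarrow> anorm A (unit_act A x b) \<le> (anorm A (fst x) + cmod (snd x)) * anorm A b"
  using norm_triangle[of "amult A (fst x) b" "vscale A (snd x) b"] norm_mult[of "fst x" b]
  by (simp add: unit_act_def algebra_closed norm_scale distrib_right)

lemma act_scale: "\<lbrakk>fst x \<in> vcarrier A; b \<in> vcarrier A\<rbrakk>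
    \<Longrightarrow> unit_act A x (vscale A c b) = vscale A c (unit_act A x b)"
  by (simp add: unit_act_def algebra_closed mult_scale_right scale_add_right scale_scale mult.commute)

lemma act_mult: "\<lbrakk>fst x \<in> vcarrier A; fst y \<in> vcarrier A; b \<in> vcarrier A\<rbrakk>
    \<Longrightarrow> unit_act A (amult (unit_alg A) x y) b = unit_act A x (unit_act A y b)"
  by (simp add: unit_act_def algebra_closed mult_assoc mult_add_left mult_add_right
      mult_scale_left mult_scale_right scale_add_right scale_scale add_ac)

text \<open>Moves the action across the star, so that the C*-identity of \<open>A\<close> at xb can
  be read as a statement about the product of \<open>astar x\<close> and x.\<close>

lemma act_star: "\<lbrakk>fst x \<in> vcarrier A; b \<in> vcarrier A; c \<in> vcarrier A\<rbrakk>
    \<Longrightarrow> amult A (astar A (unit_act A x b)) c = amult A (astar A b) (unit_act A (astar (unit_alg A) x) c)"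
  by (simp add: unit_act_def algebra_closed star_add star_mult star_scale mult_assoc mult_add_left
      mult_add_right mult_scale_left mult_scale_right)

lemma unit_norm_bdd:
  "fst x \<in> vcarrier A \<Longrightarrow> bdd_above (insert (cmod (snd x))
       {anorm A (unit_act A x b) |b. b \<in> vcarrier A \<and> anorm A b \<le> 1})"
proof -
  assume x: "fst x \<in> vcarrier A"
  have "anorm A (unit_act A x b) \<le> anorm A (fst x) + cmod (snd x)"
    if "b \<in> vcarrier A" "anorm A b \<le> 1" for b
    by (rule order_trans[OF act_norm_le[OF x]])
      (use that x norm_nonneg[of "fst x"] in \<open>auto intro: mult_left_le\<close>)
  then show ?thesis
    by (auto intro!: bdd_aboveI[where M = "anorm A (fst x) + cmod (snd x)"] simp: x norm_nonneg)
qed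

lemma unit_norm_snd: "fst x \<in> vcarrier A \<Longrightarrow> cmod (snd x) \<le> anorm (unit_alg A) x"
  using cSup_upper[OF _ unit_norm_bdd] by (simp add: unit_alg_def)

lemma unit_norm_nonneg: "fst x \<in> vcarrier A \<Longrightarrow> 0 \<le> anorm (unit_alg A) x"
  using unit_norm_snd[of x] by (meson norm_ge_zero order_trans)

lemma unit_norm_act:
  assumes x: "fst x \<in> vcarrier A" and b: "b \<in> vcarrier A"
  shows "anorm A (unit_act A x b) \<le> anorm (unit_alg A) x * anorm A b"
proof (cases "anorm A b = 0")
  case True
  then show ?thesis using act_norm_le[OF x b] by simp
next
  case False
  then have pos: "anorm A b > 0" using norm_nonneg[OF b] by simp
  define c where "c = vscale A (of_real (1 / anorm A b)) b"
  have c: "c \<in> vcarrier A" "anorm A c \<le> 1"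
    using b pos by (simp_all add: c_def closed norm_scale norm_divide)
  have "anorm A (unit_act A x c) \<le> anorm (unit_alg A) x"
    using cSup_upper[OF _ unit_norm_bdd[OF x]] c by (auto simp: unit_alg_def)
  moreover have "anorm A (unit_act A x c) = anorm A (unit_act A x b) / anorm A b"
    using pos x b by (simp add: c_def act_scale norm_scale act_closed norm_divide)
  ultimately show ?thesis using pos by (simp add: field_simps)
qed

lemma unit_norm_least:
  assumes "cmod (snd x) \<le> K"
    and "\<And>b. b \<in> vcarrier A \<Longrightarrow> anorm A b \<le> 1 \<Longrightarrow> anorm A (unit_act A x b) \<le> K"
  shows "anorm (unit_alg A) x \<le> K"
  using assms by (auto simp: unit_alg_def intro!: cSup_least)

lemma unit_norm_le:
  assumes x: "fst x \<in> vcarrier A"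
  shows "anorm (unit_alg A) x \<le> anorm A (fst x) + cmod (snd x)"
proof (rule unit_norm_least)
  show "anorm A (unit_act A x b) \<le> anorm A (fst x) + cmod (snd x)"
    if "b \<in> vcarrier A" "anorm A b \<le> 1" for b
    by (rule order_trans[OF act_norm_le[OF x]])
      (use that x norm_nonneg[of "fst x"] in \<open>auto intro: mult_left_le\<close>)
qed (use norm_nonneg[OF x] in simp)

text \<open>For x = (a, l) the product of a with its star is the action of x on that star minus l
  times the star, so |a|^2 <= (|x| + |l|) |a|. Definiteness and completeness of the unitization
  thereby reduce to those of \<open>A\<close> and of the complex numbers.\<close>

lemma unit_norm_fst:
  assumes x: "fst x \<in> vcarrier A"
  shows "anorm A (fst x) \<le> anorm (unit_alg A) x + cmod (snd x)"
proof (cases "anorm A (fst x) = 0")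
  case True
  then show ?thesis using unit_norm_nonneg[OF x] by simp
next
  case False
  then have pos: "anorm A (fst x) > 0" using norm_nonneg[OF x] by simp
  let ?b = "astar A (fst x)"
  have b: "?b \<in> vcarrier A" by (rule star_closed[OF x])
  have "amult A (fst x) ?b = vdiff A (unit_act A x ?b) (vscale A (snd x) ?b)"
    using x b by (simp add: unit_act_def vdiff_def add_assoc add_inverse add_zero algebra_closed)
  then have "(anorm A (fst x))\<^sup>2 \<le> anorm A (unit_act A x ?b) + cmod (snd x) * anorm A ?b"
    using norm_vdiff_le[of "unit_act A x ?b" "vscale A (snd x) ?b"] norm_mult_star[OF x] x b
    by (simp add: act_closed closed norm_scale)
  also have "\<dots> \<le> (anorm (unit_alg A) x + cmod (snd x)) * anorm A (fst x)"
    using unit_norm_act[OF x b] x by (simp add: norm_star algebra_simps)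
  finally show ?thesis using pos by (simp add: power2_eq_square)
qed

lemma unit_norm_embed: "a \<in> vcarrier A \<Longrightarrow> anorm (unit_alg A) (a, 0) = anorm A a"
  using unit_norm_le[of "(a, 0)"] unit_norm_fst[of "(a, 0)"] by simp

lemma unit_norm_mult:
  assumes x: "fst x \<in> vcarrier A" and y: "fst y \<in> vcarrier A"
  shows "anorm (unit_alg A) (amult (unit_alg A) x y) \<le> anorm (unit_alg A) x * anorm (unit_alg A) y"
proof (rule unit_norm_least)
  show "cmod (snd (amult (unit_alg A) x y)) \<le> anorm (unit_alg A) x * anorm (unit_alg A) y"
    using unit_norm_snd[OF x] unit_norm_snd[OF y] unit_norm_nonneg[OF x]
    by (auto simp: Real_Vector_Spaces.norm_mult intro!: mult_mono)
  fix b assume b: "b \<in> vcarrier A" "anorm A b \<le> 1"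
  have "anorm A (unit_act A (amult (unit_alg A) x y) b) = anorm A (unit_act A x (unit_act A y b))"
    using x y b by (simp only: act_mult)
  also have "\<dots> \<le> anorm (unit_alg A) x * anorm A (unit_act A y b)"
    using x y b by (intro unit_norm_act act_closed)
  also have "\<dots> \<le> anorm (unit_alg A) x * (anorm (unit_alg A) y * anorm A b)"
    using x y b by (intro mult_left_mono unit_norm_act unit_norm_nonneg)
  also have "\<dots> \<le> anorm (unit_alg A) x * anorm (unit_alg A) y"
    using x y b unit_norm_nonneg by (intro mult_left_mono mult_left_le) auto
  finally show "anorm A (unit_act A (amult (unit_alg A) x y) b)
      \<le> anorm (unit_alg A) x * anorm (unit_alg A) y" .
qed

text \<open>For |b| <= 1 the C*-identity of \<open>A\<close> and \<open>act_star\<close> bound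
  |xb|^2 by the norm of \<open>astar x\<close> times x. This is the half of the C*-identity that
  does not come from submultiplicativity.\<close>

lemma unit_norm_sq_le:
  assumes x: "fst x \<in> vcarrier A"
  shows "(anorm (unit_alg A) x)\<^sup>2 \<le> anorm (unit_alg A) (amult (unit_alg A) (astar (unit_alg A) x) x)"
    (is "_ \<le> ?N")
proof -
  have sx: "fst (astar (unit_alg A) x) \<in> vcarrier A" using x by (simp add: star_closed)
  have sxx: "fst (amult (unit_alg A) (astar (unit_alg A) x) x) \<in> vcarrier A"
    using x by (simp add: algebra_closed)
  have nn: "0 \<le> ?N" by (rule unit_norm_nonneg[OF sxx])
  have "anorm (unit_alg A) x \<le> sqrt ?N"
  proof (rule unit_norm_least)
    have "(cmod (snd x))\<^sup>2 = cmod (snd (amult (unit_alg A) (astar (unit_alg A) x) x))"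
      by (simp add: Real_Vector_Spaces.norm_mult power2_eq_square)
    also have "\<dots> \<le> ?N" by (rule unit_norm_snd[OF sxx])
    finally show "cmod (snd x) \<le> sqrt ?N" by (rule real_le_rsqrt)
    fix b assume b: "b \<in> vcarrier A" "anorm A b \<le> 1"
    let ?c = "unit_act A x b"
    have "(anorm A ?c)\<^sup>2 = anorm A (amult A (astar A ?c) ?c)"
      by (simp only: norm_star_mult act_closed x b)
    also have "\<dots> = anorm A (amult A (astar A b) (unit_act A (astar (unit_alg A) x) ?c))"
      by (simp only: act_star act_closed x b)
    also have "\<dots> = anorm A (amult A (astar A b) (unit_act A (amult (unit_alg A) (astar (unit_alg A) x) x) b))"
      by (simp only: act_mult x sx b)
    also have "\<dots> \<le> anorm A (astar A b) * (?N * anorm A b)"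
      by (rule order_trans[OF norm_mult])
        (use b sxx in \<open>auto simp del: unit_alg_ops intro!: star_closed act_closed mult_left_mono unit_norm_act norm_nonneg\<close>)
    also have "\<dots> \<le> 1 * (?N * 1)"
      using b nn norm_nonneg[of b] by (intro mult_mono) (auto simp: norm_star simp del: unit_alg_ops)
    finally show "anorm A ?c \<le> sqrt ?N" by (intro real_le_rsqrt) simp
  qed
  then show ?thesis using nn unit_norm_nonneg[OF x] by (metis power_mono real_sqrt_pow2)
qed

lemma cstar_unit_alg: "cstar_algebra (unit_alg A)"
proof -
  let ?U = "unit_alg A"
  show ?thesis
  proof unfold_locales
    show "complete_wrt ?U (anorm ?U)"
      unfolding complete_wrt_def
    proof (intro allI impI, elim conjE)
      fix s :: "nat \<Rightarrow> 'a \<times> complex"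
      assume s: "\<forall>n. s n \<in> vcarrier ?U"
        and C: "\<forall>e>0. \<exists>N. \<forall>m\<ge>N. \<forall>n\<ge>N. anorm ?U (vdiff ?U (s m) (s n)) < e"
      have fs: "fst (s n) \<in> vcarrier A" for n using s by simp
      have fd: "fst (vdiff ?U (s m) (s n)) \<in> vcarrier A" for m n
        using fs by (simp add: vdiff_unit_alg closed)
      have d2: "cmod (snd (s m) - snd (s n)) \<le> anorm ?U (vdiff ?U (s m) (s n))" for m n
        using unit_norm_snd[OF fd, of m n] by (simp add: vdiff_unit_alg)
      have d1: "anorm A (vdiff A (fst (s m)) (fst (s n))) \<le> 2 * anorm ?U (vdiff ?U (s m) (s n))" for m n
        using unit_norm_fst[OF fd, of m n] d2[of m n] by (simp add: vdiff_unit_alg)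
      have "Cauchy (\<lambda>n. snd (s n))"
        unfolding Cauchy_def dist_norm using C d2 by (meson le_less_trans)
      then obtain t where t: "(\<lambda>n. snd (s n)) \<longlonglongrightarrow> t"
        using Cauchy_convergent convergent_def by blast
      have "\<exists>N. \<forall>m\<ge>N. \<forall>n\<ge>N. anorm A (vdiff A (fst (s m)) (fst (s n))) < e" if "e > 0" for e
      proof -
        obtain N where "\<forall>m\<ge>N. \<forall>n\<ge>N. anorm ?U (vdiff ?U (s m) (s n)) < e / 2"
          using C[rule_format, of "e/2"] \<open>e > 0\<close> by auto
        then have "\<forall>m\<ge>N. \<forall>n\<ge>N. anorm A (vdiff A (fst (s m)) (fst (s n))) < e"
          using d1 by (smt (verit) field_sum_of_halves)
        then show ?thesis by blast
      qed
      then obtain l where l: "l \<in> vcarrier A" "(\<lambda>n. anorm A (vdiff A (fst (s n)) l)) \<longlonglongrightarrow> 0"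
        by (rule complete_wrtD[OF complete, of "\<lambda>n. fst (s n)", OF fs]) blast+
      have "(\<lambda>n. anorm ?U (vdiff ?U (s n) (l, t))) \<longlonglongrightarrow> 0"
      proof (rule tendsto_sandwich[OF _ _ tendsto_const])
        have fl: "fst (vdiff ?U (s n) (l, t)) \<in> vcarrier A" for n
          using fs l by (simp add: vdiff_unit_alg closed)
        show "\<forall>\<^sub>F n in sequentially. 0 \<le> anorm ?U (vdiff ?U (s n) (l, t))"
          using unit_norm_nonneg[OF fl] by simp
        show "\<forall>\<^sub>F n in sequentially. anorm ?U (vdiff ?U (s n) (l, t))
            \<le> anorm A (vdiff A (fst (s n)) l) + cmod (snd (s n) - t)"
          using unit_norm_le[OF fl] by (simp add: vdiff_unit_alg)
        have "(\<lambda>n. cmod (snd (s n) - t)) \<longlonglongrightarrow> 0"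
          using t by (simp add: LIM_zero tendsto_norm_zero)
        from tendsto_add[OF l(2) this]
        show "(\<lambda>n. anorm A (vdiff A (fst (s n)) l) + cmod (snd (s n) - t)) \<longlonglongrightarrow> 0" by simp
      qed
      then show "\<exists>l\<in>vcarrier ?U. (\<lambda>n. anorm ?U (vdiff ?U (s n) l)) \<longlonglongrightarrow> 0"
        using l(1) by (intro bexI[of _ "(l, t)"]) auto
    qed
  next
    fix x y assume x: "x \<in> vcarrier ?U" and y: "y \<in> vcarrier ?U"
    show "anorm ?U (amult ?U x y) \<le> anorm ?U x * anorm ?U y"
      using x y unit_norm_mult by (simp del: unit_alg_ops(5))
    show "anorm ?U (vadd ?U x y) \<le> anorm ?U x + anorm ?U y"
    proof (rule unit_norm_least)
      show "cmod (snd (vadd ?U x y)) \<le> anorm ?U x + anorm ?U y"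
        using unit_norm_snd[of x] unit_norm_snd[of y] x y norm_triangle_ineq[of "snd x" "snd y"]
        by simp
      fix b assume b: "b \<in> vcarrier A" "anorm A b \<le> 1"
      have "unit_act A (vadd ?U x y) b = vadd A (unit_act A x b) (unit_act A y b)"
        using x y b by (simp add: unit_act_def algebra_closed mult_add_left scale_add_left add_ac)
      then have "anorm A (unit_act A (vadd ?U x y) b) \<le> anorm A (unit_act A x b) + anorm A (unit_act A y b)"
        using x y b by (simp add: norm_triangle act_closed del: unit_alg_ops(3))
      also have "\<dots> \<le> anorm ?U x * anorm A b + anorm ?U y * anorm A b"
        using x y b by (intro add_mono unit_norm_act) auto
      also have "\<dots> \<le> anorm ?U x + anorm ?U y"
        using x y b unit_norm_nonneg by (intro add_mono mult_left_le) auto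
      finally show "anorm A (unit_act A (vadd ?U x y) b) \<le> anorm ?U x + anorm ?U y" .
    qed
  next
    fix x assume x: "x \<in> vcarrier ?U"
    then have fx: "fst x \<in> vcarrier A" by simp
    show "0 \<le> anorm ?U x" using unit_norm_nonneg[OF fx] .
    show "anorm ?U x = 0 \<longleftrightarrow> x = vzero ?U"
    proof
      assume z: "anorm ?U x = 0"
      then have "snd x = 0" using unit_norm_snd[OF fx] by simp
      moreover have "anorm A (fst x) \<le> 0" using unit_norm_fst[OF fx] z \<open>snd x = 0\<close> by simp
      then have "fst x = vzero A" using norm_eq_zero[OF fx] norm_nonneg[OF fx] by simp
      ultimately show "x = vzero ?U" by (simp add: prod_eq_iff)
    next
      assume "x = vzero ?U"
      then show "anorm ?U x = 0" using unit_norm_embed[OF zero_closed] by (simp add: norm_zero)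
    qed
    show "anorm ?U (vscale ?U c x) = cmod c * anorm ?U x" for c
    proof (rule antisym)
      have le: "anorm ?U (vscale ?U c x) \<le> cmod c * anorm ?U x" if fx: "fst x \<in> vcarrier A" for c x
      proof (rule unit_norm_least)
        show "cmod (snd (vscale ?U c x)) \<le> cmod c * anorm ?U x"
          using unit_norm_snd[OF fx] by (simp add: Real_Vector_Spaces.norm_mult mult_left_mono)
        fix b assume b: "b \<in> vcarrier A" "anorm A b \<le> 1"
        have "unit_act A (vscale ?U c x) b = vscale A c (unit_act A x b)"
          using fx b by (simp add: unit_act_def algebra_closed mult_scale_left scale_add_right scale_scale)
        then have "anorm A (unit_act A (vscale ?U c x) b) \<le> cmod c * (anorm ?U x * anorm A b)"
          using fx b unit_norm_act[OF fx b(1)]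
          by (simp add: norm_scale act_closed mult_left_mono del: unit_alg_ops(4))
        also have "\<dots> \<le> cmod c * anorm ?U x"
          using b unit_norm_nonneg[OF fx] by (intro mult_left_mono mult_left_le) auto
        finally show "anorm A (unit_act A (vscale ?U c x) b) \<le> cmod c * anorm ?U x" .
      qed
      show "anorm ?U (vscale ?U c x) \<le> cmod c * anorm ?U x" by (rule le[OF fx])
      show "cmod c * anorm ?U x \<le> anorm ?U (vscale ?U c x)"
      proof (cases "c = 0")
        case True
        have "fst (vscale ?U c x) \<in> vcarrier A" using fx by (simp add: closed)
        then show ?thesis using True unit_norm_nonneg[of "vscale ?U c x"] by simp
      next
        case False
        have "vscale ?U (1/c) (vscale ?U c x) = x"
          using False fx by (simp add: scale_scale scale_one prod_eq_iff)
        then have "anorm ?U x \<le> cmod (1/c) * anorm ?U (vscale ?U c x)"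
          using le[of "vscale ?U c x" "1/c"] fx by (simp add: closed)
        then show ?thesis using False by (simp add: norm_divide field_simps)
      qed
    qed
    show "anorm ?U (amult ?U (astar ?U x) x) = (anorm ?U x)\<^sup>2"
    proof -
      have sx: "fst (astar ?U x) \<in> vcarrier A" using fx by (simp add: star_closed)
      have ssx: "astar ?U (astar ?U x) = x" using fx by (simp add: star_star prod_eq_iff)
      \<comment> \<open>Dividing \<open>unit_norm_sq_le\<close> by the norm shows that the star is
        isometric, and this yields the other half of the C*-identity.\<close>
      have star_ge: "anorm ?U y \<le> anorm ?U (astar ?U y)" if fy: "fst y \<in> vcarrier A" for y
      proof (cases "anorm ?U y = 0")
        case False
        have "anorm ?U y * anorm ?U y \<le> anorm ?U (astar ?U y) * anorm ?U y"
          using unit_norm_sq_le[OF fy] unit_norm_mult[of "astar ?U y" y] fy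
          by (simp add: power2_eq_square star_closed del: unit_alg_ops(5))
        then show ?thesis using False unit_norm_nonneg[OF fy] by (simp add: mult_le_cancel_right)
      next
        case True
        have "fst (astar ?U y) \<in> vcarrier A" using fy by (simp add: star_closed)
        then show ?thesis using True unit_norm_nonneg by simp
      qed
      have "anorm ?U (astar ?U x) = anorm ?U x"
        using star_ge[OF fx] star_ge[OF sx] ssx by simp
      then show ?thesis
        using unit_norm_mult[OF sx fx] unit_norm_sq_le[OF fx] by (simp add: power2_eq_square)
    qed
  qed (auto simp: algebra_closed add_zero add_inverse scale_add_right
      scale_add_left scale_scale scale_one mult_assoc mult_add_right mult_add_left mult_scale_right
      mult_scale_left star_star star_add star_scale star_mult add_ac algebra_simps)
qed

end

section \<open>One Banach algebra type that contains all C*-algebras on a given type\<close>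

lemma cstar_trivial:
  "cstar_algebra \<lparr>vcarrier = {u}, vzero = u, vadd = \<lambda>_ _. u, vscale = \<lambda>_ _. u,
     amult = \<lambda>_ _. u, astar = \<lambda>_. u, anorm = \<lambda>_. 0\<rparr>"
  by unfold_locales (auto simp: complete_wrt_def)

text \<open>The product of the unitizations of all C*-algebras with carrier in \<open>'a\<close>, as a type: facts
  proved in its type class hold for each of these algebras.\<close>

definition all_unit_alg :: "('a calg \<Rightarrow> 'a \<times> complex) calg" where
  "all_unit_alg = prod_alg {A. cstar_algebra A} unit_alg"

lemma cstar_all_unit_alg: "cstar_algebra all_unit_alg"
  unfolding all_unit_alg_def by (rule cstar_prod_alg) (simp add: cstar_algebra.cstar_unit_alg)

interpretation all: cstar_algebra all_unit_alg
  by (rule cstar_all_unit_alg)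

typedef 'a all_alg = "vcarrier (all_unit_alg :: ('a calg \<Rightarrow> 'a \<times> complex) calg)"
  morphisms rep_all abs_all
  using all.zero_closed by blast

lemmas rep_all_closed [simp] = rep_all

definition all_one :: "'a calg \<Rightarrow> 'a \<times> complex" where
  "all_one = (\<lambda>A\<in>{A. cstar_algebra A}. (vzero A, 1))"

lemma unit_act_one: "cstar_algebra A \<Longrightarrow> b \<in> vcarrier A \<Longrightarrow> unit_act A (vzero A, 1) b = b"
proof -
  assume "cstar_algebra A" and b: "b \<in> vcarrier A"
  then interpret cstar_algebra A by simp
  have "amult A (vzero A) b = vzero A"
    using mult_scale_left[OF zero_closed b, of 0]
    by (simp add: scale_zero_left scale_zero_right b algebra_closed)
  then show ?thesis using b by (simp add: unit_act_def scale_one zero_add)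
qed

lemma unit_norm_one: "cstar_algebra A \<Longrightarrow> anorm (unit_alg A) (vzero A, 1) = 1"
proof (rule antisym)
  assume A: "cstar_algebra A"
  then interpret cstar_algebra A .
  show "anorm (unit_alg A) (vzero A, 1) \<le> 1"
    by (rule unit_norm_least) (auto simp: unit_act_one A)
  show "1 \<le> anorm (unit_alg A) (vzero A, 1)"
    using unit_norm_snd[of "(vzero A, 1)"] by (simp add: zero_closed)
qed

lemma all_one_closed: "all_one \<in> vcarrier all_unit_alg"
  unfolding all_unit_alg_def
proof (rule prod_alg_carrierI[where K = 1])
  show "all_one \<in> (\<Pi>\<^sub>E A\<in>{A. cstar_algebra A}. vcarrier (unit_alg A))"
    using complex_vector_space.zero_closed[OF cstar_algebra.vector_space_axioms]
    by (auto simp: all_one_def)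
qed (simp add: all_one_def unit_norm_one)

lemma all_mult_one:
  assumes a: "a \<in> vcarrier all_unit_alg"
  shows "amult all_unit_alg a all_one = a" "amult all_unit_alg all_one a = a"
proof -
  have c: "fst (a A) \<in> vcarrier A" if "cstar_algebra A" for A
    using prod_alg_component[OF a[unfolded all_unit_alg_def], of A] that by simp
  have undef: "a A = undefined" if "\<not> cstar_algebra A" for A
    using a that by (auto simp: all_unit_alg_def prod_alg_def PiE_def extensional_def)
  have m: "amult (unit_alg A) (a A) (vzero A, 1) = a A"
    "amult (unit_alg A) (vzero A, 1) (a A) = a A" if A: "cstar_algebra A" for A
  proof -
    interpret cstar_algebra A by (rule A)
    have z: "amult A (vzero A) b = vzero A" "amult A b (vzero A) = vzero A" if b: "b \<in> vcarrier A" for b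
      using mult_scale_left[OF zero_closed b, of 0] mult_scale_right[OF b zero_closed, of 0]
      by (simp_all add: scale_zero_left scale_zero_right b algebra_closed)
    show "amult (unit_alg A) (a A) (vzero A, 1) = a A" "amult (unit_alg A) (vzero A, 1) (a A) = a A"
      using c[OF A] by (simp_all add: z scale_one scale_zero_right add_zero zero_add prod_eq_iff)
  qed
  show "amult all_unit_alg a all_one = a" "amult all_unit_alg all_one a = a"
    using m undef by (auto simp: all_unit_alg_def all_one_def fun_eq_iff simp del: unit_alg_ops)
qed

lemma all_norm_one: "anorm (all_unit_alg :: ('a calg \<Rightarrow> _) calg) all_one = 1"
proof (rule antisym)
  show "anorm (all_unit_alg :: ('a calg \<Rightarrow> _) calg) all_one \<le> 1"
    unfolding all_unit_alg_def
    by (rule prod_alg_norm_least) (auto simp: all_one_def unit_norm_one)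
  \<comment> \<open>The product norm is a supremum over all factors and 0, so a factor must exist
    for the unit to have norm 1; the trivial algebra provides one, as its unitization is not
    trivial.\<close>
  have "\<exists>A :: 'a calg. cstar_algebra A" by (rule exI, rule cstar_trivial)
  then obtain A :: "'a calg" where A: "cstar_algebra A" ..
  have "anorm (unit_alg A) (all_one A) \<le> anorm all_unit_alg (all_one :: 'a calg \<Rightarrow> _)"
    unfolding all_unit_alg_def
    by (rule prod_alg_norm_upper[OF all_one_closed[unfolded all_unit_alg_def]]) (simp add: A)
  then show "1 \<le> anorm (all_unit_alg :: ('a calg \<Rightarrow> _) calg) all_one"
    using A by (simp add: all_one_def unit_norm_one)
qed

instantiation all_alg :: (type) real_normed_algebra_1
begin

definition "0 = abs_all (vzero all_unit_alg)"
definition "1 = abs_all all_one"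
definition "x + y = abs_all (vadd all_unit_alg (rep_all x) (rep_all y))"
definition "- x = abs_all (vscale all_unit_alg (-1) (rep_all x))"
definition "x - y = abs_all (vdiff all_unit_alg (rep_all x) (rep_all y))"
definition "x * y = abs_all (amult all_unit_alg (rep_all x) (rep_all y))"
definition "r *\<^sub>R x = abs_all (vscale all_unit_alg (of_real r) (rep_all x))"
definition "norm x = anorm all_unit_alg (rep_all x)"
definition "dist x y = norm (x - y :: 'a all_alg)"
definition "sgn x = inverse (norm x) *\<^sub>R (x :: 'a all_alg)"
definition "uniformity = (INF e\<in>{0<..}. principal {(x, y :: 'a all_alg). dist x y < e})"
definition "open U = (\<forall>x\<in>U. \<forall>\<^sub>F (x', y) in uniformity. x' = x \<longrightarrow> (y :: 'a all_alg) \<in> U)"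

lemma rep_all_ops:
  "rep_all 0 = vzero all_unit_alg"
  "rep_all 1 = all_one"
  "rep_all (x + y) = vadd all_unit_alg (rep_all x) (rep_all y)"
  "rep_all (- x) = vscale all_unit_alg (-1) (rep_all x)"
  "rep_all (x - y) = vdiff all_unit_alg (rep_all x) (rep_all y)"
  "rep_all (x * y) = amult all_unit_alg (rep_all x) (rep_all y)"
  "rep_all (r *\<^sub>R x) = vscale all_unit_alg (of_real r) (rep_all x)"
  by (simp_all add: zero_all_alg_def one_all_alg_def plus_all_alg_def uminus_all_alg_def
      minus_all_alg_def times_all_alg_def scaleR_all_alg_def abs_all_inverse all.algebra_closed all_one_closed)

instance
proof
  fix x y z :: "'a all_alg" and a b :: real
  note rep = rep_all_inject[symmetric] rep_all_ops
  show "x + y + z = x + (y + z)" by (simp add: rep all.add_assoc)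
  show "x + y = y + x" by (simp add: rep all.add_commute)
  show "0 + x = x" by (simp add: rep all.zero_add)
  show "- x + x = 0" by (simp add: rep all.add_inverse all.add_commute all.closed)
  show "x - y = x + - y" by (simp add: rep vdiff_def)
  show "a *\<^sub>R (x + y) = a *\<^sub>R x + a *\<^sub>R y" by (simp add: rep all.scale_add_right)
  show "(a + b) *\<^sub>R x = a *\<^sub>R x + b *\<^sub>R x" by (simp add: rep all.scale_add_left)
  show "a *\<^sub>R b *\<^sub>R x = (a * b) *\<^sub>R x" by (simp add: rep all.scale_scale)
  show "1 *\<^sub>R x = x" by (simp add: rep all.scale_one)
  show "x * y * z = x * (y * z)" by (simp add: rep all.mult_assoc)
  show "(x + y) * z = x * z + y * z" by (simp add: rep all.mult_add_left)
  show "x * (y + z) = x * y + x * z" by (simp add: rep all.mult_add_right)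
  show "a *\<^sub>R x * y = a *\<^sub>R (x * y)" by (simp add: rep all.mult_scale_left)
  show "x * a *\<^sub>R y = a *\<^sub>R (x * y)" by (simp add: rep all.mult_scale_right)
  show "1 * x = x" "x * 1 = x" by (simp_all add: rep all_mult_one)
  show "norm x = 0 \<longleftrightarrow> x = 0" by (simp add: rep norm_all_alg_def all.norm_eq_zero)
  show "norm (x + y) \<le> norm x + norm y" by (simp add: rep norm_all_alg_def all.norm_triangle)
  show "norm (a *\<^sub>R x) = \<bar>a\<bar> * norm x" by (simp add: rep norm_all_alg_def all.norm_scale)
  show "norm (x * y) \<le> norm x * norm y" by (simp add: rep norm_all_alg_def all.norm_mult)
  show "norm (1 :: 'a all_alg) = 1" by (simp add: rep norm_all_alg_def all_norm_one)
  then show "(0 :: 'a all_alg) \<noteq> 1" by (metis \<open>norm x = 0 \<longleftrightarrow> x = 0\<close> rep_all_ops(1) norm_all_alg_def all.norm_zero zero_neq_one)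
qed (fact dist_all_alg_def sgn_all_alg_def uniformity_all_alg_def open_all_alg_def)+

end

instance all_alg :: (type) banach
proof
  fix s :: "nat \<Rightarrow> 'a all_alg"
  assume "Cauchy s"
  then have "\<exists>N. \<forall>m\<ge>N. \<forall>n\<ge>N. anorm all_unit_alg (vdiff all_unit_alg (rep_all (s m)) (rep_all (s n))) < e"
    if "e > 0" for e
    using that unfolding Cauchy_def dist_norm norm_all_alg_def rep_all_ops by blast
  then obtain l where l: "l \<in> vcarrier all_unit_alg"
    "(\<lambda>n. anorm all_unit_alg (vdiff all_unit_alg (rep_all (s n)) l)) \<longlonglongrightarrow> 0"
    by (rule complete_wrtD[OF all.complete, of "\<lambda>n. rep_all (s n)", OF rep_all_closed]) blast+
  then have "(\<lambda>n. norm (s n - abs_all l)) \<longlonglongrightarrow> 0"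
    by (simp add: norm_all_alg_def rep_all_ops abs_all_inverse)
  then have "s \<longlonglongrightarrow> abs_all l" by (simp add: LIM_zero_iff tendsto_norm_zero_iff)
  then show "convergent s" by (auto simp: convergent_def)
qed

definition all_star :: "'a all_alg \<Rightarrow> 'a all_alg" where
  "all_star x = abs_all (astar all_unit_alg (rep_all x))"

definition all_iota :: "'a all_alg" where
  "all_iota = abs_all (vscale all_unit_alg \<i> all_one)"

lemma rep_all_star: "rep_all (all_star x) = astar all_unit_alg (rep_all x)"
  by (simp add: all_star_def abs_all_inverse all.star_closed)

lemma rep_all_iota: "rep_all all_iota = vscale all_unit_alg \<i> all_one"
  by (simp add: all_iota_def abs_all_inverse all.closed all_one_closed)

interpretation unital: unital_cstar all_star all_iota
proof
  fix x y :: "'a all_alg" and c :: real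
  note rep = rep_all_inject[symmetric] rep_all_ops rep_all_star rep_all_iota
  have one: "astar all_unit_alg all_one = (all_one :: 'a calg \<Rightarrow> _)"
    by (metis all.star_closed all.star_mult all.star_star all_mult_one(2) all_one_closed)
  show "all_star (all_star x) = x" by (simp add: rep all.star_star)
  show "all_star (x + y) = all_star x + all_star y" by (simp add: rep all.star_add)
  show "all_star (c *\<^sub>R x) = c *\<^sub>R all_star x" by (simp add: rep all.star_scale)
  show "all_star (x * y) = all_star y * all_star x" by (simp add: rep all.star_mult)
  show "norm (all_star x * x) = (norm x)\<^sup>2" by (simp add: rep norm_all_alg_def all.norm_star_mult)
  show "all_iota * all_iota = (-1 :: 'a all_alg)"
    by (simp add: rep all.mult_scale_left all.mult_scale_right all_one_closed all.algebra_closed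
        all_mult_one all.scale_scale)
  show "all_star all_iota = (- all_iota :: 'a all_alg)"
    by (simp add: rep all.star_scale all_one_closed one all.scale_scale)
  show "x * all_iota = all_iota * x"
    by (simp add: rep all.mult_scale_left all.mult_scale_right all_one_closed all_mult_one)
qed

text \<open>\<open>A\<close> goes into the unitization in its own coordinate and all other
  coordinates vanish. This is an isometric *-homomorphism, but it does not respect units.\<close>

definition embed_all :: "'a calg \<Rightarrow> 'a \<Rightarrow> 'a all_alg" where
  "embed_all A a = abs_all (\<lambda>B\<in>{B. cstar_algebra B}. (if B = A then a else vzero B, 0))"

context
  fixes A :: "'a calg"
  assumes A: "cstar_algebra A"
begin

interpretation cstar_algebra A by (rule A)

lemma embed_all_aux:
  assumes a: "a \<in> vcarrier A"
  shows "(\<lambda>B\<in>{B. cstar_algebra B}. (if B = A then a else vzero B, 0 :: complex)) \<in> vcarrier all_unit_alg"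
    and "anorm all_unit_alg (\<lambda>B\<in>{B. cstar_algebra B}. (if B = A then a else vzero B, 0)) = anorm A a"
proof -
  let ?a = "\<lambda>B\<in>{B. cstar_algebra B}. (if B = A then a else vzero B, 0 :: complex)"
  have n: "anorm (unit_alg B) (?a B) \<le> anorm A a" if B: "cstar_algebra B" for B
    using cstar_algebra.unit_norm_embed[OF B] a norm_nonneg[OF a] B
      complex_vector_space.zero_closed[OF cstar_algebra.vector_space_axioms[OF B]]
    by (auto simp: cstar_algebra.norm_zero[OF B])
  show c: "?a \<in> vcarrier all_unit_alg"
    unfolding all_unit_alg_def
    by (rule prod_alg_carrierI[where K = "anorm A a"])
      (use n a complex_vector_space.zero_closed[OF cstar_algebra.vector_space_axioms] in auto)
  show "anorm all_unit_alg ?a = anorm A a"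
  proof (rule antisym)
    show "anorm all_unit_alg ?a \<le> anorm A a"
      unfolding all_unit_alg_def
      by (rule prod_alg_norm_least) (use n norm_nonneg[OF a] in auto)
    have "anorm (unit_alg A) (?a A) \<le> anorm all_unit_alg ?a"
      using prod_alg_norm_upper[OF c[unfolded all_unit_alg_def], of A] A by (simp add: all_unit_alg_def)
    then show "anorm A a \<le> anorm all_unit_alg ?a" using A unit_norm_embed[OF a] by simp
  qed
qed

lemma rep_embed_all:
  "a \<in> vcarrier A \<Longrightarrow> rep_all (embed_all A a) = (\<lambda>B\<in>{B. cstar_algebra B}. (if B = A then a else vzero B, 0))"
  by (simp add: embed_all_def abs_all_inverse embed_all_aux)

lemma norm_embed_all: "a \<in> vcarrier A \<Longrightarrow> norm (embed_all A a) = anorm A a"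
  by (simp add: norm_all_alg_def rep_embed_all embed_all_aux)

lemma embed_all_hom:
  assumes a: "a \<in> vcarrier A" and b: "b \<in> vcarrier A"
  shows "embed_all A (vadd A a b) = embed_all A a + embed_all A b"
    "embed_all A (amult A a b) = embed_all A a * embed_all A b"
    "embed_all A (astar A a) = all_star (embed_all A a)"
    "embed_all A (vscale A c a) = Re c *\<^sub>R embed_all A a + Im c *\<^sub>R (all_iota * embed_all A a)"
    "embed_all A (vdiff A a b) = embed_all A a - embed_all A b"
proof -
  have z: "vadd B (vzero B) (vzero B) = vzero B" "amult B (vzero B) (vzero B) = vzero B"
    "astar B (vzero B) = vzero B" "vscale B k (vzero B) = vzero B"
    if B: "cstar_algebra B" for B :: "'a calg" and k
  proof -
    interpret B: cstar_algebra B by (rule B)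
    show "vadd B (vzero B) (vzero B) = vzero B" "vscale B k (vzero B) = vzero B"
      by (simp_all add: B.closed B.add_zero B.scale_zero_right)
    show "amult B (vzero B) (vzero B) = vzero B"
      using B.mult_scale_left[OF B.zero_closed B.zero_closed, of 0]
      by (simp add: B.scale_zero_left B.algebra_closed)
    show "astar B (vzero B) = vzero B"
      using B.star_scale[OF B.zero_closed, of 0] by (simp add: B.scale_zero_left B.algebra_closed)
  qed
  note rep = rep_all_inject[symmetric] rep_all_ops rep_all_star rep_all_iota
  have scale: "rep_all (embed_all A (vscale A c a)) = vscale all_unit_alg c (rep_all (embed_all A a))" for c
    using a by (simp add: rep_embed_all closed all_unit_alg_def fun_eq_iff z)
  show "embed_all A (vadd A a b) = embed_all A a + embed_all A b"
    using a b by (simp add: rep rep_embed_all closed all_unit_alg_def fun_eq_iff z)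
  show "embed_all A (vdiff A a b) = embed_all A a - embed_all A b"
    using a b by (simp add: rep rep_embed_all closed all_unit_alg_def fun_eq_iff z vdiff_prod_alg vdiff_unit_alg)
      (simp add: vdiff_def z)
  show "embed_all A (amult A a b) = embed_all A a * embed_all A b"
  proof -
    have "vadd A (amult A a b) (vadd A (vscale A 0 b) (vscale A 0 a)) = amult A a b"
      using a b by (simp add: scale_zero_left add_zero algebra_closed)
    then show ?thesis
      using a b by (simp add: rep rep_embed_all algebra_closed all_unit_alg_def fun_eq_iff z)
  qed
  show "embed_all A (astar A a) = all_star (embed_all A a)"
    using a by (simp add: rep rep_embed_all algebra_closed all_unit_alg_def fun_eq_iff z)
  let ?v = "rep_all (embed_all A a)"
  have "rep_all (embed_all A (vscale A c a)) = vscale all_unit_alg (of_real (Re c) + of_real (Im c) * \<i>) ?v"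
    by (rule trans[OF scale], rule arg_cong[where f = "\<lambda>c. vscale all_unit_alg c ?v"])
      (simp add: complex_eq_iff)
  also have "\<dots> = vadd all_unit_alg (vscale all_unit_alg (of_real (Re c)) ?v)
      (vscale all_unit_alg (of_real (Im c)) (vscale all_unit_alg \<i> ?v))"
    by (simp only: all.scale_add_left all.scale_scale rep_all_closed)
  also have "vscale all_unit_alg \<i> ?v = amult all_unit_alg (rep_all all_iota) ?v"
    by (simp add: rep_all_iota all.mult_scale_left all_one_closed all_mult_one)
  finally show "embed_all A (vscale A c a) = Re c *\<^sub>R embed_all A a + Im c *\<^sub>R (all_iota * embed_all A a)"
    by (simp add: rep)
qed

end

section \<open>Operators on a Hilbert space\<close>

lemma cnj_mult_self: "cnj z * z = of_real ((cmod z)\<^sup>2)"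
  by (metis complex_norm_square mult.commute)

text \<open>The optimal choice is c = -cnj z / b; for b = 0, large negative multiples of cnj z force
  z = 0. It yields the Cauchy-Schwarz inequality here and for the GNS form, and the stationarity
  estimate in the Riesz theorem.\<close>

lemma discriminant_complex:
  fixes z :: complex
  assumes "\<And>c. 0 \<le> a + 2 * Re (c * z) + (cmod c)\<^sup>2 * b" "0 \<le> b"
  shows "(cmod z)\<^sup>2 \<le> a * b"
proof (cases "b = 0")
  case False
  then have b: "b > 0" using assms by simp
  define c where "c = - (1/b) *\<^sub>R cnj z"
  have "Re (c * z) = - (cmod z)\<^sup>2 / b"
    unfolding c_def by (simp only: mult_scaleR_left cnj_mult_self) simp
  moreover have "(cmod c)\<^sup>2 * b = (cmod z)\<^sup>2 / b"
    using b by (simp add: c_def power2_eq_square field_simps)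
  ultimately have "0 \<le> a - (cmod z)\<^sup>2 / b"
    using assms(1)[of c] by simp
  then show ?thesis using b by (simp add: field_simps)
next
  case True
  have t: "0 \<le> a - 2 * t * (cmod z)\<^sup>2" for t :: real
  proof -
    have "Re ((- t *\<^sub>R cnj z) * z) = - t * (cmod z)\<^sup>2"
      by (simp only: mult_scaleR_left cnj_mult_self) simp
    then show ?thesis
      using assms(1)[of "- t *\<^sub>R cnj z"] True by (simp only: mult_zero_right)
  qed
  have "(cmod z)\<^sup>2 = 0"
  proof (rule ccontr)
    assume n: "(cmod z)\<^sup>2 \<noteq> 0"
    \<comment> \<open>This t turns the bound into a - 2(a + 1) = -a - 2, which is negative because t
      = 0 gives a >= 0.\<close>
    then show False using t[of "(a + 1) / (cmod z)\<^sup>2"] t[of 0] by simp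
  qed
  then show ?thesis using True by simp
qed

text \<open>Filters are needed because the nets that approximate in the *-strong topology cannot in
  general be replaced by sequences.\<close>

definition hconv :: "('a, 'm) hilb_scheme \<Rightarrow> ('i \<Rightarrow> 'a) \<Rightarrow> 'a \<Rightarrow> 'i filter \<Rightarrow> bool" where
  "hconv H s l F \<longleftrightarrow> ((\<lambda>i. hnorm H (vdiff H (s i) l)) \<longlongrightarrow> 0) F"

section \<open>Inner products, limits of vectors and the Riesz representation\<close>

context hilbert_space
begin

lemma inner_add_left: "\<lbrakk>x \<in> vcarrier H; y \<in> vcarrier H; z \<in> vcarrier H\<rbrakk>
    \<Longrightarrow> hinner H (vadd H x y) z = hinner H x z + hinner H y z"
  using inner_add_right[of z x y] inner_commute[of z "vadd H x y"] inner_commute[of z x] inner_commute[of z y]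
  by (simp add: closed)

lemma inner_scale_left: "\<lbrakk>x \<in> vcarrier H; y \<in> vcarrier H\<rbrakk>
    \<Longrightarrow> hinner H (vscale H c x) y = cnj c * hinner H x y"
  using inner_scale_right[of y x c] inner_commute[of y "vscale H c x"] inner_commute[of y x]
  by (simp add: closed)

lemma inner_zero_right: "x \<in> vcarrier H \<Longrightarrow> hinner H x (vzero H) = 0"
  using inner_scale_right[of x "vzero H" 0] by (simp add: scale_zero_right zero_closed)

lemma inner_diff_right: "\<lbrakk>x \<in> vcarrier H; y \<in> vcarrier H; z \<in> vcarrier H\<rbrakk>
    \<Longrightarrow> hinner H x (vdiff H y z) = hinner H x y - hinner H x z"
  by (simp add: vdiff_def inner_add_right inner_scale_right closed)

lemma inner_diff_left: "\<lbrakk>x \<in> vcarrier H; y \<in> vcarrier H; z \<in> vcarrier H\<rbrakk>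
    \<Longrightarrow> hinner H (vdiff H x y) z = hinner H x z - hinner H y z"
  by (simp add: vdiff_def inner_add_left inner_scale_left closed)

lemmas inner_simps = inner_add_left inner_add_right inner_scale_left inner_scale_right
  inner_diff_left inner_diff_right

lemma hnorm_nonneg: "x \<in> vcarrier H \<Longrightarrow> 0 \<le> hnorm H x"
  by (simp add: hnorm_def inner_nonneg)

lemma inner_self: "x \<in> vcarrier H \<Longrightarrow> hinner H x x = of_real ((hnorm H x)\<^sup>2)"
  using inner_commute[of x x] inner_nonneg[of x] by (simp add: hnorm_def complex_eq_iff)

lemma cmod_inner_self: "x \<in> vcarrier H \<Longrightarrow> cmod (hinner H x x) = (hnorm H x)\<^sup>2"
  by (simp only: inner_self norm_of_real) simp

lemma hnorm_sq: "x \<in> vcarrier H \<Longrightarrow> (hnorm H x)\<^sup>2 = Re (hinner H x x)"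
  by (simp add: hnorm_def inner_nonneg)

lemma hnorm_eq_zero: "x \<in> vcarrier H \<Longrightarrow> hnorm H x = 0 \<longleftrightarrow> x = vzero H"
  using inner_self[of x] inner_definite[of x] inner_zero_right[of x] by (auto simp: hnorm_def zero_closed)

lemma hnorm_zero: "hnorm H (vzero H) = 0"
  using hnorm_eq_zero zero_closed by blast

lemma hnorm_scale: "x \<in> vcarrier H \<Longrightarrow> hnorm H (vscale H c x) = cmod c * hnorm H x"
proof -
  assume x: "x \<in> vcarrier H"
  have "hinner H (vscale H c x) (vscale H c x) = cnj c * c * hinner H x x"
    using x by (simp only: closed inner_simps mult.assoc mult.left_commute)
  then have "(hnorm H (vscale H c x))\<^sup>2 = Re (cnj c * c * of_real ((hnorm H x)\<^sup>2))"
    using x by (simp only: hnorm_sq[OF scale_closed] inner_self)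
  also have "\<dots> = (cmod c * hnorm H x)\<^sup>2"
    by (simp only: cnj_mult_self of_real_mult[symmetric] Re_complex_of_real power_mult_distrib)
  finally have "(hnorm H (vscale H c x))\<^sup>2 = (cmod c * hnorm H x)\<^sup>2" .
  then show ?thesis
    using x by (simp add: hnorm_nonneg closed)
qed

lemma hnorm_add_scale_sq: "\<lbrakk>x \<in> vcarrier H; y \<in> vcarrier H\<rbrakk> \<Longrightarrow>
    (hnorm H (vadd H x (vscale H c y)))\<^sup>2
      = (hnorm H x)\<^sup>2 + 2 * Re (c * hinner H x y) + (cmod c)\<^sup>2 * (hnorm H y)\<^sup>2"
proof -
  assume x: "x \<in> vcarrier H" and y: "y \<in> vcarrier H"
  have "hinner H (vadd H x (vscale H c y)) (vadd H x (vscale H c y))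
      = hinner H x x + c * hinner H x y + cnj (c * hinner H x y) + (cnj c * c) * hinner H y y"
    using x y inner_commute[OF x y] by (simp add: closed inner_simps algebra_simps)
  also have "\<dots> = of_real ((hnorm H x)\<^sup>2) + c * hinner H x y + cnj (c * hinner H x y)
      + of_real ((cmod c)\<^sup>2 * (hnorm H y)\<^sup>2)"
    by (simp only: cnj_mult_self inner_self x y of_real_mult)
  finally show ?thesis
    using x y by (simp only: hnorm_sq closed plus_complex.sel Re_complex_of_real complex_cnj) simp
qed

lemma Cauchy_Schwarz: "\<lbrakk>x \<in> vcarrier H; y \<in> vcarrier H\<rbrakk>
    \<Longrightarrow> cmod (hinner H x y) \<le> hnorm H x * hnorm H y"
proof -
  assume x: "x \<in> vcarrier H" and y: "y \<in> vcarrier H"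
  have "(cmod (hinner H x y))\<^sup>2 \<le> (hnorm H x)\<^sup>2 * (hnorm H y)\<^sup>2"
  proof (rule discriminant_complex)
    show "0 \<le> (hnorm H x)\<^sup>2 + 2 * Re (c * hinner H x y) + (cmod c)\<^sup>2 * (hnorm H y)\<^sup>2" for c
      using hnorm_add_scale_sq[OF x y, of c] by (metis zero_le_power2)
  qed simp
  then have "(cmod (hinner H x y))\<^sup>2 \<le> (hnorm H x * hnorm H y)\<^sup>2" by (simp add: power_mult_distrib)
  then show ?thesis using x y by (intro power2_le_imp_le[of "cmod (hinner H x y)"]) (auto simp: hnorm_nonneg)
qed

lemma hnorm_triangle: "\<lbrakk>x \<in> vcarrier H; y \<in> vcarrier H\<rbrakk>
    \<Longrightarrow> hnorm H (vadd H x y) \<le> hnorm H x + hnorm H y"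
proof -
  assume x: "x \<in> vcarrier H" and y: "y \<in> vcarrier H"
  have "(hnorm H (vadd H x y))\<^sup>2 = (hnorm H x)\<^sup>2 + 2 * Re (hinner H x y) + (hnorm H y)\<^sup>2"
    using hnorm_add_scale_sq[OF x y, of 1] y by (simp add: scale_one)
  also have "\<dots> \<le> (hnorm H x)\<^sup>2 + 2 * (hnorm H x * hnorm H y) + (hnorm H y)\<^sup>2"
    using Cauchy_Schwarz[OF x y] complex_Re_le_cmod[of "hinner H x y"] by linarith
  finally have "(hnorm H (vadd H x y))\<^sup>2 \<le> (hnorm H x + hnorm H y)\<^sup>2"
    by (simp add: power2_sum)
  then show ?thesis using x y by (intro power2_le_imp_le[of "hnorm H (vadd H x y)"]) (auto simp: hnorm_nonneg)
qed

lemma hnorm_vdiff_triangle: "\<lbrakk>x \<in> vcarrier H; y \<in> vcarrier H; z \<in> vcarrier H\<rbrakk>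
    \<Longrightarrow> hnorm H (vdiff H x z) \<le> hnorm H (vdiff H x y) + hnorm H (vdiff H y z)"
  using hnorm_triangle[of "vdiff H x y" "vdiff H y z"] by (simp add: vdiff_add_vdiff closed)

lemma hnorm_vdiff_commute: "\<lbrakk>x \<in> vcarrier H; y \<in> vcarrier H\<rbrakk>
    \<Longrightarrow> hnorm H (vdiff H x y) = hnorm H (vdiff H y x)"
  using hnorm_scale[of "vdiff H y x" "-1"] by (simp add: vdiff_swap closed)

lemma hnorm_le_vdiff: "\<lbrakk>x \<in> vcarrier H; y \<in> vcarrier H\<rbrakk>
    \<Longrightarrow> hnorm H x \<le> hnorm H (vdiff H x y) + hnorm H y"
  using hnorm_triangle[of "vdiff H x y" y] by (simp add: vdiff_add_cancel closed)

lemma hnorm_vdiff_eq_zero: "\<lbrakk>x \<in> vcarrier H; y \<in> vcarrier H\<rbrakk>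
    \<Longrightarrow> hnorm H (vdiff H x y) = 0 \<longleftrightarrow> x = y"
  by (simp add: hnorm_eq_zero closed vdiff_eq_zero_iff)

lemma eq_by_inner:
  assumes "x \<in> vcarrier H" "y \<in> vcarrier H" "\<And>z. z \<in> vcarrier H \<Longrightarrow> hinner H x z = hinner H y z"
  shows "x = y"
proof -
  have "hinner H (vdiff H x y) (vdiff H x y) = 0"
    using assms by (simp add: inner_diff_left closed)
  then show ?thesis
    using assms inner_definite[of "vdiff H x y"] vdiff_eq_zero_iff[of x y] by (simp add: closed)
qed

lemma hconv_const: "x \<in> vcarrier H \<Longrightarrow> hconv H (\<lambda>_. x) x F"
  by (simp add: hconv_def vdiff_self hnorm_zero)

lemma hconv_squeeze:
  assumes "\<And>i. s i \<in> vcarrier H" "l \<in> vcarrier H"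
    "\<And>i. hnorm H (vdiff H (s i) l) \<le> g i" "(g \<longlongrightarrow> 0) F"
  shows "hconv H s l F"
  unfolding hconv_def
  by (rule tendsto_sandwich[OF _ _ tendsto_const assms(4)])
    (use assms in \<open>auto simp: hnorm_nonneg closed\<close>)

lemma hconv_add:
  assumes "\<And>i. s i \<in> vcarrier H" "\<And>i. t i \<in> vcarrier H" "l \<in> vcarrier H" "k \<in> vcarrier H"
    "hconv H s l F" "hconv H t k F"
  shows "hconv H (\<lambda>i. vadd H (s i) (t i)) (vadd H l k) F"
proof (rule hconv_squeeze)
  show "((\<lambda>i. hnorm H (vdiff H (s i) l) + hnorm H (vdiff H (t i) k)) \<longlongrightarrow> 0) F"
    using tendsto_add[OF assms(5,6)[unfolded hconv_def]] by simp
qed (use assms in \<open>auto simp: closed vdiff_add_add hnorm_triangle\<close>)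

lemma hconv_scale:
  assumes "\<And>i. s i \<in> vcarrier H" "l \<in> vcarrier H" "hconv H s l F"
  shows "hconv H (\<lambda>i. vscale H c (s i)) (vscale H c l) F"
proof (rule hconv_squeeze)
  show "((\<lambda>i. cmod c * hnorm H (vdiff H (s i) l)) \<longlongrightarrow> 0) F"
    using tendsto_mult_left[OF assms(3)[unfolded hconv_def], of "cmod c"] by simp
qed (use assms in \<open>auto simp: closed scale_vdiff[symmetric] hnorm_scale\<close>)

lemma hconv_unique:
  assumes "\<And>i. s i \<in> vcarrier H" "l \<in> vcarrier H" "k \<in> vcarrier H"
    "hconv H s l F" "hconv H s k F" "F \<noteq> bot"
  shows "l = k"
proof -
  have "hnorm H (vdiff H l k) \<le> 0"
  proof (rule tendsto_le[OF assms(6)])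
    show "((\<lambda>i. hnorm H (vdiff H (s i) l) + hnorm H (vdiff H (s i) k)) \<longlongrightarrow> 0) F"
      using tendsto_add[OF assms(4,5)[unfolded hconv_def]] by simp
    show "((\<lambda>i. hnorm H (vdiff H l k)) \<longlongrightarrow> hnorm H (vdiff H l k)) F" by simp
    show "\<forall>\<^sub>F i in F. hnorm H (vdiff H l k) \<le> hnorm H (vdiff H (s i) l) + hnorm H (vdiff H (s i) k)"
      using hnorm_vdiff_triangle[OF assms(2,1,3)] hnorm_vdiff_commute[OF assms(1,2)] by simp
  qed
  then show ?thesis using assms hnorm_nonneg[of "vdiff H l k"] hnorm_vdiff_eq_zero[of l k] by (simp add: closed)
qed

lemma hconv_norm_le:
  assumes "\<And>i. s i \<in> vcarrier H" "l \<in> vcarrier H" "hconv H s l F" "F \<noteq> bot"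
    "\<And>i. hnorm H (s i) \<le> K"
  shows "hnorm H l \<le> K"
proof (rule tendsto_le[OF assms(4)])
  show "((\<lambda>i. hnorm H (vdiff H (s i) l) + K) \<longlongrightarrow> K) F"
    using tendsto_add[OF assms(3)[unfolded hconv_def] tendsto_const] by simp
  show "((\<lambda>i. hnorm H l) \<longlongrightarrow> hnorm H l) F" by simp
  show "\<forall>\<^sub>F i in F. hnorm H l \<le> hnorm H (vdiff H (s i) l) + K"
  proof (intro always_eventually allI)
    fix i
    show "hnorm H l \<le> hnorm H (vdiff H (s i) l) + K"
      using hnorm_le_vdiff[OF assms(2,1), of i] hnorm_vdiff_commute[OF assms(1,2), of i] assms(5)[of i] by simp
  qed
qed

lemma hconv_inner:
  assumes "\<And>i. s i \<in> vcarrier H" "l \<in> vcarrier H" "hconv H s l F" "y \<in> vcarrier H"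
  shows "((\<lambda>i. hinner H (s i) y) \<longlongrightarrow> hinner H l y) F"
proof -
  have "((\<lambda>i. hinner H (s i) y - hinner H l y) \<longlongrightarrow> 0) F"
  proof (rule Lim_null_comparison)
    show "((\<lambda>i. hnorm H (vdiff H (s i) l) * hnorm H y) \<longlongrightarrow> 0) F"
      using tendsto_mult_right[OF assms(3)[unfolded hconv_def], of "hnorm H y"] by simp
    show "\<forall>\<^sub>F i in F. cmod (hinner H (s i) y - hinner H l y) \<le> hnorm H (vdiff H (s i) l) * hnorm H y"
      using Cauchy_Schwarz[OF vdiff_closed[OF assms(1,2)] assms(4)] assms
      by (simp add: inner_diff_left)
  qed
  then show ?thesis by (simp add: LIM_zero_iff)
qed

text \<open>\<open>\<zeta>\<close> minimises J x = |x|^2 - 2 Re(\<phi> x), which is at least -K^2.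
  Minimising sequences are Cauchy by the parallelogram law. If J(s n) is within 1/(n+1) of the
  infimum, varying s n by multiples of x gives |<s n, x> - \<phi> x|^2 <= |x|^2 / (n+1).\<close>

lemma Riesz_representation:
  assumes add: "\<And>x y. x \<in> vcarrier H \<Longrightarrow> y \<in> vcarrier H \<Longrightarrow> \<phi> (vadd H x y) = \<phi> x + \<phi> y"
    and scale: "\<And>c x. x \<in> vcarrier H \<Longrightarrow> \<phi> (vscale H c x) = c * \<phi> x"
    and bound: "\<And>x. x \<in> vcarrier H \<Longrightarrow> cmod (\<phi> x) \<le> K * hnorm H x"
  obtains \<zeta> where "\<zeta> \<in> vcarrier H" "\<And>x. x \<in> vcarrier H \<Longrightarrow> \<phi> x = hinner H \<zeta> x"
proof -
  define J where "J x = (hnorm H x)\<^sup>2 - 2 * Re (\<phi> x)" for x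
  have Jlow: "- K\<^sup>2 \<le> J x" if x: "x \<in> vcarrier H" for x
  proof -
    have "Re (\<phi> x) \<le> K * hnorm H x"
      using bound[OF x] complex_Re_le_cmod[of "\<phi> x"] by linarith
    moreover have "0 \<le> (hnorm H x - K)\<^sup>2" by simp
    ultimately show ?thesis by (simp add: J_def power2_diff algebra_simps)
  qed
  define m where "m = (INF x\<in>vcarrier H. J x)"
  have bdd: "bdd_below (J ` vcarrier H)" by (rule bdd_belowI2[of _ "- K\<^sup>2"]) (rule Jlow)
  have mle: "m \<le> J x" if "x \<in> vcarrier H" for x
    unfolding m_def by (rule cINF_lower[OF bdd that])
  have "\<exists>x\<in>vcarrier H. J x < m + 1 / real (Suc n)" for n
  proof -
    have "vcarrier H \<noteq> {}" using zero_closed by blast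
    then show ?thesis
      using cINF_less_iff[OF _ bdd, of "m + 1 / real (Suc n)"] by (simp add: m_def)
  qed
  then obtain s where s: "\<And>n. s n \<in> vcarrier H" "\<And>n. J (s n) < m + 1 / real (Suc n)" by metis
  have par: "(hnorm H (vdiff H x y))\<^sup>2 \<le> 2 * J x + 2 * J y - 4 * m"
    if x: "x \<in> vcarrier H" and y: "y \<in> vcarrier H" for x y
  proof -
    let ?h = "vscale H (1/2) (vadd H x y)"
    have "Re (\<phi> ?h) = (Re (\<phi> x) + Re (\<phi> y)) / 2" using x y by (simp add: scale add closed)
    moreover have "(hnorm H ?h)\<^sup>2 = (hnorm H (vadd H x y))\<^sup>2 / 4"
      using x y by (simp add: hnorm_scale closed power2_eq_square norm_divide)
    moreover have "(hnorm H (vadd H x y))\<^sup>2 = (hnorm H x)\<^sup>2 + 2 * Re (hinner H x y) + (hnorm H y)\<^sup>2"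
      using hnorm_add_scale_sq[OF x y, of 1] y by (simp add: scale_one)
    moreover have "(hnorm H (vdiff H x y))\<^sup>2 = (hnorm H x)\<^sup>2 - 2 * Re (hinner H x y) + (hnorm H y)\<^sup>2"
      using hnorm_add_scale_sq[OF x y, of "-1"] by (simp add: vdiff_def)
    moreover have "m \<le> J ?h" using x y by (intro mle closed)
    \<comment> \<open>The real arithmetic behind the parallelogram estimate, stated for variables so
      that \<open>blast\<close> can match it with the facts collected above.\<close>
    moreover have "d \<le> 2 * (X - 2 * a) + 2 * (Y - 2 * b) - 4 * m'"
      if "p = (a + b) / 2" "h = s / 4" "s = X + 2 * R + Y" "d = X - 2 * R + Y" "m' \<le> h - 2 * p"
      for a b p h s X Y R d m' :: real
      using that by (simp add: field_simps)
    ultimately show ?thesis unfolding J_def by blast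
  qed
  have "\<exists>N. \<forall>i\<ge>N. \<forall>j\<ge>N. hnorm H (vdiff H (s i) (s j)) < e" if e: "e > 0" for e
  proof -
    \<comment> \<open>Beyond this N each 1/(k+1) is below e^2/4, and \<open>par\<close> bounds the
      squared distance by 2/(i+1) + 2/(j+1) < e^2.\<close>
    obtain N where N: "4 / e\<^sup>2 < real N" using reals_Archimedean2 by blast
    have "hnorm H (vdiff H (s i) (s j)) < e" if ij: "i \<ge> N" "j \<ge> N" for i j
    proof -
      have inv: "1 / real (Suc k) < e\<^sup>2 / 4" if "k \<ge> N" for k
      proof -
        have "4 / e\<^sup>2 < real (Suc k)" using N that by linarith
        then show ?thesis using e by (simp add: field_simps)
      qed
      have "(hnorm H (vdiff H (s i) (s j)))\<^sup>2 < e\<^sup>2"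
        using par[OF s(1) s(1), of i j] s(2)[of i] s(2)[of j] inv[OF ij(1)] inv[OF ij(2)] by linarith
      then show ?thesis using e by (intro power2_less_imp_less[of _ e]) auto
    qed
    then show ?thesis by blast
  qed
  then obtain \<zeta> where \<zeta>: "\<zeta> \<in> vcarrier H" "(\<lambda>n. hnorm H (vdiff H (s n) \<zeta>)) \<longlonglongrightarrow> 0"
    by (rule complete_wrtD[OF complete, of s, OF s(1)]) blast+
  show thesis
  proof (rule that[OF \<zeta>(1)])
    fix x assume x: "x \<in> vcarrier H"
    have le: "(cmod (hinner H (s n) x - \<phi> x))\<^sup>2 \<le> 1 / real (Suc n) * (hnorm H x)\<^sup>2" for n
    proof (rule discriminant_complex)
      fix c
      have "m \<le> J (vadd H (s n) (vscale H c x))" using x s by (intro mle closed)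
      also have "\<dots> = J (s n) + 2 * Re (c * (hinner H (s n) x - \<phi> x)) + (cmod c)\<^sup>2 * (hnorm H x)\<^sup>2"
        using x s by (simp add: J_def hnorm_add_scale_sq add scale closed algebra_simps)
      finally show "0 \<le> 1 / real (Suc n) + 2 * Re (c * (hinner H (s n) x - \<phi> x)) + (cmod c)\<^sup>2 * (hnorm H x)\<^sup>2"
        using s(2)[of n] by linarith
    qed simp
    have lim: "(\<lambda>n. 1 / real (Suc n) * (hnorm H x)\<^sup>2) \<longlonglongrightarrow> 0"
      using tendsto_mult_right[OF lim_inverse_n', of "(hnorm H x)\<^sup>2"]
      by (intro LIMSEQ_Suc[where f = "\<lambda>n. 1 / real n * (hnorm H x)\<^sup>2"]) simp
    have "(\<lambda>n. (cmod (hinner H (s n) x - \<phi> x))\<^sup>2) \<longlonglongrightarrow> 0"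
      by (rule tendsto_sandwich[OF _ _ tendsto_const lim]) (use le in auto)
    then have "(\<lambda>n. sqrt ((cmod (hinner H (s n) x - \<phi> x))\<^sup>2)) \<longlonglongrightarrow> sqrt 0"
      by (rule tendsto_real_sqrt)
    then have "(\<lambda>n. hinner H (s n) x - \<phi> x) \<longlonglongrightarrow> 0"
      by (simp add: tendsto_norm_zero_iff)
    then have "(\<lambda>n. hinner H (s n) x) \<longlonglongrightarrow> \<phi> x" by (simp add: LIM_zero_iff)
    moreover have "(\<lambda>n. hinner H (s n) x) \<longlonglongrightarrow> hinner H \<zeta> x"
      by (rule hconv_inner[OF s(1) \<zeta>(1) _ x]) (simp add: hconv_def \<zeta>(2))
    ultimately show "\<phi> x = hinner H \<zeta> x" by (rule LIMSEQ_unique)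
  qed
qed

section \<open>Bounded operators, their norm and adjoints, and the C*-algebra B(H)\<close>

lemma bounded_operatorsI:
  assumes "T \<in> vcarrier H \<rightarrow>\<^sub>E vcarrier H"
    "\<And>x y. x \<in> vcarrier H \<Longrightarrow> y \<in> vcarrier H \<Longrightarrow> T (vadd H x y) = vadd H (T x) (T y)"
    "\<And>c x. x \<in> vcarrier H \<Longrightarrow> T (vscale H c x) = vscale H c (T x)"
    "\<And>x. x \<in> vcarrier H \<Longrightarrow> hnorm H (T x) \<le> K * hnorm H x"
  shows "T \<in> bounded_operators H"
  unfolding bounded_operators_def mem_Collect_eq
  by (intro conjI ballI allI exI[of _ K] assms)

lemma op_closed: "T \<in> bounded_operators H \<Longrightarrow> x \<in> vcarrier H \<Longrightarrow> T x \<in> vcarrier H"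
  by (auto simp: bounded_operators_def)

lemma op_undefined: "T \<in> bounded_operators H \<Longrightarrow> x \<notin> vcarrier H \<Longrightarrow> T x = undefined"
  by (auto simp: bounded_operators_def)

lemma op_add: "\<lbrakk>T \<in> bounded_operators H; x \<in> vcarrier H; y \<in> vcarrier H\<rbrakk>
    \<Longrightarrow> T (vadd H x y) = vadd H (T x) (T y)"
  by (auto simp: bounded_operators_def)

lemma op_scale: "\<lbrakk>T \<in> bounded_operators H; x \<in> vcarrier H\<rbrakk> \<Longrightarrow> T (vscale H c x) = vscale H c (T x)"
  by (auto simp: bounded_operators_def)

lemma op_diff: "\<lbrakk>T \<in> bounded_operators H; x \<in> vcarrier H; y \<in> vcarrier H\<rbrakk>
    \<Longrightarrow> T (vdiff H x y) = vdiff H (T x) (T y)"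
  by (simp add: vdiff_def op_add op_scale closed)

lemma op_ext:
  "\<lbrakk>S \<in> bounded_operators H; T \<in> bounded_operators H; \<And>x. x \<in> vcarrier H \<Longrightarrow> S x = T x\<rbrakk> \<Longrightarrow> S = T"
  by (rule PiE_ext[of S "vcarrier H" "\<lambda>_. vcarrier H"]) (auto simp: bounded_operators_def)

lemma op_bound:
  assumes "T \<in> bounded_operators H"
  obtains K where "K \<ge> 0" "\<And>x. x \<in> vcarrier H \<Longrightarrow> hnorm H (T x) \<le> K * hnorm H x"
proof -
  obtain K where K: "\<forall>x\<in>vcarrier H. hnorm H (T x) \<le> K * hnorm H x"
    using assms by (auto simp: bounded_operators_def)
  show thesis
  proof (rule that[of "max K 0"])
    fix x assume x: "x \<in> vcarrier H"
    show "hnorm H (T x) \<le> max K 0 * hnorm H x"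
      using K[rule_format, OF x] mult_right_mono[of K "max K 0" "hnorm H x"] hnorm_nonneg[OF x] by simp
  qed simp
qed

lemma BH_simps [simp]:
  "vcarrier (BH H) = bounded_operators H"
  "vzero (BH H) = (\<lambda>\<xi>\<in>vcarrier H. vzero H)"
  "vadd (BH H) S T = (\<lambda>\<xi>\<in>vcarrier H. vadd H (S \<xi>) (T \<xi>))"
  "vscale (BH H) c T = (\<lambda>\<xi>\<in>vcarrier H. vscale H c (T \<xi>))"
  "amult (BH H) S T = (\<lambda>\<xi>\<in>vcarrier H. S (T \<xi>))"
  "astar (BH H) T = adjoint_op H T"
  by (simp_all add: BH_def)

lemma vdiff_BH: "vdiff (BH H) S T = (\<lambda>\<xi>\<in>vcarrier H. vdiff H (S \<xi>) (T \<xi>))"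
  by (auto simp: vdiff_def)

lemma opnorm_bdd:
  "T \<in> bounded_operators H \<Longrightarrow> bdd_above {hnorm H (T \<xi>) |\<xi>. \<xi> \<in> vcarrier H \<and> hnorm H \<xi> \<le> 1}"
proof -
  assume "T \<in> bounded_operators H"
  then obtain K where K: "K \<ge> 0" "\<And>x. x \<in> vcarrier H \<Longrightarrow> hnorm H (T x) \<le> K * hnorm H x"
    by (rule op_bound) blast
  show ?thesis
  proof (rule bdd_aboveI[where M = K], clarify)
    fix \<xi> assume "\<xi> \<in> vcarrier H" "hnorm H \<xi> \<le> 1"
    then show "hnorm H (T \<xi>) \<le> K" using K(2)[of \<xi>] mult_left_le[of "hnorm H \<xi>" K] K(1) by linarith
  qed
qed

lemma opnorm_upper1:
  "T \<in> bounded_operators H \<Longrightarrow> x \<in> vcarrier H \<Longrightarrow> hnorm H x \<le> 1 \<Longrightarrow> hnorm H (T x) \<le> anorm (BH H) T"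
  using cSup_upper[OF _ opnorm_bdd, of "hnorm H (T x)" T] by (auto simp: BH_def)

lemma opnorm_nonneg: "T \<in> bounded_operators H \<Longrightarrow> 0 \<le> anorm (BH H) T"
  using opnorm_upper1[of T "vzero H"] hnorm_nonneg[OF op_closed[of T "vzero H"]]
  by (simp add: zero_closed hnorm_zero)

lemma opnorm_upper:
  assumes T: "T \<in> bounded_operators H" and x: "x \<in> vcarrier H"
  shows "hnorm H (T x) \<le> anorm (BH H) T * hnorm H x"
proof (cases "hnorm H x = 0")
  case True
  then have "x = vscale H 0 x" using x by (simp add: hnorm_eq_zero scale_zero_right)
  then have "T x = vscale H 0 (T x)" using op_scale[OF T x, of 0] by simp
  then show ?thesis using True by (metis hnorm_zero op_closed[OF T x] scale_zero_left mult_zero_right order_refl)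
next
  case False
  then have pos: "hnorm H x > 0" using hnorm_nonneg[OF x] by simp
  have "hnorm H (T (vscale H (of_real (1 / hnorm H x)) x)) \<le> anorm (BH H) T"
    using pos x by (intro opnorm_upper1 T closed) (auto simp: hnorm_scale norm_divide)
  then show ?thesis using pos x T
    by (simp add: op_scale hnorm_scale op_closed norm_divide field_simps)
qed

lemma opnorm_least:
  assumes "K \<ge> 0" "\<And>x. x \<in> vcarrier H \<Longrightarrow> hnorm H (T x) \<le> K * hnorm H x"
  shows "anorm (BH H) T \<le> K"
proof -
  have "Sup {hnorm H (T \<xi>) |\<xi>. \<xi> \<in> vcarrier H \<and> hnorm H \<xi> \<le> 1} \<le> K"
  proof (rule cSup_least)
    show "{hnorm H (T \<xi>) |\<xi>. \<xi> \<in> vcarrier H \<and> hnorm H \<xi> \<le> 1} \<noteq> {}"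
      using zero_closed hnorm_zero by auto
    fix r assume "r \<in> {hnorm H (T \<xi>) |\<xi>. \<xi> \<in> vcarrier H \<and> hnorm H \<xi> \<le> 1}"
    then obtain \<xi> where "r = hnorm H (T \<xi>)" "\<xi> \<in> vcarrier H" "hnorm H \<xi> \<le> 1" by blast
    then show "r \<le> K" using assms(2)[of \<xi>] mult_left_le[of "hnorm H \<xi>" K] assms(1) by linarith
  qed
  then show ?thesis by (simp add: BH_def)
qed

text \<open>\<open>adjoint_op\<close> is a definite description, so unique existence has to precede
  every fact about it. The vector S \<xi> is the Riesz vector of \<eta> |-> <\<xi>, T \<eta>>, and
  |Sx|^2 = <x, T S x> bounds S.\<close>

lemma adjoint_exists:
  assumes T: "T \<in> bounded_operators H"
  shows "\<exists>!S. S \<in> bounded_operators H \<and>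
    (\<forall>\<xi>\<in>vcarrier H. \<forall>\<eta>\<in>vcarrier H. hinner H (S \<xi>) \<eta> = hinner H \<xi> (T \<eta>))"
proof -
  obtain K where K: "K \<ge> 0" "\<And>x. x \<in> vcarrier H \<Longrightarrow> hnorm H (T x) \<le> K * hnorm H x"
    by (rule op_bound[OF T]) blast
  have phi_add: "hinner H \<xi> (T (vadd H x y)) = hinner H \<xi> (T x) + hinner H \<xi> (T y)"
    if "\<xi> \<in> vcarrier H" "x \<in> vcarrier H" "y \<in> vcarrier H" for \<xi> x y
    using that by (simp add: op_add[OF T] inner_add_right op_closed[OF T])
  have phi_scale: "hinner H \<xi> (T (vscale H c x)) = c * hinner H \<xi> (T x)"
    if "\<xi> \<in> vcarrier H" "x \<in> vcarrier H" for \<xi> x c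
    using that by (simp add: op_scale[OF T] inner_scale_right op_closed[OF T])
  have "\<exists>\<zeta>\<in>vcarrier H. \<forall>\<eta>\<in>vcarrier H. hinner H \<zeta> \<eta> = hinner H \<xi> (T \<eta>)" if \<xi>: "\<xi> \<in> vcarrier H" for \<xi>
  proof -
    have bd: "cmod (hinner H \<xi> (T x)) \<le> (hnorm H \<xi> * K) * hnorm H x" if x: "x \<in> vcarrier H" for x
    proof -
      have "cmod (hinner H \<xi> (T x)) \<le> hnorm H \<xi> * hnorm H (T x)"
        by (intro Cauchy_Schwarz op_closed[OF T] x \<xi>)
      also have "\<dots> \<le> hnorm H \<xi> * (K * hnorm H x)" by (intro mult_left_mono K x hnorm_nonneg \<xi>)
      finally show ?thesis by (simp add: mult.assoc)
    qed
    obtain \<zeta> where "\<zeta> \<in> vcarrier H" "\<And>x. x \<in> vcarrier H \<Longrightarrow> hinner H \<xi> (T x) = hinner H \<zeta> x"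
      by (rule Riesz_representation[of "\<lambda>x. hinner H \<xi> (T x)", OF phi_add[OF \<xi>] phi_scale[OF \<xi>] bd])
        blast+
    then show ?thesis by (intro bexI[of _ \<zeta>]) auto
  qed
  then obtain S0 where S0: "\<And>\<xi>. \<xi> \<in> vcarrier H \<Longrightarrow> S0 \<xi> \<in> vcarrier H"
    "\<And>\<xi> \<eta>. \<xi> \<in> vcarrier H \<Longrightarrow> \<eta> \<in> vcarrier H \<Longrightarrow> hinner H (S0 \<xi>) \<eta> = hinner H \<xi> (T \<eta>)"
    by metis
  define S where "S = restrict S0 (vcarrier H)"
  have Sc: "S \<xi> \<in> vcarrier H" if "\<xi> \<in> vcarrier H" for \<xi> using that by (simp add: S_def S0)
  have Si: "hinner H (S \<xi>) \<eta> = hinner H \<xi> (T \<eta>)" if "\<xi> \<in> vcarrier H" "\<eta> \<in> vcarrier H" for \<xi> \<eta>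
    using that by (simp add: S_def S0)
  have "S \<in> bounded_operators H"
  proof (rule bounded_operatorsI[where K = K])
    show "S \<in> vcarrier H \<rightarrow>\<^sub>E vcarrier H" by (auto simp: S_def S0)
    fix x assume x: "x \<in> vcarrier H"
    show "S (vscale H c x) = vscale H c (S x)" for c
      by (rule eq_by_inner) (auto simp: x Sc Si closed inner_simps op_closed T)
    have "(hnorm H (S x))\<^sup>2 = cmod (hinner H (S x) (S x))"
      using x by (simp add: cmod_inner_self Sc)
    also have "\<dots> = cmod (hinner H x (T (S x)))" using x by (simp add: Si Sc)
    also have "\<dots> \<le> hnorm H x * (K * hnorm H (S x))"
      using x Cauchy_Schwarz[of x "T (S x)"] mult_left_mono[OF K(2)[of "S x"] hnorm_nonneg[OF x]]
      by (fastforce simp: Sc op_closed T)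
    finally have sq: "hnorm H (S x) * hnorm H (S x) \<le> (K * hnorm H x) * hnorm H (S x)"
      by (simp add: power2_eq_square algebra_simps)
    show "hnorm H (S x) \<le> K * hnorm H x"
    proof (cases "hnorm H (S x) = 0")
      case False
      then have "hnorm H (S x) > 0" using hnorm_nonneg[OF Sc[OF x]] by simp
      then show ?thesis using sq by simp
    qed (use K x hnorm_nonneg in simp)
  next
    fix x y assume "x \<in> vcarrier H" "y \<in> vcarrier H"
    then show "S (vadd H x y) = vadd H (S x) (S y)"
      by (intro eq_by_inner) (auto simp: Sc Si closed inner_simps op_closed T)
  qed
  moreover have "S' = S" if "S' \<in> bounded_operators H"
    "\<forall>\<xi>\<in>vcarrier H. \<forall>\<eta>\<in>vcarrier H. hinner H (S' \<xi>) \<eta> = hinner H \<xi> (T \<eta>)" for S'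
    using that by (intro op_ext[OF _ \<open>S \<in> _\<close>] eq_by_inner) (auto simp: Si Sc op_closed)
  ultimately show ?thesis using Si by blast
qed

lemma adjoint_closed: "T \<in> bounded_operators H \<Longrightarrow> adjoint_op H T \<in> bounded_operators H"
  using theI'[OF adjoint_exists] unfolding adjoint_op_def by blast

lemma adjoint_inner: "\<lbrakk>T \<in> bounded_operators H; x \<in> vcarrier H; y \<in> vcarrier H\<rbrakk>
    \<Longrightarrow> hinner H (adjoint_op H T x) y = hinner H x (T y)"
  using theI'[OF adjoint_exists] unfolding adjoint_op_def by blast

lemma adjoint_inner': "\<lbrakk>T \<in> bounded_operators H; x \<in> vcarrier H; y \<in> vcarrier H\<rbrakk>
    \<Longrightarrow> hinner H x (adjoint_op H T y) = hinner H (T x) y"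
  using adjoint_inner[of T y x] inner_commute[of "adjoint_op H T y" x] inner_commute[of y "T x"]
  by (simp add: op_closed adjoint_closed)

lemma adjoint_eqI:
  assumes "T \<in> bounded_operators H" "S \<in> bounded_operators H"
    "\<And>x y. x \<in> vcarrier H \<Longrightarrow> y \<in> vcarrier H \<Longrightarrow> hinner H (S x) y = hinner H x (T y)"
  shows "adjoint_op H T = S"
  unfolding adjoint_op_def by (rule the1_equality[OF adjoint_exists[OF assms(1)]]) (use assms in blast)

lemma op_zero_closed: "(\<lambda>\<xi>\<in>vcarrier H. vzero H) \<in> bounded_operators H"
  by (rule bounded_operatorsI[where K = 0]) (auto simp: closed add_zero scale_zero_right hnorm_zero)

lemma op_add_closed:
  assumes "S \<in> bounded_operators H" "T \<in> bounded_operators H"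
  shows "(\<lambda>\<xi>\<in>vcarrier H. vadd H (S \<xi>) (T \<xi>)) \<in> bounded_operators H"
proof (rule bounded_operatorsI[where K = "anorm (BH H) S + anorm (BH H) T"])
  fix x assume x: "x \<in> vcarrier H"
  show "hnorm H ((\<lambda>\<xi>\<in>vcarrier H. vadd H (S \<xi>) (T \<xi>)) x) \<le> (anorm (BH H) S + anorm (BH H) T) * hnorm H x"
    using hnorm_triangle[of "S x" "T x"] opnorm_upper[OF assms(1) x] opnorm_upper[OF assms(2) x] x assms
    by (simp add: op_closed distrib_right)
qed (use assms in \<open>auto simp: closed op_closed op_add op_scale scale_add_right add_ac\<close>)

lemma op_scale_closed:
  assumes "T \<in> bounded_operators H"
  shows "(\<lambda>\<xi>\<in>vcarrier H. vscale H c (T \<xi>)) \<in> bounded_operators H"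
proof (rule bounded_operatorsI[where K = "cmod c * anorm (BH H) T"])
  fix x assume x: "x \<in> vcarrier H"
  show "hnorm H ((\<lambda>\<xi>\<in>vcarrier H. vscale H c (T \<xi>)) x) \<le> (cmod c * anorm (BH H) T) * hnorm H x"
    using opnorm_upper[OF assms x] x assms by (simp add: op_closed hnorm_scale mult.assoc mult_left_mono)
qed (use assms in \<open>auto simp: closed op_closed op_add op_scale scale_add_right scale_scale mult.commute\<close>)

lemma op_mult_bound:
  assumes "S \<in> bounded_operators H" "T \<in> bounded_operators H" "x \<in> vcarrier H"
  shows "hnorm H (S (T x)) \<le> anorm (BH H) S * anorm (BH H) T * hnorm H x"
proof -
  have "hnorm H (S (T x)) \<le> anorm (BH H) S * hnorm H (T x)"
    by (intro opnorm_upper op_closed[OF assms(2)] assms)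
  also have "\<dots> \<le> anorm (BH H) S * (anorm (BH H) T * hnorm H x)"
    using assms by (intro mult_left_mono opnorm_upper opnorm_nonneg)
  finally show ?thesis by (simp add: mult.assoc)
qed

lemma op_mult_closed:
  assumes "S \<in> bounded_operators H" "T \<in> bounded_operators H"
  shows "(\<lambda>\<xi>\<in>vcarrier H. S (T \<xi>)) \<in> bounded_operators H"
  by (rule bounded_operatorsI[where K = "anorm (BH H) S * anorm (BH H) T"])
    (use assms in \<open>auto simp: closed op_closed op_add op_scale op_mult_bound\<close>)

lemma opnorm_adjoint_le:
  assumes T: "T \<in> bounded_operators H"
  shows "anorm (BH H) (adjoint_op H T) \<le> anorm (BH H) T"
proof (rule opnorm_least[OF opnorm_nonneg[OF T]])
  fix x assume x: "x \<in> vcarrier H"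
  let ?y = "adjoint_op H T x"
  have y: "?y \<in> vcarrier H" by (intro op_closed[OF adjoint_closed[OF T]] x)
  have "(hnorm H ?y)\<^sup>2 = cmod (hinner H x (T ?y))"
    using adjoint_inner[OF T x y] cmod_inner_self[OF y] by simp
  also have "\<dots> \<le> hnorm H x * hnorm H (T ?y)" by (intro Cauchy_Schwarz op_closed[OF T] x y)
  also have "\<dots> \<le> hnorm H x * (anorm (BH H) T * hnorm H ?y)"
    by (intro mult_left_mono opnorm_upper hnorm_nonneg T x y)
  finally have sq: "hnorm H ?y * hnorm H ?y \<le> (anorm (BH H) T * hnorm H x) * hnorm H ?y"
    by (simp add: power2_eq_square algebra_simps)
  show "hnorm H ?y \<le> anorm (BH H) T * hnorm H x"
  proof (cases "hnorm H ?y = 0")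
    case False
    then have "hnorm H ?y > 0" using hnorm_nonneg[OF y] by simp
    then show ?thesis using sq by simp
  qed (use opnorm_nonneg[OF T] hnorm_nonneg[OF x] in simp)
qed

lemma bounded_operators_limit:
  assumes T: "\<And>i. T i \<in> bounded_operators H" and K: "\<And>i. anorm (BH H) (T i) \<le> K" and F: "F \<noteq> bot"
    and L: "\<And>x. x \<in> vcarrier H \<Longrightarrow> L x \<in> vcarrier H"
    and lim: "\<And>x. x \<in> vcarrier H \<Longrightarrow> hconv H (\<lambda>i. T i x) (L x) F"
  shows "restrict L (vcarrier H) \<in> bounded_operators H"
proof (rule bounded_operatorsI[where K = K])
  note c = closed op_closed[OF T] L
  fix x assume x: "x \<in> vcarrier H"
  have "hconv H (\<lambda>i. T i (vscale H k x)) (vscale H k (L x)) F" for k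
    using hconv_scale[OF _ _ lim[OF x], of k] x by (simp add: c op_scale[OF T])
  then have "L (vscale H k x) = vscale H k (L x)" for k
    by (intro hconv_unique[OF _ _ _ lim _ F]) (auto simp: c x)
  then show "restrict L (vcarrier H) (vscale H k x) = vscale H k (restrict L (vcarrier H) x)" for k
    using x by (simp add: c)
  have "hnorm H (L x) \<le> K * hnorm H x"
  proof (rule hconv_norm_le[OF _ _ lim[OF x] F])
    show "hnorm H (T i x) \<le> K * hnorm H x" for i
      using opnorm_upper[OF T x, of i] mult_right_mono[OF K[of i] hnorm_nonneg[OF x]] by linarith
  qed (auto simp: c x)
  then show "hnorm H (restrict L (vcarrier H) x) \<le> K * hnorm H x" using x by simp
next
  note c = closed op_closed[OF T] L
  fix x y assume x: "x \<in> vcarrier H" and y: "y \<in> vcarrier H"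
  have "hconv H (\<lambda>i. T i (vadd H x y)) (vadd H (L x) (L y)) F"
    using hconv_add[OF _ _ _ _ lim[OF x] lim[OF y]] x y by (simp add: c op_add[OF T])
  then have "L (vadd H x y) = vadd H (L x) (L y)"
    by (intro hconv_unique[OF _ _ _ lim _ F]) (auto simp: c x y)
  then show "restrict L (vcarrier H) (vadd H x y)
      = vadd H (restrict L (vcarrier H) x) (restrict L (vcarrier H) y)"
    using x y by (simp add: c)
qed (use L in auto)

lemma BH_complete: "complete_wrt (BH H) (anorm (BH H))"
  unfolding complete_wrt_def
proof (intro allI impI, elim conjE)
  fix s :: "nat \<Rightarrow> 'a \<Rightarrow> 'a"
  assume "\<forall>n. s n \<in> vcarrier (BH H)"
    and C: "\<forall>e>0. \<exists>N. \<forall>m\<ge>N. \<forall>n\<ge>N. anorm (BH H) (vdiff (BH H) (s m) (s n)) < e"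
  then have s: "s n \<in> bounded_operators H" for n by simp
  have d: "vdiff (BH H) S T \<in> bounded_operators H"
    if "S \<in> bounded_operators H" "T \<in> bounded_operators H" for S T
    using op_add_closed[OF that(1) op_scale_closed[OF that(2)], of "-1"] by (simp add: vdiff_def)
  have dx: "hnorm H (vdiff H (s m x) (s n x)) \<le> anorm (BH H) (vdiff (BH H) (s m) (s n)) * hnorm H x"
    if x: "x \<in> vcarrier H" for x m n
    using opnorm_upper[OF d[OF s s] x, of m n] x by (simp add: vdiff_BH)
  have unif: "\<exists>N. \<forall>m\<ge>N. \<forall>n\<ge>N. \<forall>x\<in>vcarrier H. hnorm H (vdiff H (s m x) (s n x)) \<le> e * hnorm H x"
    if "e > 0" for e
  proof -
    obtain N where N: "\<forall>m\<ge>N. \<forall>n\<ge>N. anorm (BH H) (vdiff (BH H) (s m) (s n)) < e"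
      using C[rule_format, OF \<open>e > 0\<close>] by blast
    have "hnorm H (vdiff H (s m x) (s n x)) \<le> e * hnorm H x" if "m \<ge> N" "n \<ge> N" "x \<in> vcarrier H" for m n x
      using dx[OF that(3), of m n] N that hnorm_nonneg[OF that(3)]
      by (meson less_imp_le mult_right_mono order_trans)
    then show ?thesis by blast
  qed
  have "\<exists>l\<in>vcarrier H. hconv H (\<lambda>n. s n x) l sequentially" if x: "x \<in> vcarrier H" for x
  proof -
    have "\<exists>N. \<forall>m\<ge>N. \<forall>n\<ge>N. hnorm H (vdiff H (s m x) (s n x)) < e" if e: "e > 0" for e
    proof -
      have p: "e / (hnorm H x + 1) > 0" using e hnorm_nonneg[OF x] by simp
      have "e / (hnorm H x + 1) * hnorm H x < e"
        using e hnorm_nonneg[OF x] by (simp add: field_simps)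
      then show ?thesis using unif[OF p] x by (meson le_less_trans)
    qed
    then obtain l where "l \<in> vcarrier H" "(\<lambda>n. hnorm H (vdiff H (s n x) l)) \<longlonglongrightarrow> 0"
      by (rule complete_wrtD[OF complete, of "\<lambda>n. s n x", OF op_closed[OF s x]]) blast+
    then show ?thesis by (auto simp: hconv_def)
  qed
  then obtain L where L: "\<And>x. x \<in> vcarrier H \<Longrightarrow> L x \<in> vcarrier H"
    "\<And>x. x \<in> vcarrier H \<Longrightarrow> hconv H (\<lambda>n. s n x) (L x) sequentially" by metis
  have near: "\<exists>N. \<forall>n\<ge>N. \<forall>x\<in>vcarrier H. hnorm H (vdiff H (s n x) (L x)) \<le> e * hnorm H x"
    if e: "e > 0" for e
  proof -
    obtain N where N: "\<forall>m\<ge>N. \<forall>n\<ge>N. \<forall>x\<in>vcarrier H. hnorm H (vdiff H (s m x) (s n x)) \<le> e * hnorm H x"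
      using unif[OF e] by blast
    have "hnorm H (vdiff H (s n x) (L x)) \<le> e * hnorm H x" if n: "n \<ge> N" and x: "x \<in> vcarrier H" for n x
    proof (rule tendsto_le[OF trivial_limit_sequentially])
      show "(\<lambda>m. e * hnorm H x + hnorm H (vdiff H (s m x) (L x))) \<longlonglongrightarrow> e * hnorm H x"
        using tendsto_add[OF tendsto_const L(2)[OF x, unfolded hconv_def], of "e * hnorm H x"] by simp
      show "\<forall>\<^sub>F m in sequentially. hnorm H (vdiff H (s n x) (L x)) \<le> e * hnorm H x + hnorm H (vdiff H (s m x) (L x))"
        using eventually_ge_at_top[of N]
      proof eventually_elim
        case (elim m)
        show ?case
          using hnorm_vdiff_triangle[OF op_closed[OF s x] op_closed[OF s x] L(1)[OF x], of n m] N n elim x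
          by fastforce
      qed
    qed (rule tendsto_const)
    then show ?thesis by blast
  qed
  obtain N where N: "\<forall>m\<ge>N. \<forall>n\<ge>N. \<forall>x\<in>vcarrier H. hnorm H (vdiff H (s m x) (s n x)) \<le> 1 * hnorm H x"
    using unif[of 1] by auto
  \<comment> \<open>Only the tail from N on is known to be uniformly bounded, hence the shifted
    sequence.\<close>
  have bd: "anorm (BH H) (s (n + N)) \<le> 1 + anorm (BH H) (s N)" for n
  proof (rule opnorm_least)
    fix x assume x: "x \<in> vcarrier H"
    have "hnorm H (vdiff H (s (n + N) x) (s N x)) \<le> 1 * hnorm H x" using N x by simp
    then show "hnorm H (s (n + N) x) \<le> (1 + anorm (BH H) (s N)) * hnorm H x"
      using hnorm_le_vdiff[OF op_closed[OF s x] op_closed[OF s x], of "n + N" N] opnorm_upper[OF s x, of N]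
      by (simp add: distrib_right)
  qed (use opnorm_nonneg[OF s, of N] in simp)
  have "restrict L (vcarrier H) \<in> bounded_operators H"
  proof (rule bounded_operators_limit[OF s bd trivial_limit_sequentially L(1)])
    show "hconv H (\<lambda>n. s (n + N) x) (L x) sequentially" if "x \<in> vcarrier H" for x
      using LIMSEQ_ignore_initial_segment[OF L(2)[OF that, unfolded hconv_def], of N]
      by (simp add: hconv_def)
  qed
  moreover have "(\<lambda>n. anorm (BH H) (vdiff (BH H) (s n) (restrict L (vcarrier H)))) \<longlonglongrightarrow> 0"
  proof (rule LIMSEQ_I)
    fix r :: real assume r: "r > 0"
    obtain M where M: "\<forall>n\<ge>M. \<forall>x\<in>vcarrier H. hnorm H (vdiff H (s n x) (L x)) \<le> r / 2 * hnorm H x"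
      using near[of "r / 2"] r by auto
    have "norm (anorm (BH H) (vdiff (BH H) (s n) (restrict L (vcarrier H))) - 0) < r" if n: "n \<ge> M" for n
    proof -
      have "anorm (BH H) (vdiff (BH H) (s n) (restrict L (vcarrier H))) \<le> r / 2"
        by (rule opnorm_least) (use r n M in \<open>auto simp: vdiff_BH\<close>)
      then show ?thesis
        using r opnorm_nonneg[OF d[OF s \<open>restrict L (vcarrier H) \<in> bounded_operators H\<close>], of n] by simp
    qed
    then show "\<exists>M. \<forall>n\<ge>M. norm (anorm (BH H) (vdiff (BH H) (s n) (restrict L (vcarrier H))) - 0) < r"
      by blast
  qed
  ultimately show "\<exists>l\<in>vcarrier (BH H). (\<lambda>n. anorm (BH H) (vdiff (BH H) (s n) l)) \<longlonglongrightarrow> 0"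
    by auto
qed

lemma cstar_BH: "cstar_algebra (BH H)"
proof -
  note c = closed op_closed adjoint_closed
  note oc = op_zero_closed op_add_closed op_scale_closed op_mult_closed adjoint_closed
  show ?thesis
  proof unfold_locales
    fix T assume asm: "T \<in> vcarrier (BH H)"
    then show "astar (BH H) (astar (BH H) T) = T"
      unfolding BH_simps by (intro adjoint_eqI) (auto simp: adjoint_inner' c)
  next
    fix S T assume asm: "S \<in> vcarrier (BH H)" "T \<in> vcarrier (BH H)"
    then show "astar (BH H) (vadd (BH H) S T) = vadd (BH H) (astar (BH H) S) (astar (BH H) T)"
      unfolding BH_simps by (intro adjoint_eqI) (auto simp: adjoint_inner c oc inner_simps)
  next
    fix T and k :: complex assume asm: "T \<in> vcarrier (BH H)"
    then show "astar (BH H) (vscale (BH H) k T) = vscale (BH H) (cnj k) (astar (BH H) T)"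
      unfolding BH_simps by (intro adjoint_eqI) (auto simp: adjoint_inner c oc inner_simps)
  next
    fix S T assume asm: "S \<in> vcarrier (BH H)" "T \<in> vcarrier (BH H)"
    then show "astar (BH H) (amult (BH H) S T) = amult (BH H) (astar (BH H) T) (astar (BH H) S)"
      unfolding BH_simps by (intro adjoint_eqI) (auto simp: adjoint_inner c oc inner_simps)
  next
    fix T assume asm: "T \<in> vcarrier (BH H)"
    then show "0 \<le> anorm (BH H) T" by (simp add: opnorm_nonneg)
  next
    fix T assume asm: "T \<in> vcarrier (BH H)"
    then have T: "T \<in> bounded_operators H" by simp
    show "anorm (BH H) T = 0 \<longleftrightarrow> T = vzero (BH H)"
    proof
      assume z: "anorm (BH H) T = 0"
      have "T x = vzero H" if x: "x \<in> vcarrier H" for x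
        using opnorm_upper[OF T x] hnorm_nonneg[OF op_closed[OF T x]] z hnorm_eq_zero[OF op_closed[OF T x]] by simp
      then show "T = vzero (BH H)" by (intro op_ext T) (auto simp: op_zero_closed)
    next
      assume "T = vzero (BH H)"
      then have "anorm (BH H) T \<le> 0" by (intro opnorm_least) (auto simp: hnorm_zero)
      then show "anorm (BH H) T = 0" using opnorm_nonneg[OF T] by simp
    qed
  next
    fix S T assume asm: "S \<in> vcarrier (BH H)" "T \<in> vcarrier (BH H)"
    then have ST: "S \<in> bounded_operators H" "T \<in> bounded_operators H" by simp_all
    show "anorm (BH H) (vadd (BH H) S T) \<le> anorm (BH H) S + anorm (BH H) T"
    proof (rule opnorm_least)
      fix x assume x: "x \<in> vcarrier H"
      show "hnorm H (vadd (BH H) S T x) \<le> (anorm (BH H) S + anorm (BH H) T) * hnorm H x"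
        using hnorm_triangle[of "S x" "T x"] opnorm_upper[OF ST(1) x] opnorm_upper[OF ST(2) x] x ST
        by (simp add: op_closed distrib_right)
    qed (use opnorm_nonneg ST in simp)
  next
    fix T and k :: complex assume asm: "T \<in> vcarrier (BH H)"
    then have T: "T \<in> bounded_operators H" by simp
    have le: "anorm (BH H) (vscale (BH H) k T) \<le> cmod k * anorm (BH H) T"
      if T: "T \<in> bounded_operators H" for T k
    proof (rule opnorm_least)
      fix x assume x: "x \<in> vcarrier H"
      show "hnorm H (vscale (BH H) k T x) \<le> cmod k * anorm (BH H) T * hnorm H x"
        using opnorm_upper[OF T x] x T by (simp add: op_closed hnorm_scale mult.assoc mult_left_mono)
    qed (use opnorm_nonneg[OF T] in simp)
    show "anorm (BH H) (vscale (BH H) k T) = cmod k * anorm (BH H) T"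
    proof (rule antisym[OF le[OF T]])
      show "cmod k * anorm (BH H) T \<le> anorm (BH H) (vscale (BH H) k T)"
      proof (cases "k = 0")
        case True
        then show ?thesis using opnorm_nonneg[OF op_scale_closed[OF T, of k]] by simp
      next
        case False
        have "vscale (BH H) (1/k) (vscale (BH H) k T) = T"
        proof -
          have "vscale (BH H) (1/k) (vscale (BH H) k T) = restrict T (vcarrier H)"
            using False T by (auto simp: restrict_def scale_scale scale_one op_closed)
          also have "\<dots> = T" using T by (auto simp: bounded_operators_def intro!: PiE_restrict)
          finally show ?thesis .
        qed
        then have "anorm (BH H) T \<le> cmod (1/k) * anorm (BH H) (vscale (BH H) k T)"
          using le[of "vscale (BH H) k T" "1/k"] T by (simp add: op_scale_closed)
        then show ?thesis using False by (simp add: norm_divide field_simps)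
      qed
    qed
  next
    fix S T assume asm: "S \<in> vcarrier (BH H)" "T \<in> vcarrier (BH H)"
    then have ST: "S \<in> bounded_operators H" "T \<in> bounded_operators H" by simp_all

    then show "anorm (BH H) (amult (BH H) S T) \<le> anorm (BH H) S * anorm (BH H) T"
      by (intro opnorm_least) (auto simp: op_mult_bound intro!: mult_nonneg_nonneg opnorm_nonneg)
  next
    fix T assume asm: "T \<in> vcarrier (BH H)"
    then have T: "T \<in> bounded_operators H" by simp
    note ac = adjoint_closed[OF T]
    show "anorm (BH H) (amult (BH H) (astar (BH H) T) T) = (anorm (BH H) T)\<^sup>2"
    proof (rule antisym)
      have "anorm (BH H) (amult (BH H) (astar (BH H) T) T) \<le> anorm (BH H) (adjoint_op H T) * anorm (BH H) T"
        by (intro opnorm_least) (auto simp: op_mult_bound T ac intro!: mult_nonneg_nonneg opnorm_nonneg)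
      also have "\<dots> \<le> anorm (BH H) T * anorm (BH H) T"
        by (intro mult_right_mono opnorm_adjoint_le opnorm_nonneg T)
      finally show "anorm (BH H) (amult (BH H) (astar (BH H) T) T) \<le> (anorm (BH H) T)\<^sup>2"
        by (simp only: power2_eq_square)
      let ?N = "anorm (BH H) (amult (BH H) (astar (BH H) T) T)"
      have mc: "amult (BH H) (astar (BH H) T) T \<in> bounded_operators H"
        using op_mult_closed[OF ac T] by simp
      have "anorm (BH H) T \<le> sqrt ?N"
      proof (rule opnorm_least)
        fix x assume x: "x \<in> vcarrier H"
        have "(hnorm H (T x))\<^sup>2 = cmod (hinner H (adjoint_op H T (T x)) x)"
          using x T by (simp add: adjoint_inner cmod_inner_self op_closed)
        also have "\<dots> \<le> hnorm H (adjoint_op H T (T x)) * hnorm H x"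
          by (intro Cauchy_Schwarz op_closed[OF ac] op_closed[OF T] x)
        also have "\<dots> \<le> (?N * hnorm H x) * hnorm H x"
          using opnorm_upper[OF mc x] x by (intro mult_right_mono hnorm_nonneg) auto
        also have "\<dots> = (sqrt ?N * hnorm H x)\<^sup>2"
          using opnorm_nonneg[OF mc] by (simp only: power_mult_distrib real_sqrt_pow2) (simp add: power2_eq_square)
        finally show "hnorm H (T x) \<le> sqrt ?N * hnorm H x"
          by (rule power2_le_imp_le) (use opnorm_nonneg[OF mc] hnorm_nonneg[OF x] in simp)
      qed (use opnorm_nonneg[OF mc] in simp)
      then show "(anorm (BH H) T)\<^sup>2 \<le> ?N"
        using opnorm_nonneg[OF mc] opnorm_nonneg[OF T] by (metis power_mono real_sqrt_pow2)
    qed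
  next
    show "complete_wrt (BH H) (anorm (BH H))" by (rule BH_complete)
  qed (auto simp: fun_eq_iff oc c op_undefined op_add op_scale scale_zero_right
      add_zero add_inverse scale_add_right scale_add_left scale_scale scale_one add_ac)
qed

end

section \<open>Coding into the universe\<close>

type_synonym ('x, 'k) index = "'x + nat + 'k"

text \<open>The summand \<open>nat\<close> makes the index type infinite, and an infinite set is
  equipotent with its square.\<close>

lemma index_pairing:
  obtains p :: "('x, 'k) index \<Rightarrow> ('x, 'k) index \<Rightarrow> ('x, 'k) index"
  where "\<And>a b c d. p a b = p c d \<longleftrightarrow> a = c \<and> b = d"
proof -
  have "infinite (range (\<lambda>n. Inr (Inl n) :: ('x, 'k) index))"
    by (intro range_inj_infinite injI) simp
  then have "infinite (UNIV :: ('x, 'k) index set)"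
    using finite_subset subset_UNIV by blast
  from card_of_ordIso[THEN iffD2, OF card_of_Times_same_infinite[OF this]]
  obtain q where "bij_betw q ((UNIV :: ('x, 'k) index set) \<times> (UNIV :: ('x, 'k) index set)) (UNIV :: ('x, 'k) index set)" ..
  then have "inj q" by (simp add: bij_betw_def)
  then show thesis by (intro that[of "\<lambda>a b. q (a, b)"]) (simp add: inj_eq)
qed

definition pairc :: "('x, 'k) index \<Rightarrow> ('x, 'k) index \<Rightarrow> ('x, 'k) index" where
  "pairc = (SOME p. \<forall>a b c d. p a b = p c d \<longleftrightarrow> a = c \<and> b = d)"

lemma pairc_eq_iff [simp]: "pairc a b = pairc c d \<longleftrightarrow> a = c \<and> b = d"
proof -
  have "\<exists>p :: ('x, 'k) index \<Rightarrow> ('x, 'k) index \<Rightarrow> ('x, 'k) index. \<forall>a b c d. p a b = p c d \<longleftrightarrow> a = c \<and> b = d"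
    by (rule index_pairing) blast
  from someI_ex[OF this] show ?thesis unfolding pairc_def by blast
qed

definition natc :: "nat \<Rightarrow> ('x, 'k) index" where
  "natc n = Inr (Inl n)"

lemma natc_eq_iff [simp]: "natc m = natc n \<longleftrightarrow> m = n"
  by (simp add: natc_def)

primrec listc :: "('x, 'k) index list \<Rightarrow> ('x, 'k) index" where
  "listc [] = natc 0"
| "listc (a # l) = pairc a (listc l)"

text \<open>The code \<open>natc 0\<close> of the empty list may itself be a pair, so lists of
  different lengths can clash. Wherever full injectivity is needed, the length is recorded as
  well.\<close>

lemma listc_inj: "length l = length m \<Longrightarrow> listc l = listc m \<Longrightarrow> l = m"
proof (induction l arbitrary: m)
  case (Cons a l)
  then show ?case by (cases m) auto
qed simp

text \<open>Lets a net over the finite sets of indices be rewritten as a family over the indices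
  themselves, whose product still fits into the universe.\<close>

lemma finite_sets_enumeration:
  obtains fs :: "('x, 'k) index \<Rightarrow> ('x, 'k) index set"
  where "\<And>k. finite (fs k)" "\<And>F. finite F \<Longrightarrow> \<exists>k. fs k = F"
proof -
  define c where "c l = pairc (natc (length l)) (listc l)" for l :: "('x, 'k) index list"
  have "inj c" by (rule injI) (auto simp: c_def intro: listc_inj)
  show thesis
  proof (rule that[of "\<lambda>k. set (inv c k)"])
    fix F :: "('x, 'k) index set" assume "finite F"
    then obtain l where "set l = F" using finite_list by blast
    then show "\<exists>k. set (inv c k) = F" using \<open>inj c\<close> by (intro exI[of _ "c l"]) simp
  qed simp
qed

text \<open>Each coordinate is a set of indices, so a family is coded by the disjoint union of its
  coordinates, tagged by \<open>cI i\<close>.\<close>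

lemma prod_alg_code:
  fixes A :: "'i \<Rightarrow> ('x, 'k) universe calg" and cI :: "'i \<Rightarrow> ('x, 'k) index"
  assumes "inj_on cI I"
  shows "\<exists>c :: ('i \<Rightarrow> ('x, 'k) universe) \<Rightarrow> ('x, 'k) universe. inj_on c (vcarrier (prod_alg I A))"
proof (intro exI inj_onI)
  let ?c = "\<lambda>a. {pairc (cI i) z |i z. i \<in> I \<and> z \<in> a i}"
  fix a b assume a: "a \<in> vcarrier (prod_alg I A)" and b: "b \<in> vcarrier (prod_alg I A)" and eq: "?c a = ?c b"
  have sub: "a i \<subseteq> b i" if eq: "?c a = ?c b" and i: "i \<in> I" for a b :: "'i \<Rightarrow> ('x, 'k) universe" and i
  proof
    fix z assume "z \<in> a i"
    then have "pairc (cI i) z \<in> ?c b" unfolding eq[symmetric] using i by blast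
    then show "z \<in> b i" using inj_onD[OF assms] i by auto
  qed
  have "a i = b i" if "i \<in> I" for i using sub[OF eq that] sub[OF eq[symmetric] that] by blast
  then show "a = b"
    using a b by (intro PiE_ext[of a I "\<lambda>i. vcarrier (A i)" b]) (auto simp: prod_alg_def)
qed

section \<open>Dense families: codes for operators and extension of convergence\<close>

definition dense_family :: "('a, 'm) hilb_scheme \<Rightarrow> ('j \<Rightarrow> 'a) \<Rightarrow> bool" where
  "dense_family H d \<longleftrightarrow> (\<forall>j. d j \<in> vcarrier H) \<and>
    (\<forall>x\<in>vcarrier H. \<forall>e>0. \<exists>j. hnorm H (vdiff H x (d j)) < e)"

lemma dense_familyD:
  assumes "dense_family H d" "x \<in> vcarrier H" "0 < e"
  obtains j where "hnorm H (vdiff H x (d j)) < e"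
  using assms unfolding dense_family_def by blast

context hilbert_space
begin

text \<open>Shows that the set of approximations of a vector, to all precisions 1/(n+1), is a
  faithful code for it.\<close>

lemma dense_family_separates:
  assumes d: "dense_family H d" and x: "x \<in> vcarrier H" and y: "y \<in> vcarrier H"
    and eq: "\<And>j n. hnorm H (vdiff H x (d j)) < 1 / real (Suc n) \<longleftrightarrow> hnorm H (vdiff H y (d j)) < 1 / real (Suc n)"
  shows "x = y"
proof -
  have "hnorm H (vdiff H x y) \<le> e" if e: "e > 0" for e
  proof -
    obtain n where n: "1 / real (Suc n) < e / 2" using e nat_approx_posE[of "e/2"] by auto
    obtain j where j: "hnorm H (vdiff H x (d j)) < 1 / real (Suc n)"
      by (rule dense_familyD[OF d x, of "1 / real (Suc n)"]) simp
    have dj: "d j \<in> vcarrier H" using d by (simp add: dense_family_def)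
    have "hnorm H (vdiff H x y) \<le> hnorm H (vdiff H x (d j)) + hnorm H (vdiff H (d j) y)"
      by (rule hnorm_vdiff_triangle[OF x dj y])
    then show ?thesis using j eq[of j n] n hnorm_vdiff_commute[OF dj y] by simp
  qed
  then have "hnorm H (vdiff H x y) \<le> 0" by (rule dense_ge)
  then show ?thesis using hnorm_nonneg[of "vdiff H x y"] hnorm_vdiff_eq_zero[OF x y] x y by (simp add: closed)
qed

lemma op_eq_on_dense:
  assumes d: "dense_family H d" and S: "S \<in> bounded_operators H" and T: "T \<in> bounded_operators H"
    and eq: "\<And>j. S (d j) = T (d j)"
  shows "S = T"
proof (rule op_ext[OF S T])
  fix x assume x: "x \<in> vcarrier H"
  let ?K = "anorm (BH H) S + anorm (BH H) T + 1"
  have K: "?K > 0" using opnorm_nonneg[OF S] opnorm_nonneg[OF T] by simp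
  have "hnorm H (vdiff H (S x) (T x)) \<le> e" if e: "e > 0" for e
  proof -
    obtain j where j: "hnorm H (vdiff H x (d j)) < e / ?K"
      by (rule dense_familyD[OF d x, of "e / ?K"]) (use K e in simp)
    have dj: "d j \<in> vcarrier H" using d by (simp add: dense_family_def)
    have "hnorm H (vdiff H (S x) (T x)) \<le> hnorm H (vdiff H (S x) (S (d j))) + hnorm H (vdiff H (T (d j)) (T x))"
      using hnorm_vdiff_triangle[OF op_closed[OF S x] op_closed[OF S dj] op_closed[OF T x]] by (simp add: eq)
    also have "\<dots> \<le> anorm (BH H) S * hnorm H (vdiff H x (d j)) + anorm (BH H) T * hnorm H (vdiff H (d j) x)"
      using opnorm_upper[OF S vdiff_closed[OF x dj]] opnorm_upper[OF T vdiff_closed[OF dj x]]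
      by (simp add: op_diff[OF S x dj] op_diff[OF T dj x])
    also have "\<dots> \<le> ?K * hnorm H (vdiff H x (d j))"
      using hnorm_vdiff_commute[OF x dj] hnorm_nonneg[OF vdiff_closed[OF x dj]] by (simp add: distrib_right)
    also have "\<dots> \<le> e" using j K by (simp add: field_simps)
    finally show ?thesis .
  qed
  then have "hnorm H (vdiff H (S x) (T x)) \<le> 0" by (rule dense_ge)
  then show "S x = T x"
    using hnorm_nonneg[OF vdiff_closed[OF op_closed[OF S x] op_closed[OF T x]]]
      hnorm_vdiff_eq_zero[OF op_closed[OF S x] op_closed[OF T x]] by simp
qed

text \<open>An operator is determined by its values on the dense family and each value by its
  approximations from that family, so a set of triples of indices codes it.\<close>

lemma BH_code:
  fixes d :: "('x, 'k) index \<Rightarrow> 'a"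
  assumes d: "dense_family H d"
  shows "\<exists>c :: ('a \<Rightarrow> 'a) \<Rightarrow> ('x, 'k) universe. inj_on c (bounded_operators H)"
proof (intro exI inj_onI)
  let ?c = "\<lambda>T. {pairc i (pairc j (natc n)) |i j n. hnorm H (vdiff H (T (d i)) (d j)) < 1 / real (Suc n)}"
  fix S T assume S: "S \<in> bounded_operators H" and T: "T \<in> bounded_operators H" and eq: "?c S = ?c T"
  have mem: "pairc i (pairc j (natc n)) \<in> ?c T \<longleftrightarrow> hnorm H (vdiff H (T (d i)) (d j)) < 1 / real (Suc n)" for T i j n
    by auto
  have dc: "d j \<in> vcarrier H" for j using d by (simp add: dense_family_def)
  show "S = T"
  proof (rule op_eq_on_dense[OF d S T])
    fix i
    show "S (d i) = T (d i)"
      by (rule dense_family_separates[OF d op_closed[OF S dc] op_closed[OF T dc]])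
        (rule arg_cong[OF eq, of "\<lambda>A. pairc i (pairc _ (natc _)) \<in> A", unfolded mem])
  qed
qed

text \<open>The uniform bound \<open>K\<close> controls the error of replacing x by a dense vector
  simultaneously for all k. The 1 in \<open>?K\<close> only keeps the divisor positive.\<close>

lemma hconv_dense:
  assumes d: "dense_family H d" and S: "\<And>k. S k \<in> bounded_operators H" and T: "T \<in> bounded_operators H"
    and K: "\<And>k. anorm (BH H) (S k) \<le> K" and conv: "\<And>j. hconv H (\<lambda>k. S k (d j)) (T (d j)) F"
    and x: "x \<in> vcarrier H"
  shows "hconv H (\<lambda>k. S k x) (T x) F"
  unfolding hconv_def
proof (rule tendstoI)
  fix e :: real assume e: "e > 0"
  let ?K = "\<bar>K\<bar> + anorm (BH H) T + 1"
  have K0: "?K > 0" using opnorm_nonneg[OF T] by simp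
  obtain j where j: "hnorm H (vdiff H x (d j)) < e / 2 / ?K"
    by (rule dense_familyD[OF d x, of "e / 2 / ?K"]) (use K0 e in simp)
  have dj: "d j \<in> vcarrier H" using d by (simp add: dense_family_def)
  have "\<forall>\<^sub>F k in F. hnorm H (vdiff H (S k (d j)) (T (d j))) < e / 2"
    using tendstoD[OF conv[of j, unfolded hconv_def], of "e / 2"] e by (auto elim!: eventually_mono)
  then show "\<forall>\<^sub>F k in F. dist (hnorm H (vdiff H (S k x) (T x))) 0 < e"
  proof eventually_elim
    case (elim k)
    note c = op_closed[OF S x, of k] op_closed[OF S dj, of k] op_closed[OF T x] op_closed[OF T dj]
    have "hnorm H (vdiff H (S k x) (T x)) \<le> hnorm H (vdiff H (S k x) (S k (d j)))
        + (hnorm H (vdiff H (S k (d j)) (T (d j))) + hnorm H (vdiff H (T (d j)) (T x)))"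
      using hnorm_vdiff_triangle[OF c(1,2,3)] hnorm_vdiff_triangle[OF c(2,4,3)] by linarith
    moreover have "hnorm H (vdiff H (S k x) (S k (d j))) \<le> \<bar>K\<bar> * hnorm H (vdiff H x (d j))"
    proof -
      have "hnorm H (vdiff H (S k x) (S k (d j))) \<le> anorm (BH H) (S k) * hnorm H (vdiff H x (d j))"
        using opnorm_upper[OF S vdiff_closed[OF x dj], of k] by (simp add: op_diff[OF S x dj])
      also have "\<dots> \<le> \<bar>K\<bar> * hnorm H (vdiff H x (d j))"
        using K[of k] by (intro mult_right_mono hnorm_nonneg vdiff_closed x dj) linarith
      finally show ?thesis .
    qed
    moreover have "hnorm H (vdiff H (T (d j)) (T x)) \<le> anorm (BH H) T * hnorm H (vdiff H x (d j))"
      using opnorm_upper[OF T vdiff_closed[OF dj x]] hnorm_vdiff_commute[OF dj x]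
      by (simp add: op_diff[OF T dj x])
    moreover have "\<bar>K\<bar> * hnorm H (vdiff H x (d j)) + anorm (BH H) T * hnorm H (vdiff H x (d j)) \<le> e / 2"
    proof -
      have "?K * hnorm H (vdiff H x (d j)) \<le> e / 2" using j K0 by (simp add: field_simps)
      then show ?thesis using hnorm_nonneg[OF vdiff_closed[OF x dj]] by (simp add: distrib_right)
    qed
    ultimately have "hnorm H (vdiff H (S k x) (T x)) < e" using elim by linarith
    then show ?case using hnorm_nonneg[OF vdiff_closed[OF c(1,3)]] by simp
  qed
qed

text \<open>An interchange of limits: \<open>s n\<close> is close to \<open>t\<close> uniformly in
  k, so convergence along the filter passes to \<open>t\<close>. It makes the *-strongly convergent
  families norm closed.\<close>

lemma hconv_uniform:
  assumes s: "\<And>n k. s n k \<in> vcarrier H" and l: "\<And>n. l n \<in> vcarrier H" and t: "\<And>k. t k \<in> vcarrier H"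
    and m: "m \<in> vcarrier H" and conv: "\<And>n. hconv H (s n) (l n) F"
    and a: "\<And>n k. hnorm H (vdiff H (s n k) (t k)) \<le> a n" and b: "\<And>n. hnorm H (vdiff H (l n) m) \<le> b n"
    and lim: "a \<longlonglongrightarrow> 0" "b \<longlonglongrightarrow> 0"
  shows "hconv H t m F"
  unfolding hconv_def
proof (rule tendstoI)
  fix e :: real assume e: "e > 0"
  have "(\<lambda>n. a n + b n) \<longlonglongrightarrow> 0" using tendsto_add[OF lim] by simp
  then have "\<forall>\<^sub>F n in sequentially. a n + b n < e / 2"
    using e by (intro order_tendstoD) auto
  then obtain n where n: "a n + b n < e / 2" by (auto simp: eventually_sequentially)
  have "\<forall>\<^sub>F k in F. hnorm H (vdiff H (s n k) (l n)) < e / 2"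
    using tendstoD[OF conv[of n, unfolded hconv_def], of "e / 2"] e by (auto elim!: eventually_mono)
  then show "\<forall>\<^sub>F k in F. dist (hnorm H (vdiff H (t k) m)) 0 < e"
  proof eventually_elim
    case (elim k)
    have "hnorm H (vdiff H (t k) m) \<le> hnorm H (vdiff H (t k) (s n k))
        + (hnorm H (vdiff H (s n k) (l n)) + hnorm H (vdiff H (l n) m))"
      using hnorm_vdiff_triangle[OF t s m, of k n k] hnorm_vdiff_triangle[OF s l m, of n k n] by linarith
    then have "hnorm H (vdiff H (t k) m) < e"
      using elim n a[of n k] b[of n] hnorm_vdiff_commute[OF t s, of k n k] by linarith
    then show ?case using hnorm_nonneg[OF vdiff_closed[OF t m]] by simp
  qed
qed

section \<open>Neighbourhoods in the *-strong topology\<close>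

lemma topspace_star_strong: "topspace (star_strong_topology H) = bounded_operators H"
proof -
  have "T \<in> topspace (star_strong_topology H)" if T: "T \<in> bounded_operators H" for T
  proof -
    let ?U = "{S \<in> bounded_operators H. hnorm H (vdiff H (S (vzero H)) (T (vzero H))) < 1}"
    have "T \<in> ?U" using T op_closed[OF T zero_closed] by (simp add: vdiff_self hnorm_zero)
    moreover have "openin (star_strong_topology H) ?U"
      unfolding star_strong_topology_def
      by (intro topology_generated_by_Basis UnI1 CollectI exI[of _ "vzero H"] exI[of _ "T (vzero H)"] exI[of _ 1])
        (auto simp: zero_closed op_closed[OF T])
    ultimately show ?thesis using openin_subset by blast
  qed
  moreover have "topspace (star_strong_topology H) \<subseteq> bounded_operators H"
    unfolding star_strong_topology_def topology_generated_by_topspace by auto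
  ultimately show ?thesis by blast
qed

lemma star_strong_nbhd:
  assumes T: "T \<in> bounded_operators H" and J: "finite J" "\<And>\<xi>. \<xi> \<in> J \<Longrightarrow> \<xi> \<in> vcarrier H" and e: "e > 0"
  obtains U where "openin (star_strong_topology H) U" "T \<in> U"
    "\<And>S \<xi>. S \<in> U \<Longrightarrow> \<xi> \<in> J \<Longrightarrow> hnorm H (vdiff H (S \<xi>) (T \<xi>)) < e"
    "\<And>S \<xi>. S \<in> U \<Longrightarrow> \<xi> \<in> J \<Longrightarrow> hnorm H (vdiff H (adjoint_op H S \<xi>) (adjoint_op H T \<xi>)) < e"
proof -
  let ?O = "star_strong_topology H"
  let ?U1 = "\<lambda>\<xi>. {S \<in> bounded_operators H. hnorm H (vdiff H (S \<xi>) (T \<xi>)) < e}"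
  let ?U2 = "\<lambda>\<xi>. {S \<in> bounded_operators H. hnorm H (vdiff H (adjoint_op H S \<xi>) (adjoint_op H T \<xi>)) < e}"
  note aT = adjoint_closed[OF T]
  have o1: "openin ?O (?U1 \<xi>)" if "\<xi> \<in> J" for \<xi>
    unfolding star_strong_topology_def
    by (intro topology_generated_by_Basis UnI1 CollectI exI[of _ \<xi>] exI[of _ "T \<xi>"] exI[of _ e])
      (use that e J op_closed[OF T] in auto)
  have o2: "openin ?O (?U2 \<xi>)" if "\<xi> \<in> J" for \<xi>
    unfolding star_strong_topology_def
    by (intro topology_generated_by_Basis UnI2 CollectI exI[of _ \<xi>] exI[of _ "adjoint_op H T \<xi>"] exI[of _ e])
      (use that e J op_closed[OF aT] in auto)
  \<comment> \<open>The intersection with the whole space is there for empty \<open>J\<close>, where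
    the indexed intersection is \<open>UNIV\<close>.\<close>
  let ?U = "(\<Inter>\<xi>\<in>J. ?U1 \<xi> \<inter> ?U2 \<xi>) \<inter> topspace ?O"
  show thesis
  proof (rule that[of ?U])
    show "openin ?O ?U" by (intro openin_INT J openin_Int o1 o2)
    show "T \<in> ?U"
      using T e J op_closed[OF T] op_closed[OF aT] by (auto simp: topspace_star_strong vdiff_self hnorm_zero)
  qed auto
qed

end

section \<open>Limits of finite-dimensional representations\<close>

text \<open>The adjoints are part of the condition because taking adjoints is not continuous for the
  strong topology.\<close>

definition ops_conv :: "('a, 'm) hilb_scheme \<Rightarrow> 'i filter \<Rightarrow> ('i \<Rightarrow> 'a \<Rightarrow> 'a) \<Rightarrow> ('a \<Rightarrow> 'a) \<Rightarrow> bool" where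
  "ops_conv H F a T \<longleftrightarrow> T \<in> bounded_operators H \<and>
    (\<forall>\<xi>\<in>vcarrier H. hconv H (\<lambda>k. a k \<xi>) (T \<xi>) F \<and>
      hconv H (\<lambda>k. adjoint_op H (a k) \<xi>) (adjoint_op H T \<xi>) F)"

text \<open>On bounded families that converge \<open>*\<close>-strongly along \<open>F\<close>, taking limits is multiplicative.\<close>

definition conv_alg :: "('a, 'm) hilb_scheme \<Rightarrow> 'i filter \<Rightarrow> ('i \<Rightarrow> 'a \<Rightarrow> 'a) calg" where
  "conv_alg H F = (prod_alg UNIV (\<lambda>_. BH H))
    \<lparr>vcarrier := {a \<in> vcarrier (prod_alg UNIV (\<lambda>_. BH H)). \<exists>T. ops_conv H F a T}\<rparr>"

definition ops_lim :: "('a, 'm) hilb_scheme \<Rightarrow> 'i filter \<Rightarrow> ('i \<Rightarrow> 'a \<Rightarrow> 'a) \<Rightarrow> 'a \<Rightarrow> 'a" where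
  "ops_lim H F a = (THE T. ops_conv H F a T)"

context hilbert_space
begin

lemma ops_conv_closed: "ops_conv H F a T \<Longrightarrow> T \<in> bounded_operators H"
  by (simp add: ops_conv_def)

lemma ops_convD:
  assumes "ops_conv H F a T" "x \<in> vcarrier H"
  shows "hconv H (\<lambda>k. a k x) (T x) F" "hconv H (\<lambda>k. adjoint_op H (a k) x) (adjoint_op H T x) F"
  using assms by (auto simp: ops_conv_def)

lemma prod_BH_component: "a \<in> vcarrier (prod_alg UNIV (\<lambda>_. BH H)) \<Longrightarrow> a k \<in> bounded_operators H"
  using prod_alg_component[of a UNIV "\<lambda>_. BH H" k] by simp

lemma prod_BH_norm: "a \<in> vcarrier (prod_alg UNIV (\<lambda>_. BH H))
    \<Longrightarrow> anorm (BH H) (a k) \<le> anorm (prod_alg UNIV (\<lambda>_. BH H)) a"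
  using prod_alg_norm_upper[of a UNIV "\<lambda>_. BH H" k] by simp

lemma ops_conv_unique:
  assumes a: "\<And>k. a k \<in> bounded_operators H" and F: "F \<noteq> bot"
    and S: "ops_conv H F a S" and T: "ops_conv H F a T"
  shows "S = T"
  by (rule op_ext[OF ops_conv_closed[OF S] ops_conv_closed[OF T]])
    (rule hconv_unique[OF op_closed[OF a] op_closed[OF ops_conv_closed[OF S]]
        op_closed[OF ops_conv_closed[OF T]] ops_convD(1)[OF S] ops_convD(1)[OF T] F])

lemma adjoint_ops:
  assumes S: "S \<in> bounded_operators H" and T: "T \<in> bounded_operators H"
  shows "adjoint_op H (vadd (BH H) S T) = vadd (BH H) (adjoint_op H S) (adjoint_op H T)"
    "adjoint_op H (vscale (BH H) c T) = vscale (BH H) (cnj c) (adjoint_op H T)"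
    "adjoint_op H (amult (BH H) S T) = amult (BH H) (adjoint_op H T) (adjoint_op H S)"
    "adjoint_op H (adjoint_op H T) = T"
    "adjoint_op H (vdiff (BH H) S T) = vdiff (BH H) (adjoint_op H S) (adjoint_op H T)"
  using cstar_algebra.star_add[OF cstar_BH, of S T] cstar_algebra.star_scale[OF cstar_BH, of T c]
    cstar_algebra.star_mult[OF cstar_BH, of S T] cstar_algebra.star_star[OF cstar_BH, of T]
    cstar_algebra.star_vdiff[OF cstar_BH, of S T] S T by simp_all

lemma ops_conv_zero: "ops_conv H F (\<lambda>_. vzero (BH H)) (vzero (BH H))"
proof -
  have z: "vzero (BH H) \<in> bounded_operators H" using op_zero_closed by simp
  then show ?thesis
    by (auto simp: ops_conv_def simp del: BH_simps intro!: hconv_const op_closed[OF z] op_closed[OF adjoint_closed[OF z]])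
qed

lemma ops_conv_add:
  assumes a: "\<And>k. a k \<in> bounded_operators H" and b: "\<And>k. b k \<in> bounded_operators H"
    and S: "ops_conv H F a S" and T: "ops_conv H F b T"
  shows "ops_conv H F (\<lambda>k. vadd (BH H) (a k) (b k)) (vadd (BH H) S T)"
  unfolding ops_conv_def
proof (intro conjI ballI)
  note Sb = ops_conv_closed[OF S] and Tb = ops_conv_closed[OF T]
  show "vadd (BH H) S T \<in> bounded_operators H" using op_add_closed[OF Sb Tb] by simp
  fix x assume x: "x \<in> vcarrier H"
  show "hconv H (\<lambda>k. vadd (BH H) (a k) (b k) x) (vadd (BH H) S T x) F"
    using hconv_add[OF op_closed[OF a x] op_closed[OF b x] op_closed[OF Sb x] op_closed[OF Tb x]
        ops_convD(1)[OF S x] ops_convD(1)[OF T x]] x by simp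
  show "hconv H (\<lambda>k. adjoint_op H (vadd (BH H) (a k) (b k)) x) (adjoint_op H (vadd (BH H) S T) x) F"
    unfolding adjoint_ops(1)[OF a b] adjoint_ops(1)[OF Sb Tb]
    using hconv_add[OF op_closed[OF adjoint_closed[OF a] x] op_closed[OF adjoint_closed[OF b] x]
        op_closed[OF adjoint_closed[OF Sb] x] op_closed[OF adjoint_closed[OF Tb] x]
        ops_convD(2)[OF S x] ops_convD(2)[OF T x]] x by simp
qed

lemma ops_conv_scale:
  assumes b: "\<And>k. b k \<in> bounded_operators H" and T: "ops_conv H F b T"
  shows "ops_conv H F (\<lambda>k. vscale (BH H) c (b k)) (vscale (BH H) c T)"
  unfolding ops_conv_def
proof (intro conjI ballI)
  note Tb = ops_conv_closed[OF T]
  show "vscale (BH H) c T \<in> bounded_operators H" using op_scale_closed[OF Tb] by simp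
  fix x assume x: "x \<in> vcarrier H"
  show "hconv H (\<lambda>k. vscale (BH H) c (b k) x) (vscale (BH H) c T x) F"
    using hconv_scale[OF op_closed[OF b x] op_closed[OF Tb x] ops_convD(1)[OF T x]] x by simp
  show "hconv H (\<lambda>k. adjoint_op H (vscale (BH H) c (b k)) x) (adjoint_op H (vscale (BH H) c T) x) F"
    unfolding adjoint_ops(2)[OF b b] adjoint_ops(2)[OF Tb Tb]
    using hconv_scale[OF op_closed[OF adjoint_closed[OF b] x] op_closed[OF adjoint_closed[OF Tb] x]
        ops_convD(2)[OF T x]] x by simp
qed

lemma ops_conv_star:
  assumes b: "\<And>k. b k \<in> bounded_operators H" and T: "ops_conv H F b T"
  shows "ops_conv H F (\<lambda>k. adjoint_op H (b k)) (adjoint_op H T)"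
  using ops_convD[OF T] adjoint_closed[OF ops_conv_closed[OF T]]
  by (simp add: ops_conv_def adjoint_ops(4)[OF b b] adjoint_ops(4)[OF ops_conv_closed[OF T] ops_conv_closed[OF T]])

text \<open>a_k b_k x - STx = a_k (b_k x - Tx) + (a_k - S) Tx; the first term needs the uniform
  bound on the a_k.\<close>

lemma hconv_product:
  assumes a: "\<And>k. a k \<in> bounded_operators H" and b: "\<And>k. b k \<in> bounded_operators H"
    and S: "S \<in> bounded_operators H" and T: "T \<in> bounded_operators H"
    and K: "\<And>k. anorm (BH H) (a k) \<le> K" and x: "x \<in> vcarrier H"
    and cb: "hconv H (\<lambda>k. b k x) (T x) F" and ca: "hconv H (\<lambda>k. a k (T x)) (S (T x)) F"
  shows "hconv H (\<lambda>k. a k (b k x)) (S (T x)) F"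
proof (rule hconv_squeeze)
  note bx = op_closed[OF b x] and Tx = op_closed[OF T x]
  show "((\<lambda>k. K * hnorm H (vdiff H (b k x) (T x)) + hnorm H (vdiff H (a k (T x)) (S (T x)))) \<longlongrightarrow> 0) F"
    using tendsto_add[OF tendsto_mult_left[OF cb[unfolded hconv_def], of K] ca[unfolded hconv_def]] by simp
  fix k
  have "hnorm H (vdiff H (a k (b k x)) (a k (T x))) \<le> anorm (BH H) (a k) * hnorm H (vdiff H (b k x) (T x))"
    using opnorm_upper[OF a vdiff_closed[OF bx Tx], of k k] by (simp add: op_diff[OF a bx Tx])
  also have "\<dots> \<le> K * hnorm H (vdiff H (b k x) (T x))"
    by (intro mult_right_mono K hnorm_nonneg vdiff_closed bx Tx)
  finally show "hnorm H (vdiff H (a k (b k x)) (S (T x)))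
      \<le> K * hnorm H (vdiff H (b k x) (T x)) + hnorm H (vdiff H (a k (T x)) (S (T x)))"
    using hnorm_vdiff_triangle[OF op_closed[OF a bx] op_closed[OF a Tx] op_closed[OF S Tx], of k k k] by linarith
  show "a k (b k x) \<in> vcarrier H" by (rule op_closed[OF a bx])
  show "S (T x) \<in> vcarrier H" by (rule op_closed[OF S Tx])
qed

lemma ops_conv_mult:
  assumes a: "\<And>k. a k \<in> bounded_operators H" and b: "\<And>k. b k \<in> bounded_operators H"
    and K: "\<And>k. anorm (BH H) (a k) \<le> K" "\<And>k. anorm (BH H) (b k) \<le> L"
    and S: "ops_conv H F a S" and T: "ops_conv H F b T"
  shows "ops_conv H F (\<lambda>k. amult (BH H) (a k) (b k)) (amult (BH H) S T)"
  unfolding ops_conv_def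
proof (intro conjI ballI)
  note Sb = ops_conv_closed[OF S] and Tb = ops_conv_closed[OF T]
  show "amult (BH H) S T \<in> bounded_operators H" using op_mult_closed[OF Sb Tb] by simp
  fix x assume x: "x \<in> vcarrier H"
  show "hconv H (\<lambda>k. amult (BH H) (a k) (b k) x) (amult (BH H) S T x) F"
    using hconv_product[OF a b Sb Tb K(1) x ops_convD(1)[OF T x] ops_convD(1)[OF S op_closed[OF Tb x]]] x
    by simp
  have L: "anorm (BH H) (adjoint_op H (b k)) \<le> L" for k
    using opnorm_adjoint_le[OF b, of k] K(2)[of k] by linarith
  show "hconv H (\<lambda>k. adjoint_op H (amult (BH H) (a k) (b k)) x) (adjoint_op H (amult (BH H) S T) x) F"
    unfolding adjoint_ops(3)[OF a b] adjoint_ops(3)[OF Sb Tb]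
    using hconv_product[OF adjoint_closed[OF b] adjoint_closed[OF a] adjoint_closed[OF Tb] adjoint_closed[OF Sb]
        L x ops_convD(2)[OF S x] ops_convD(2)[OF T op_closed[OF adjoint_closed[OF Sb] x]]] x
    by simp
qed

lemma opnorm_vdiff_apply:
  assumes S: "S \<in> bounded_operators H" and T: "T \<in> bounded_operators H" and x: "x \<in> vcarrier H"
  shows "hnorm H (vdiff H (S x) (T x)) \<le> anorm (BH H) (vdiff (BH H) S T) * hnorm H x"
    "hnorm H (vdiff H (adjoint_op H S x) (adjoint_op H T x)) \<le> anorm (BH H) (vdiff (BH H) S T) * hnorm H x"
proof -
  interpret B: cstar_algebra "BH H" by (rule cstar_BH)
  have d: "vdiff (BH H) S T \<in> bounded_operators H" using B.vdiff_closed[of S T] S T by simp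
  show "hnorm H (vdiff H (S x) (T x)) \<le> anorm (BH H) (vdiff (BH H) S T) * hnorm H x"
    using opnorm_upper[OF d x] x by (simp add: vdiff_BH)
  have "hnorm H (adjoint_op H (vdiff (BH H) S T) x) \<le> anorm (BH H) (adjoint_op H (vdiff (BH H) S T)) * hnorm H x"
    by (rule opnorm_upper[OF adjoint_closed[OF d] x])
  also have "\<dots> \<le> anorm (BH H) (vdiff (BH H) S T) * hnorm H x"
    by (intro mult_right_mono opnorm_adjoint_le d hnorm_nonneg x)
  finally have "hnorm H (vdiff (BH H) (adjoint_op H S) (adjoint_op H T) x)
      \<le> anorm (BH H) (vdiff (BH H) S T) * hnorm H x"
    by (simp only: adjoint_ops(5)[OF S T])
  then show "hnorm H (vdiff H (adjoint_op H S x) (adjoint_op H T x))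
      \<le> anorm (BH H) (vdiff (BH H) S T) * hnorm H x"
    using x by (simp add: vdiff_BH)
qed

text \<open>Norm bounds survive pointwise limits, so taking limits is contractive. Applied to a norm
  convergent sequence of families, it makes their limit operators a Cauchy sequence.\<close>

lemma ops_conv_norm_diff:
  assumes a: "\<And>k. a k \<in> bounded_operators H" and b: "\<And>k. b k \<in> bounded_operators H" and F: "F \<noteq> bot"
    and S: "ops_conv H F a S" and T: "ops_conv H F b T"
    and K: "0 \<le> K" "\<And>k. anorm (BH H) (vdiff (BH H) (a k) (b k)) \<le> K"
  shows "anorm (BH H) (vdiff (BH H) S T) \<le> K"
proof (rule opnorm_least[OF K(1)])
  note Sb = ops_conv_closed[OF S] and Tb = ops_conv_closed[OF T]
  fix x assume x: "x \<in> vcarrier H"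
  have "hconv H (\<lambda>k. vadd H (a k x) (vscale H (-1) (b k x))) (vadd H (S x) (vscale H (-1) (T x))) F"
    by (intro hconv_add hconv_scale ops_convD(1)[OF S x] ops_convD(1)[OF T x] scale_closed
        op_closed[OF a x] op_closed[OF b x] op_closed[OF Sb x] op_closed[OF Tb x])
  then have c: "hconv H (\<lambda>k. vdiff H (a k x) (b k x)) (vdiff H (S x) (T x)) F" by (simp add: vdiff_def)
  have "hnorm H (vdiff H (S x) (T x)) \<le> K * hnorm H x"
  proof (rule hconv_norm_le[OF _ _ c F])
    show "hnorm H (vdiff H (a k x) (b k x)) \<le> K * hnorm H x" for k
      using opnorm_vdiff_apply(1)[OF a b x, of k k] mult_right_mono[OF K(2)[of k] hnorm_nonneg[OF x]] by linarith
  qed (intro vdiff_closed op_closed[OF a x] op_closed[OF b x] op_closed[OF Sb x] op_closed[OF Tb x])+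
  then show "hnorm H (vdiff (BH H) S T x) \<le> K * hnorm H x" using x by (simp add: vdiff_BH)
qed

text \<open>The point is norm closedness. If convergent families \<open>s n\<close> tend to
  \<open>a\<close>, their limits \<open>T n\<close> are Cauchy by \<open>ops_conv_norm_diff\<close>,
  and \<open>hconv_uniform\<close> identifies the limit of \<open>T n\<close> as the limit of
  \<open>a\<close>. Only with a C*-algebra here can (R2) and (R3) be applied to it.\<close>

lemma conv_alg_cstar:
  assumes F: "F \<noteq> bot"
  shows "cstar_algebra (conv_alg H F)"
  unfolding conv_alg_def
proof -
  let ?Q = "prod_alg UNIV (\<lambda>_. BH H)"
  interpret Q: cstar_algebra ?Q by (intro cstar_prod_alg cstar_BH)
  interpret B: cstar_algebra "BH H" by (rule cstar_BH)
  note comp = prod_BH_component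
  note [simp del] = BH_simps
  show "cstar_algebra (?Q\<lparr>vcarrier := {a \<in> vcarrier ?Q. \<exists>T. ops_conv H F a T}\<rparr>)"
  proof (rule Q.cstar_subalgebra)
    show "vzero ?Q \<in> {a \<in> vcarrier ?Q. \<exists>T. ops_conv H F a T}"
      using Q.zero_closed ops_conv_zero by (auto simp: restrict_UNIV)
    show "vadd ?Q a b \<in> {a \<in> vcarrier ?Q. \<exists>T. ops_conv H F a T}"
      if "a \<in> {a \<in> vcarrier ?Q. \<exists>T. ops_conv H F a T}" "b \<in> {a \<in> vcarrier ?Q. \<exists>T. ops_conv H F a T}" for a b
      using that Q.add_closed[of a b] ops_conv_add[OF comp comp] by (fastforce simp: restrict_UNIV)
    show "vscale ?Q c a \<in> {a \<in> vcarrier ?Q. \<exists>T. ops_conv H F a T}"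
      if "a \<in> {a \<in> vcarrier ?Q. \<exists>T. ops_conv H F a T}" for a c
      using that Q.scale_closed[of a c] ops_conv_scale[OF comp] by (fastforce simp: restrict_UNIV)
    show "amult ?Q a b \<in> {a \<in> vcarrier ?Q. \<exists>T. ops_conv H F a T}"
      if "a \<in> {a \<in> vcarrier ?Q. \<exists>T. ops_conv H F a T}" "b \<in> {a \<in> vcarrier ?Q. \<exists>T. ops_conv H F a T}" for a b
    proof -
      obtain S T where a: "a \<in> vcarrier ?Q" and b: "b \<in> vcarrier ?Q" and "ops_conv H F a S" "ops_conv H F b T"
        using \<open>a \<in> _\<close> \<open>b \<in> _\<close> by blast
      then have "ops_conv H F (amult ?Q a b) (amult (BH H) S T)"
        using ops_conv_mult[OF comp[OF a] comp[OF b] prod_BH_norm[OF a] prod_BH_norm[OF b]]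
        by (simp add: restrict_UNIV)
      then show ?thesis using Q.mult_closed[OF a b] by blast
    qed
    show "astar ?Q a \<in> {a \<in> vcarrier ?Q. \<exists>T. ops_conv H F a T}"
      if "a \<in> {a \<in> vcarrier ?Q. \<exists>T. ops_conv H F a T}" for a
      using that Q.star_closed[of a] ops_conv_star[OF comp] by (fastforce simp: BH_simps(6) restrict_UNIV)
  next
    fix s :: "nat \<Rightarrow> _" and a
    assume sZ: "\<And>n. s n \<in> {a \<in> vcarrier ?Q. \<exists>T. ops_conv H F a T}" and a: "a \<in> vcarrier ?Q"
      and lim: "(\<lambda>n. anorm ?Q (vdiff ?Q (s n) a)) \<longlonglongrightarrow> 0"
    have s: "s n \<in> vcarrier ?Q" for n using sZ by blast
    have "\<forall>n. \<exists>T. ops_conv H F (s n) T" using sZ by blast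
    then obtain T where T: "\<And>n. ops_conv H F (s n) (T n)" by metis
    note Tb = ops_conv_closed[OF T]
    have comp_diff: "anorm (BH H) (vdiff (BH H) (u k) (v k)) \<le> anorm ?Q (vdiff ?Q u v)"
      if "u \<in> vcarrier ?Q" "v \<in> vcarrier ?Q" for u v k
      using prod_BH_norm[OF Q.vdiff_closed[OF that], of k] by (simp add: vdiff_prod_alg)
    have Tdiff: "anorm (BH H) (vdiff (BH H) (T m) (T n)) \<le> anorm ?Q (vdiff ?Q (s m) a) + anorm ?Q (vdiff ?Q (s n) a)" for m n
    proof (rule ops_conv_norm_diff[OF comp[OF s] comp[OF s] F T T])
      show "0 \<le> anorm ?Q (vdiff ?Q (s m) a) + anorm ?Q (vdiff ?Q (s n) a)"
        by (intro add_nonneg_nonneg Q.norm_nonneg Q.vdiff_closed s a)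
      show "anorm (BH H) (vdiff (BH H) (s m k) (s n k)) \<le> anorm ?Q (vdiff ?Q (s m) a) + anorm ?Q (vdiff ?Q (s n) a)" for k
        using comp_diff[OF s[of m] s[of n], of k] Q.norm_vdiff_triangle[OF s[of m] a s[of n]] Q.norm_vdiff_commute[OF a s[of n]] by linarith
    qed
    have TC: "\<exists>N. \<forall>m\<ge>N. \<forall>n\<ge>N. anorm (BH H) (vdiff (BH H) (T m) (T n)) < e" if e: "e > 0" for e
    proof -
      have "\<forall>\<^sub>F n in sequentially. anorm ?Q (vdiff ?Q (s n) a) < e / 2"
        using lim e by (intro order_tendstoD(2)[where a = "e/2"]) auto
      then obtain N where N: "\<And>n. n \<ge> N \<Longrightarrow> anorm ?Q (vdiff ?Q (s n) a) < e / 2"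
        by (auto simp: eventually_sequentially)
      have "anorm (BH H) (vdiff (BH H) (T m) (T n)) < e" if "m \<ge> N" "n \<ge> N" for m n
        using Tdiff[of m n] N[OF that(1)] N[OF that(2)] by linarith
      then show ?thesis by blast
    qed
    have "T n \<in> vcarrier (BH H)" for n using Tb by (simp add: BH_simps)
    then obtain L where L: "L \<in> vcarrier (BH H)" "(\<lambda>n. anorm (BH H) (vdiff (BH H) (T n) L)) \<longlonglongrightarrow> 0"
      by (rule complete_wrtD[OF BH_complete, of T, OF _ TC]) blast+
    have Lb: "L \<in> bounded_operators H" using L(1) by (simp add: BH_simps)
    have "ops_conv H F a L"
      unfolding ops_conv_def
    proof (intro conjI ballI)
      show "L \<in> bounded_operators H" by (rule Lb)
      fix x assume x: "x \<in> vcarrier H"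
      have lim1: "(\<lambda>n. anorm ?Q (vdiff ?Q (s n) a) * hnorm H x) \<longlonglongrightarrow> 0"
        using tendsto_mult_right[OF lim, of "hnorm H x"] by simp
      have lim2: "(\<lambda>n. anorm (BH H) (vdiff (BH H) (T n) L) * hnorm H x) \<longlonglongrightarrow> 0"
        using tendsto_mult_right[OF L(2), of "hnorm H x"] by simp
      have le: "anorm (BH H) (vdiff (BH H) (s n k) (a k)) * hnorm H x \<le> anorm ?Q (vdiff ?Q (s n) a) * hnorm H x" for n k
        by (intro mult_right_mono comp_diff s a hnorm_nonneg x)
      show "hconv H (\<lambda>k. a k x) (L x) F"
      proof (rule hconv_uniform[OF _ _ _ _ ops_convD(1)[OF T x] _ _ lim1 lim2])
        show "hnorm H (vdiff H (s n k x) (a k x)) \<le> anorm ?Q (vdiff ?Q (s n) a) * hnorm H x" for n k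
          using opnorm_vdiff_apply(1)[OF comp[OF s[of n], of k] comp[OF a, of k] x] le[of n k] by linarith
        show "hnorm H (vdiff H (T n x) (L x)) \<le> anorm (BH H) (vdiff (BH H) (T n) L) * hnorm H x" for n
          by (rule opnorm_vdiff_apply(1)[OF Tb Lb x])
      qed (rule op_closed[OF comp[OF s] x] op_closed[OF Tb x] op_closed[OF comp[OF a] x] op_closed[OF Lb x])+
      show "hconv H (\<lambda>k. adjoint_op H (a k) x) (adjoint_op H L x) F"
      proof (rule hconv_uniform[OF _ _ _ _ ops_convD(2)[OF T x] _ _ lim1 lim2])
        show "hnorm H (vdiff H (adjoint_op H (s n k) x) (adjoint_op H (a k) x)) \<le> anorm ?Q (vdiff ?Q (s n) a) * hnorm H x" for n k
          using opnorm_vdiff_apply(2)[OF comp[OF s[of n], of k] comp[OF a, of k] x] le[of n k] by linarith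
        show "hnorm H (vdiff H (adjoint_op H (T n) x) (adjoint_op H L x)) \<le> anorm (BH H) (vdiff (BH H) (T n) L) * hnorm H x" for n
          by (rule opnorm_vdiff_apply(2)[OF Tb Lb x])
      qed (rule op_closed[OF adjoint_closed[OF comp[OF s]] x] op_closed[OF adjoint_closed[OF Tb] x]
          op_closed[OF adjoint_closed[OF comp[OF a]] x] op_closed[OF adjoint_closed[OF Lb] x])+
    qed
    then show "a \<in> {a \<in> vcarrier ?Q. \<exists>T. ops_conv H F a T}" using a by blast
  qed auto
qed

lemma conv_alg_simps:
  "a \<in> vcarrier (conv_alg H F) \<longleftrightarrow> a \<in> vcarrier (prod_alg UNIV (\<lambda>_. BH H)) \<and> (\<exists>T. ops_conv H F a T)"
  "vadd (conv_alg H F) = vadd (prod_alg UNIV (\<lambda>_. BH H))"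
  "vscale (conv_alg H F) = vscale (prod_alg UNIV (\<lambda>_. BH H))"
  "amult (conv_alg H F) = amult (prod_alg UNIV (\<lambda>_. BH H))"
  "astar (conv_alg H F) = astar (prod_alg UNIV (\<lambda>_. BH H))"
  by (simp_all add: conv_alg_def)

lemma ops_lim_eq:
  assumes F: "F \<noteq> bot" and a: "\<And>k. a k \<in> bounded_operators H" and T: "ops_conv H F a T"
  shows "ops_lim H F a = T"
  unfolding ops_lim_def using T ops_conv_unique[OF a F _ T] by (intro the_equality) blast+

lemma ops_lim_hom:
  assumes F: "F \<noteq> bot"
  shows "star_hom (ops_lim H F) (conv_alg H F) (BH H)"
proof -
  let ?Q = "prod_alg UNIV (\<lambda>_. BH H)"
  interpret B: cstar_algebra "BH H" by (rule cstar_BH)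
  note comp = prod_BH_component and eq = ops_lim_eq[OF F]
  have c: "a k \<in> vcarrier (BH H)" if "a \<in> vcarrier ?Q" for a k using comp[OF that] by simp
  have oc: "vadd (BH H) S T \<in> bounded_operators H" "vscale (BH H) k S \<in> bounded_operators H"
    "amult (BH H) S T \<in> bounded_operators H"
    if "S \<in> bounded_operators H" "T \<in> bounded_operators H" for S T k
    using op_add_closed[OF that] op_scale_closed[OF that(1)] op_mult_closed[OF that] by simp_all
  note [simp del] = BH_simps(2-6)
  show ?thesis
    unfolding star_hom_def
  proof (intro conjI ballI allI funcsetI)
    fix a assume "a \<in> vcarrier (conv_alg H F)"
    then obtain S where a: "a \<in> vcarrier ?Q" and S: "ops_conv H F a S" by (auto simp: conv_alg_simps)
    note lS = eq[OF comp[OF a] S]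
    show "ops_lim H F a \<in> vcarrier (BH H)" using ops_conv_closed[OF S] by (simp add: lS)
    show "ops_lim H F (astar (conv_alg H F) a) = astar (BH H) (ops_lim H F a)"
      using eq[OF adjoint_closed[OF comp[OF a]] ops_conv_star[OF comp[OF a] S]]
      by (simp add: conv_alg_simps lS BH_simps(6) restrict_UNIV)
    show "ops_lim H F (vscale (conv_alg H F) k a) = vscale (BH H) k (ops_lim H F a)" for k
      using eq[OF oc(2)[OF comp[OF a] comp[OF a]] ops_conv_scale[OF comp[OF a] S, of k]]
      by (simp add: conv_alg_simps lS restrict_UNIV)
    fix b assume "b \<in> vcarrier (conv_alg H F)"
    then obtain T where b: "b \<in> vcarrier ?Q" and T: "ops_conv H F b T" by (auto simp: conv_alg_simps)
    note lT = eq[OF comp[OF b] T]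
    show "ops_lim H F (vadd (conv_alg H F) a b) = vadd (BH H) (ops_lim H F a) (ops_lim H F b)"
      using eq[OF oc(1)[OF comp[OF a] comp[OF b]] ops_conv_add[OF comp[OF a] comp[OF b] S T]]
      by (simp add: conv_alg_simps lS lT restrict_UNIV)
    show "ops_lim H F (amult (conv_alg H F) a b) = amult (BH H) (ops_lim H F a) (ops_lim H F b)"
      using eq[OF oc(3)[OF comp[OF a] comp[OF b]]
          ops_conv_mult[OF comp[OF a] comp[OF b] prod_BH_norm[OF a] prod_BH_norm[OF b] S T]]
      by (simp add: conv_alg_simps lS lT restrict_UNIV)
  qed
qed

end

section \<open>From finite-dimensional to all representations on one Hilbert space\<close>

lemma norm_copy_alg:
  assumes "inj_on c (vcarrier A)" "x \<in> vcarrier A"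
  shows "anorm (copy_alg c A) (c x) = anorm A x"
  using assms by (simp add: copy_alg_def Let_def)

text \<open>\<open>closed_relation\<close> covers the families whose product has a copy in the
  universe; an injection of the index set into the index type guarantees such a copy through
  \<open>prod_alg_code\<close>.\<close>

lemma closed_relationD:
  fixes X :: "'x set" and S :: "('x, 'k) relation" and I :: "('x, 'k) universe set" and A :: "('x, 'k) universe \<Rightarrow> ('x, 'k) universe calg"
  assumes S: "closed_relation X S"
    and f: "\<And>i. i \<in> I \<Longrightarrow> is_representation S X (A i) (f i)"
    and bdd: "\<And>x i. x \<in> X \<Longrightarrow> i \<in> I \<Longrightarrow> anorm (A i) (f i x) \<le> M x"
    and cI: "inj_on (cI :: _ \<Rightarrow> ('x, 'k) index) I"
  shows "is_representation S X (prod_alg I A) (\<lambda>x\<in>X. \<lambda>i\<in>I. f i x)"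
proof -
  have A: "cstar_algebra (A i)" if "i \<in> I" for i
    using f[OF that] by (simp add: is_representation_def)
  have P: "cstar_algebra (prod_alg I A)" by (rule cstar_prod_alg[OF A])
  obtain c :: "_ \<Rightarrow> ('x, 'k) universe" where "inj_on c (vcarrier (prod_alg I A))"
    using prod_alg_code[OF cI, of A] by blast
  then have "\<exists>(P :: ('x, 'k) universe calg) \<psi>. cstar_algebra P \<and> star_iso \<psi> (prod_alg I A) P"
    using copy_alg[OF P] by blast
  moreover have "\<forall>x\<in>X. bdd_above ((\<lambda>i. anorm (A i) (f i x)) ` I)"
    using bdd by (auto intro!: bdd_aboveI2)
  ultimately show ?thesis
    using f by (intro S[unfolded closed_relation_def, THEN spec[of _ I], THEN spec[of _ A], THEN spec[of _ f], THEN mp]) blast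
qed

text \<open>Along the filter, \<open>fs k\<close> eventually contains \<open>i\<close>,
  \<open>j\<close> and any given number of codes \<open>natc n\<close>, so its cardinality grows
  beyond all bounds and the tolerance tends to 0.\<close>

lemma hconv_finite_sets:
  fixes H :: "('a, 'm) hilb_scheme" and fs :: "('x, 'k) index \<Rightarrow> ('x, 'k) index set"
  assumes near: "\<And>k. i \<in> fs k \<Longrightarrow> j \<in> fs k \<Longrightarrow> hnorm H (vdiff H (s k) l) < 1 / (real (card (fs k)) + 1)"
    and nn: "\<And>k. 0 \<le> hnorm H (vdiff H (s k) l)"
    and fs: "\<And>k. finite (fs k)"
  shows "hconv H s l (filtercomap fs (finite_subsets_at_top UNIV))"
  unfolding hconv_def
proof (rule tendstoI)
  fix e :: real assume e: "e > 0"
  obtain N where N: "1 / real (Suc N) < e" using nat_approx_posE[OF e] by auto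
  let ?G = "insert i (insert j (natc ` {..<Suc N}))"
  have "\<forall>\<^sub>F G in finite_subsets_at_top UNIV. ?G \<subseteq> G"
    by (auto simp: eventually_finite_subsets_at_top intro!: exI[of _ ?G])
  then show "\<forall>\<^sub>F k in filtercomap fs (finite_subsets_at_top UNIV). dist (hnorm H (vdiff H (s k) l)) 0 < e"
  proof (rule eventually_mono[OF eventually_filtercomapI])
    fix k assume G: "?G \<subseteq> fs k"
    have "Suc N = card (natc ` {..<Suc N} :: ('x, 'k) index set)"
      by (subst card_image) (auto simp: inj_on_def)
    also have "\<dots> \<le> card (fs k)" using G by (intro card_mono fs) auto
    finally have "1 / (real (card (fs k)) + 1) \<le> 1 / real (Suc N)" by (simp add: field_simps)
    moreover have "hnorm H (vdiff H (s k) l) < 1 / (real (card (fs k)) + 1)"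
      using G by (intro near) auto
    ultimately show "dist (hnorm H (vdiff H (s k) l)) 0 < e" using N nn[of k] by simp
  qed
qed

text \<open>The dense family bounds the size of \<open>H\<close>, which gives B(H) a copy in the
  universe and allows the *-strong net to run over the index type.\<close>

lemma rfd_transfer:
  fixes R S :: "('x, 'k) relation" and H :: "('x, 'k) universe hilb" and d :: "('x, 'k) index \<Rightarrow> ('x, 'k) universe"
  assumes S: "cstar_relation X S" and rfd: "rfd_relation X R" and cl: "closed_relation X S"
    and fd: "\<And>g. is_representation R X (BH H) g \<Longrightarrow> finite_dimensional X H g \<Longrightarrow> is_representation S X (BH H) g"
    and H: "hilbert_space H" and d: "dense_family H d" and f: "is_representation R X (BH H) f"
  shows "is_representation S X (BH H) f"
proof -
  interpret hilbert_space H by (rule H)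
  interpret B: cstar_algebra "BH H" by (rule cstar_BH)
  have fB: "f x \<in> bounded_operators H" if "x \<in> X" for x
    using f that by (auto simp: is_representation_def)
  have fE: "f \<in> extensional X" using f by (auto simp: is_representation_def PiE_def)
  have dc: "d j \<in> vcarrier H" for j using d by (simp add: dense_family_def)
  define r where "r x = anorm (BH H) (f x)" for x
  obtain C where C: "\<And>(H :: ('x, 'k) universe hilb) r f. hilbert_space H \<and> (\<forall>x\<in>X. 0 \<le> r x) \<and>
        is_representation R X (BH H) f \<and> (\<forall>x\<in>X. anorm (BH H) (f x) \<le> r x) \<Longrightarrow>
        f \<in> product_topology (\<lambda>_. star_strong_topology H) X closure_of
          {g. is_representation R X (BH H) g \<and> finite_dimensional X H g \<and>
            (\<forall>x\<in>X. anorm (BH H) (g x) \<le> C x (r x))}"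
    using rfd unfolding rfd_relation_def by blast
  let ?top = "product_topology (\<lambda>_. star_strong_topology H) X"
  let ?G = "{g. is_representation R X (BH H) g \<and> finite_dimensional X H g \<and>
            (\<forall>x\<in>X. anorm (BH H) (g x) \<le> C x (r x))}"
  have f_cl: "f \<in> ?top closure_of ?G"
    by (rule C) (use H f fB in \<open>auto simp: r_def opnorm_nonneg\<close>)
  \<comment> \<open>One finite set of indices plays three roles: its elements \<open>Inl x\<close>
    select points of \<open>X\<close>, its elements \<open>j\<close> select dense vectors, and its
    cardinality fixes the precision.\<close>
  define near where "near F g \<longleftrightarrow> (\<forall>x\<in>X. Inl x \<in> F \<longrightarrow> (\<forall>j\<in>F.
      hnorm H (vdiff H (g x (d j)) (f x (d j))) < 1 / (real (card F) + 1) \<and>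
      hnorm H (vdiff H (adjoint_op H (g x) (d j)) (adjoint_op H (f x) (d j))) < 1 / (real (card F) + 1)))"
    for F :: "('x, 'k) index set" and g
  have approx: "\<exists>g\<in>?G. near F g"
    if F: "finite F" for F :: "('x, 'k) index set"
  proof -
    let ?e = "1 / (real (card F) + 1)"
    have "\<exists>U. openin (star_strong_topology H) U \<and> f x \<in> U \<and> (\<forall>T\<in>U. \<forall>j\<in>F.
        hnorm H (vdiff H (T (d j)) (f x (d j))) < ?e \<and>
        hnorm H (vdiff H (adjoint_op H T (d j)) (adjoint_op H (f x) (d j))) < ?e)" if x: "x \<in> X" for x
    proof -
      have e: "?e > 0" by simp
      obtain U where "openin (star_strong_topology H) U" "f x \<in> U"
        "\<And>S \<xi>. S \<in> U \<Longrightarrow> \<xi> \<in> d ` F \<Longrightarrow> hnorm H (vdiff H (S \<xi>) (f x \<xi>)) < ?e"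
        "\<And>S \<xi>. S \<in> U \<Longrightarrow> \<xi> \<in> d ` F \<Longrightarrow> hnorm H (vdiff H (adjoint_op H S \<xi>) (adjoint_op H (f x) \<xi>)) < ?e"
        by (rule star_strong_nbhd[OF fB[OF x], of "d ` F", OF finite_imageI[OF F] _ e]) (use dc in blast)+
      then show ?thesis by (intro exI[of _ U]) blast
    qed
    then obtain U where U: "\<And>x. x \<in> X \<Longrightarrow> openin (star_strong_topology H) (U x)" "\<And>x. x \<in> X \<Longrightarrow> f x \<in> U x"
      "\<And>x T j. x \<in> X \<Longrightarrow> T \<in> U x \<Longrightarrow> j \<in> F \<Longrightarrow>
        hnorm H (vdiff H (T (d j)) (f x (d j))) < ?e \<and>
        hnorm H (vdiff H (adjoint_op H T (d j)) (adjoint_op H (f x) (d j))) < ?e"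
      by metis
    \<comment> \<open>A basic open set of the product topology may restrict only finitely many
      coordinates, here those x with \<open>Inl x\<close> in \<open>F\<close>.\<close>
    define W where "W x = (if Inl x \<in> F then U x else bounded_operators H)" for x
    have "finite {x \<in> X. W x \<noteq> topspace (star_strong_topology H)}"
    proof (rule finite_subset)
      show "{x \<in> X. W x \<noteq> topspace (star_strong_topology H)} \<subseteq> Inl -` F"
        by (auto simp: W_def topspace_star_strong)
      show "finite (Inl -` F :: 'x set)" using F by (intro finite_vimageI) auto
    qed
    moreover have "openin (star_strong_topology H) (W x)" if "x \<in> X" for x
      using U(1)[OF that] openin_topspace[of "star_strong_topology H"] by (simp add: W_def topspace_star_strong)
    ultimately have "openin ?top (PiE X W)" by (simp add: openin_PiE_gen)
    moreover have "f \<in> PiE X W" using U(2) fB fE by (auto simp: W_def PiE_def)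
    ultimately obtain g where g: "g \<in> ?G" "g \<in> PiE X W"
      using f_cl unfolding in_closure_of by blast
    have "g x \<in> U x" if "x \<in> X" "Inl x \<in> F" for x using PiE_mem[OF g(2) that(1)] that(2) by (simp add: W_def)
    then have "near F g" using U(3) unfolding near_def by blast
    then show ?thesis using g(1) by blast
  qed
  obtain fs :: "('x, 'k) index \<Rightarrow> ('x, 'k) index set" where
    fs: "\<And>k. finite (fs k)" "\<And>F. finite F \<Longrightarrow> \<exists>k. fs k = F"
    using finite_sets_enumeration by blast
  have "\<forall>k. \<exists>g. g \<in> ?G \<and> near (fs k) g"
    using approx fs(1) by blast
  from choice[OF this] obtain g where g: "\<forall>k. g k \<in> ?G \<and> near (fs k) (g k)" ..
  then have gG: "\<And>k. g k \<in> ?G" by blast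
  have near: "hnorm H (vdiff H (g k x (d j)) (f x (d j))) < 1 / (real (card (fs k)) + 1)"
    "hnorm H (vdiff H (adjoint_op H (g k x) (d j)) (adjoint_op H (f x) (d j))) < 1 / (real (card (fs k)) + 1)"
    if "x \<in> X" "Inl x \<in> fs k" "j \<in> fs k" for k x j
    using g that unfolding near_def by blast+
  have gB: "g k x \<in> bounded_operators H" if "x \<in> X" for k x
    using gG[of k] that by (auto simp: is_representation_def)
  have gC: "anorm (BH H) (g k x) \<le> C x (r x)" if "x \<in> X" for k x using gG[of k] that by blast
  have gS: "is_representation S X (BH H) (g k)" for k using gG[of k] fd by blast
  define F where "F = filtercomap fs (finite_subsets_at_top (UNIV :: ('x, 'k) index set))"
  \<comment> \<open>The filter is proper because \<open>fs\<close> reaches every finite set of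
    indices.\<close>
  have F: "F \<noteq> bot"
  proof
    assume "F = bot"
    then have "eventually (\<lambda>_. False) F" by simp
    then obtain Q where Q: "eventually Q (finite_subsets_at_top (UNIV :: ('x, 'k) index set))" "\<And>k. \<not> Q (fs k)"
      by (auto simp: F_def eventually_filtercomap)
    then obtain G where "finite G" "Q G" by (auto simp: eventually_finite_subsets_at_top)
    then show False using Q(2) fs(2)[of G] by metis
  qed
  have conv: "ops_conv H F (\<lambda>k. g k x) (f x)" if x: "x \<in> X" for x
    unfolding ops_conv_def
  proof (intro conjI ballI)
    show "f x \<in> bounded_operators H" by (rule fB[OF x])
    fix \<xi> assume \<xi>: "\<xi> \<in> vcarrier H"
    show "hconv H (\<lambda>k. g k x \<xi>) (f x \<xi>) F"
    proof (rule hconv_dense[OF d gB[OF x] fB[OF x] gC[OF x] _ \<xi>])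
      show "hconv H (\<lambda>k. g k x (d j)) (f x (d j)) F" for j
        unfolding F_def
        by (rule hconv_finite_sets[where j = j and i = "Inl x"])
          (use near(1)[OF x] fs(1) in \<open>auto intro!: hnorm_nonneg vdiff_closed op_closed[OF gB[OF x] dc] op_closed[OF fB[OF x] dc]\<close>)
    qed
    show "hconv H (\<lambda>k. adjoint_op H (g k x) \<xi>) (adjoint_op H (f x) \<xi>) F"
    proof (rule hconv_dense[OF d adjoint_closed[OF gB[OF x]] adjoint_closed[OF fB[OF x]] _ _ \<xi>])
      show "anorm (BH H) (adjoint_op H (g k x)) \<le> C x (r x)" for k
        using opnorm_adjoint_le[OF gB[OF x], of k] gC[OF x, of k] by linarith
      show "hconv H (\<lambda>k. adjoint_op H (g k x) (d j)) (adjoint_op H (f x) (d j)) F" for j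
        unfolding F_def
        by (rule hconv_finite_sets[where j = j and i = "Inl x"])
          (use near(2)[OF x] fs(1) in \<open>auto intro!: hnorm_nonneg vdiff_closed op_closed[OF adjoint_closed[OF gB[OF x]] dc] op_closed[OF adjoint_closed[OF fB[OF x]] dc]\<close>)
    qed
  qed
  let ?Q = "prod_alg (UNIV :: ('x, 'k) index set) (\<lambda>_. BH H)"
  let ?f = "\<lambda>x\<in>X. \<lambda>k. g k x"
  have gQ: "(\<lambda>k. g k x) \<in> vcarrier ?Q" if "x \<in> X" for x
    by (rule prod_alg_carrierI[where K = "C x (r x)"]) (use gB[OF that] gC[OF that] in auto)
  have fL: "?f \<in> X \<rightarrow>\<^sub>E vcarrier (conv_alg H F)"
    by (auto simp: conv_alg_simps intro!: exI conv gQ)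
  obtain c :: "_ \<Rightarrow> ('x, 'k) universe" where c: "inj_on c (bounded_operators H)"
    using BH_code[OF d] by blast
  then have c': "inj_on c (vcarrier (BH H))" by simp
  define B where "B = copy_alg c (BH H)"
  have B: "cstar_algebra B" and iso: "star_iso c (BH H) B"
    using copy_alg[OF cstar_BH c'] by (simp_all add: B_def)
  note hom = star_iso_hom[OF iso]
  \<comment> \<open>\<open>closed_relation\<close> takes index sets from the universe, so the index
    k is represented by the singleton {k} and recovered by \<open>the_elem\<close>.\<close>
  define I :: "('x, 'k) universe set" where "I = range (\<lambda>k. {k})"
  have I: "inj_on the_elem I" by (auto simp: I_def inj_on_def)
  have B_norm: "anorm B (c T) = anorm (BH H) T" if "T \<in> bounded_operators H" for T
    using norm_copy_alg[OF c'] that by (simp add: B_def)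
  let ?\<phi> = "\<lambda>a. \<lambda>i\<in>I. c (a (the_elem i))"
  have "is_representation S X (prod_alg I (\<lambda>_. B)) (\<lambda>x\<in>X. \<lambda>i\<in>I. (\<lambda>x\<in>X. c (g (the_elem i) x)) x)"
  proof (rule closed_relationD[OF cl _ _ I])
    show "is_representation S X B (\<lambda>x\<in>X. c (g (the_elem i) x))" for i
      by (rule is_representation_hom[OF S gS B hom inj_on_id])
    show "anorm B ((\<lambda>x\<in>X. c (g (the_elem i) x)) x) \<le> C x (r x)" if "x \<in> X" for x i
      using gC[OF that] that by (simp add: B_norm[OF gB[OF that]])
  qed
  also have "(\<lambda>x\<in>X. \<lambda>i\<in>I. (\<lambda>x\<in>X. c (g (the_elem i) x)) x) = (\<lambda>x\<in>X. ?\<phi> (?f x))"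
    by (auto simp: fun_eq_iff)
  finally have rep: "is_representation S X (prod_alg I (\<lambda>_. B)) (\<lambda>x\<in>X. ?\<phi> (?f x))" .
  have comp: "a k \<in> bounded_operators H" "anorm (BH H) (a k) \<le> anorm ?Q a"
    if "a \<in> vcarrier (conv_alg H F)" for a k
    using prod_BH_component[of a k] prod_BH_norm[of a k] that by (simp_all add: conv_alg_simps)
  have "star_hom ?\<phi> (conv_alg H F) (prod_alg I (\<lambda>_. B))"
    unfolding star_hom_def
  proof (intro conjI ballI allI funcsetI)
    have h: "c T \<in> vcarrier B" "c (vadd (BH H) T T') = vadd B (c T) (c T')" "c (vscale (BH H) z T) = vscale B z (c T)"
      "c (amult (BH H) T T') = amult B (c T) (c T')" "c (astar (BH H) T) = astar B (c T)"
      if "T \<in> bounded_operators H" "T' \<in> bounded_operators H" for T T' z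
      using hom that unfolding star_hom_def by (auto simp del: BH_simps(2-6))
    note [simp del] = BH_simps(2-6)
    fix a assume a: "a \<in> vcarrier (conv_alg H F)"
    show "?\<phi> a \<in> vcarrier (prod_alg I (\<lambda>_. B))"
      by (rule prod_alg_carrierI[where K = "anorm ?Q a"])
        (use comp[OF a] in \<open>auto simp: h(1)[OF comp(1)[OF a] comp(1)[OF a]] B_norm\<close>)
    show "?\<phi> (vscale (conv_alg H F) z a) = vscale (prod_alg I (\<lambda>_. B)) z (?\<phi> a)" for z
      by (auto simp: fun_eq_iff conv_alg_simps h(3)[OF comp(1)[OF a] comp(1)[OF a]])
    show "?\<phi> (astar (conv_alg H F) a) = astar (prod_alg I (\<lambda>_. B)) (?\<phi> a)"
      by (auto simp: fun_eq_iff conv_alg_simps h(5)[OF comp(1)[OF a] comp(1)[OF a]])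
    fix b assume b: "b \<in> vcarrier (conv_alg H F)"
    show "?\<phi> (vadd (conv_alg H F) a b) = vadd (prod_alg I (\<lambda>_. B)) (?\<phi> a) (?\<phi> b)"
      by (auto simp: fun_eq_iff conv_alg_simps h(2)[OF comp(1)[OF a] comp(1)[OF b]])
    show "?\<phi> (amult (conv_alg H F) a b) = amult (prod_alg I (\<lambda>_. B)) (?\<phi> a) (?\<phi> b)"
      by (auto simp: fun_eq_iff conv_alg_simps h(4)[OF comp(1)[OF a] comp(1)[OF b]])
  qed
  moreover have "inj_on ?\<phi> (vcarrier (conv_alg H F))"
  proof (rule inj_onI, rule ext)
    fix a b k assume a: "a \<in> vcarrier (conv_alg H F)" and b: "b \<in> vcarrier (conv_alg H F)" and eq: "?\<phi> a = ?\<phi> b"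
    have "c (a k) = c (b k)" using fun_cong[OF eq, of "{k}"] by (simp add: I_def)
    then show "a k = b k" using inj_onD[OF c] comp[OF a] comp[OF b] by blast
  qed
  \<comment> \<open>(R2) along the injective \<open>?\<phi>\<close> brings the family down from the
    full product to the convergent families, where (R3) along the limit map becomes
    available.\<close>
  ultimately have "is_representation S X (conv_alg H F) ?f"
    using is_representation_inj[OF S rep conv_alg_cstar[OF F] _ _ fL] by blast
  from is_representation_hom[OF S this cstar_BH ops_lim_hom[OF F] c']
  have "is_representation S X (BH H) (\<lambda>x\<in>X. ops_lim H F (?f x))" .
  moreover have "(\<lambda>x\<in>X. ops_lim H F (?f x)) = f"
  proof
    fix x
    show "(\<lambda>x\<in>X. ops_lim H F (?f x)) x = f x"
      using ops_lim_eq[OF F gB conv, of x] extensional_arb[OF fE, of x] by (cases "x \<in> X") auto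
  qed
  ultimately show ?thesis by simp
qed

section \<open>The GNS construction\<close>

context unital_cstar
begin

definition cscale :: "complex \<Rightarrow> 'b \<Rightarrow> 'b" where
  "cscale c x = Re c *\<^sub>R x + Im c *\<^sub>R (\<iota> * x)"

lemma cscale_add_right: "cscale c (x + y) = cscale c x + cscale c y"
  by (simp add: cscale_def scaleR_add_right distrib_left)

lemma cscale_add_left: "cscale (c + d) x = cscale c x + cscale d x"
  by (simp add: cscale_def scaleR_add_left)

lemma cscale_cscale: "cscale c (cscale d x) = cscale (c * d) x"
  by (simp add: cscale_def algebra_simps)

lemma cscale_one [simp]: "cscale 1 x = x"
  by (simp add: cscale_def)

lemma cscale_minus_one [simp]: "cscale (-1) x = - x"
  by (simp add: cscale_def)

lemma cscale_zero [simp]: "cscale c 0 = 0"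
  by (simp add: cscale_def)

lemma mult_cscale: "a * cscale c x = cscale c (a * x)" "cscale c a * x = cscale c (a * x)"
  by (simp_all add: cscale_def distrib_left distrib_right iota_right[of a] mult.assoc)

end

context positive_functional
begin

text \<open>The GNS form. It is only semidefinite; null vectors are identified later, when sequences
  are coded.\<close>

definition sip :: "'a \<Rightarrow> 'a \<Rightarrow> complex" where
  "sip x y = \<Phi> (star x * y)"

definition pn :: "'a \<Rightarrow> real" where
  "pn x = sqrt (Re (sip x x))"

lemma func_cscale: "\<Phi> (cscale c x) = c * \<Phi> x"
  by (simp add: cscale_def func_add func_scaleR func_iota complex_eq_iff)

lemma sip_add_right: "sip x (y + z) = sip x y + sip x z"
  by (simp add: sip_def distrib_left func_add)

lemma sip_cscale_right: "sip x (cscale c y) = c * sip x y"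
  by (simp add: sip_def mult_cscale func_cscale)

lemma sip_commute: "sip y x = cnj (sip x y)"
  unfolding sip_def by (subst func_star[symmetric]) simp

lemma sip_add_left: "sip (x + y) z = sip x z + sip y z"
  by (simp add: sip_def distrib_right func_add)

lemma sip_cscale_left: "sip (cscale c x) y = cnj c * sip x y"
  using sip_commute[of "cscale c x" y] sip_commute[of x y] by (simp add: sip_cscale_right)

lemma sip_mult_left: "sip (a * x) y = sip x (star a * y)"
  by (simp add: sip_def mult.assoc)

lemma sip_diff_right: "sip x (y - z) = sip x y - sip x z"
  using sip_add_right[of x y "cscale (-1) z"] by (simp add: sip_cscale_right del: cscale_minus_one) simp

lemma sip_diff_left: "sip (x - y) z = sip x z - sip y z"
  using sip_add_left[of x "cscale (-1) y" z] by (simp add: sip_cscale_left del: cscale_minus_one) simp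

lemma pn_nonneg [simp]: "0 \<le> pn x"
  by (simp add: pn_def sip_def func_pos)

lemma pn_sq: "(pn x)\<^sup>2 = Re (sip x x)"
  by (simp add: pn_def sip_def func_pos)

lemma pn_zero [simp]: "pn 0 = 0"
  using sip_cscale_right[of 0 0 0] by (simp add: pn_def)

lemma pn_le_norm: "pn x \<le> norm x"
  by (rule power2_le_imp_le) (simp_all add: pn_sq sip_def func_bound)

lemma pn_add_cscale_sq: "(pn (x + cscale c y))\<^sup>2 = (pn x)\<^sup>2 + 2 * Re (c * sip x y) + (cmod c)\<^sup>2 * (pn y)\<^sup>2"
proof -
  have "sip (x + cscale c y) (x + cscale c y)
      = sip x x + c * sip x y + cnj (c * sip x y) + (cnj c * c) * sip y y"
    by (simp add: sip_add_left sip_add_right sip_cscale_left sip_cscale_right sip_commute[of y x] algebra_simps)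
  also have "\<dots> = sip x x + c * sip x y + cnj (c * sip x y) + of_real ((cmod c)\<^sup>2) * sip y y"
    by (simp only: cnj_mult_self)
  finally show ?thesis
    unfolding pn_sq by (simp only: plus_complex.sel complex_cnj Re_complex_of_real times_complex.sel Im_complex_of_real) simp
qed

lemma sip_le: "cmod (sip x y) \<le> pn x * pn y"
proof -
  have "(cmod (sip x y))\<^sup>2 \<le> (pn x)\<^sup>2 * (pn y)\<^sup>2"
  proof (rule discriminant_complex)
    show "0 \<le> (pn x)\<^sup>2 + 2 * Re (c * sip x y) + (cmod c)\<^sup>2 * (pn y)\<^sup>2" for c
      using zero_le_power2[of "pn (x + cscale c y)"] unfolding pn_add_cscale_sq .
  qed simp
  then have "(cmod (sip x y))\<^sup>2 \<le> (pn x * pn y)\<^sup>2" by (simp add: power_mult_distrib)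
  then show ?thesis by (rule power2_le_imp_le) simp
qed

lemma pn_triangle: "pn (x + y) \<le> pn x + pn y"
proof -
  have "(pn (x + y))\<^sup>2 = (pn x)\<^sup>2 + 2 * Re (sip x y) + (pn y)\<^sup>2"
    using pn_add_cscale_sq[of x 1 y] by simp
  also have "\<dots> \<le> (pn x)\<^sup>2 + 2 * (pn x * pn y) + (pn y)\<^sup>2"
    using sip_le[of x y] complex_Re_le_cmod[of "sip x y"] by linarith
  finally have "(pn (x + y))\<^sup>2 \<le> (pn x + pn y)\<^sup>2" by (simp add: power2_sum)
  then show ?thesis by (rule power2_le_imp_le) simp
qed

lemma pn_cscale: "pn (cscale c x) = cmod c * pn x"
proof -
  have "(pn (cscale c x))\<^sup>2 = (cmod c * pn x)\<^sup>2"
    using pn_add_cscale_sq[of 0 c x] sip_cscale_left[of 0 0 x] by (simp add: power_mult_distrib)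
  then show ?thesis by simp
qed

lemma pn_minus [simp]: "pn (- x) = pn x"
  using pn_cscale[of "-1" x] by simp

lemma pn_diff_commute: "pn (x - y) = pn (y - x)"
  using pn_minus[of "x - y"] by simp

lemma pn_diff_triangle: "pn (x - z) \<le> pn (x - y) + pn (y - z)"
  using pn_triangle[of "x - y" "y - z"] by simp

lemma pn_diff_abs: "\<bar>pn x - pn y\<bar> \<le> pn (x - y)"
  using pn_triangle[of "x - y" y] pn_triangle[of "y - x" x] pn_diff_commute[of x y] by simp

text \<open>The difference |a|^2 - \<open>star a * a\<close> is positive, hence a square k^2, and
  \<open>star x\<close> times it times x equals \<open>star (k * x) * (k * x)\<close>, at which
  \<open>\<Phi>\<close> is nonnegative. This is the boundedness of left multiplication.\<close>

lemma pn_mult: "pn (a * x) \<le> norm a * pn x"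
proof -
  have "pos (of_real ((norm a)\<^sup>2) - star a * a)"
    by (rule pos_iff_norm[of _ "(norm a)\<^sup>2"]) (simp_all add: norm_star_mult)
  then obtain k where k: "star k = k" "of_real ((norm a)\<^sup>2) - star a * a = k * k"
    by (auto simp: pos_def)
  have "star x * (of_real ((norm a)\<^sup>2) - star a * a) * x = star (k * x) * (k * x)"
    by (simp only: k(2)) (simp add: k(1) mult.assoc)
  then have "0 \<le> Re (\<Phi> (star x * (of_real ((norm a)\<^sup>2) - star a * a) * x))"
    by (simp only: func_pos)
  also have "star x * (of_real ((norm a)\<^sup>2) - star a * a) * x = (norm a)\<^sup>2 *\<^sub>R (star x * x) - star (a * x) * (a * x)"
    by (simp add: of_real_def algebra_simps mult.assoc)
  also have "\<Phi> \<dots> = of_real ((norm a)\<^sup>2) * \<Phi> (star x * x) - \<Phi> (star (a * x) * (a * x))"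
    using func_add[of "(norm a)\<^sup>2 *\<^sub>R (star x * x)" "(-1) *\<^sub>R (star (a * x) * (a * x))"]
    by (simp only: func_scaleR) simp
  finally have "(pn (a * x))\<^sup>2 \<le> (norm a * pn x)\<^sup>2"
    by (simp add: pn_sq sip_def power_mult_distrib)
  then show ?thesis by (rule power2_le_imp_le) simp
qed

end

text \<open>\<open>Z\<close> is the algebra to be represented and \<open>e\<close> a dense family in
  it, with parameters coded by \<open>tc\<close> in the index type. \<open>Z\<close> need not
  contain 1, so there need be no vector of the unit, and operators are compared on the vectors of
  \<open>Z\<close> instead.\<close>

locale gns = positive_functional star \<iota> \<Phi>
  for star :: "'a::{real_normed_algebra_1,banach} \<Rightarrow> 'a" and \<iota> \<Phi> +
  fixes Z :: "'a set" and e :: "'t \<Rightarrow> 'a" and tc :: "'t \<Rightarrow> ('x, 'k) index"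
  assumes Z_zero: "0 \<in> Z"
    and Z_add: "x \<in> Z \<Longrightarrow> y \<in> Z \<Longrightarrow> x + y \<in> Z"
    and Z_cscale: "x \<in> Z \<Longrightarrow> cscale c x \<in> Z"
    and Z_mult: "x \<in> Z \<Longrightarrow> y \<in> Z \<Longrightarrow> x * y \<in> Z"
    and e_Z: "e t \<in> Z"
    and dense: "x \<in> Z \<Longrightarrow> 0 < \<epsilon> \<Longrightarrow> \<exists>t. norm (x - e t) < \<epsilon>"
    and inj_tc: "inj tc"
begin

section \<open>The completion of the GNS space, with carrier in the universe\<close>

lemma Z_diff: "x \<in> Z \<Longrightarrow> y \<in> Z \<Longrightarrow> x - y \<in> Z"
  using Z_add[of x "cscale (-1) y"] Z_cscale[of y "-1"] by simp

text \<open>Sequences that are Cauchy for the seminorm. Modulo null sequences they form the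
  completion and the quotient by null vectors at once.\<close>

definition K :: "(nat \<Rightarrow> 'a) set" where
  "K = {s. (\<forall>n. s n \<in> Z) \<and> (\<forall>\<epsilon>>0. \<exists>N. \<forall>m\<ge>N. \<forall>n\<ge>N. pn (s m - s n) < \<epsilon>)}"

text \<open>Sums, differences, multiples and products all change by at most a linear combination of
  the changes of their arguments, so this one criterion serves them all.\<close>

lemma KI:
  assumes "\<And>n. s n \<in> Z" "\<And>m n. pn (s m - s n) \<le> c * pn (t m - t n) + d * pn (u m - u n)"
    "t \<in> K" "u \<in> K" "0 \<le> c" "0 \<le> d"
  shows "s \<in> K"
  unfolding K_def
proof (intro CollectI conjI allI impI)
  fix \<epsilon> :: real assume \<epsilon>: "\<epsilon> > 0"
  define \<delta> where "\<delta> = \<epsilon> / (c + d + 1)"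
  have \<delta>: "\<delta> > 0" using \<epsilon> assms by (simp add: \<delta>_def)
  obtain N1 where N1: "\<forall>m\<ge>N1. \<forall>n\<ge>N1. pn (t m - t n) < \<delta>" using assms(3) \<delta> unfolding K_def by blast
  obtain N2 where N2: "\<forall>m\<ge>N2. \<forall>n\<ge>N2. pn (u m - u n) < \<delta>" using assms(4) \<delta> unfolding K_def by blast
  have "pn (s m - s n) < \<epsilon>" if mn: "m \<ge> max N1 N2" "n \<ge> max N1 N2" for m n
  proof -
    have t: "pn (t m - t n) < \<delta>" and u: "pn (u m - u n) < \<delta>" using N1 N2 mn by simp_all
    have "c * pn (t m - t n) + d * pn (u m - u n) \<le> c * \<delta> + d * \<delta>"
      using t u assms by (intro add_mono mult_left_mono) auto
    also have "\<dots> < (c + d + 1) * \<delta>" using \<delta> by (simp add: algebra_simps)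
    also have "\<dots> = \<epsilon>" using assms by (simp add: \<delta>_def)
    finally show ?thesis using assms(2)[of m n] by linarith
  qed
  then show "\<exists>N. \<forall>m\<ge>N. \<forall>n\<ge>N. pn (s m - s n) < \<epsilon>" by blast
qed (rule assms)

lemma K_Z: "s \<in> K \<Longrightarrow> s n \<in> Z"
  by (simp add: K_def)

lemma K_const: "x \<in> Z \<Longrightarrow> (\<lambda>_. x) \<in> K"
  by (simp add: K_def)

lemma K_add: "s \<in> K \<Longrightarrow> t \<in> K \<Longrightarrow> (\<lambda>n. s n + t n) \<in> K"
  by (rule KI[where c = 1 and d = 1 and t = s and u = t])
    (use pn_triangle in \<open>auto simp: Z_add K_Z add_diff_add\<close>)

lemma K_diff: "s \<in> K \<Longrightarrow> t \<in> K \<Longrightarrow> (\<lambda>n. s n - t n) \<in> K"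
proof (rule KI[where c = 1 and d = 1 and t = s and u = t])
  fix m n
  have "pn (s m - t m - (s n - t n)) = pn ((s m - s n) + - (t m - t n))" by (simp add: algebra_simps)
  also have "\<dots> \<le> pn (s m - s n) + pn (t m - t n)" using pn_triangle pn_minus by metis
  finally show "pn (s m - t m - (s n - t n)) \<le> 1 * pn (s m - s n) + 1 * pn (t m - t n)" by simp
qed (auto simp: Z_diff K_Z)

lemma K_mult: "a \<in> Z \<Longrightarrow> s \<in> K \<Longrightarrow> (\<lambda>n. a * s n) \<in> K"
  by (rule KI[where c = "norm a" and d = 0 and t = s and u = s])
    (auto simp: Z_mult K_Z pn_mult simp flip: right_diff_distrib)

lemma K_cscale: "s \<in> K \<Longrightarrow> (\<lambda>n. cscale c (s n)) \<in> K"
proof (rule KI[where c = "cmod c" and d = 0 and t = s and u = s])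
  fix m n
  have "cscale c (s m) - cscale c (s n) = cscale c (s m - s n)"
    by (simp add: cscale_def algebra_simps)
  then show "pn (cscale c (s m) - cscale c (s n)) \<le> cmod c * pn (s m - s n) + 0 * pn (s m - s n)"
    by (simp add: pn_cscale)
qed (auto simp: Z_cscale K_Z)

lemma pn_convergent: "s \<in> K \<Longrightarrow> convergent (\<lambda>n. pn (s n))"
  unfolding Cauchy_convergent_iff[symmetric] Cauchy_def dist_norm real_norm_def
  using pn_diff_abs by (simp add: K_def) (meson le_less_trans)

lemma pn_lim: "s \<in> K \<Longrightarrow> (\<lambda>n. pn (s n)) \<longlonglongrightarrow> lim (\<lambda>n. pn (s n))"
  using pn_convergent convergent_LIMSEQ_iff by blast

text \<open>Polarization writes the form through seminorms of s + c t with c in {1, -1, i, -i}, and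
  these converge by \<open>pn_lim\<close>.\<close>

lemma sip_convergent:
  assumes s: "s \<in> K" and t: "t \<in> K"
  shows "(\<lambda>n. sip (s n) (t n)) \<longlonglongrightarrow> lim (\<lambda>n. sip (s n) (t n))"
proof -
  have pol: "sip x y = (1/4) * (of_real ((pn (x + y))\<^sup>2) - of_real ((pn (x + cscale (-1) y))\<^sup>2)
      + \<i> * (of_real ((pn (x + cscale (-\<i>) y))\<^sup>2) - of_real ((pn (x + cscale \<i> y))\<^sup>2)))" for x y
    using pn_add_cscale_sq[of x 1 y] pn_add_cscale_sq[of x "-1" y] pn_add_cscale_sq[of x \<i> y]
      pn_add_cscale_sq[of x "-\<i>" y]
    by (simp add: complex_eq_iff)
  have "convergent (\<lambda>n. sip (s n) (t n))"
  proof (rule convergentI)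
    let ?L = "\<lambda>c. lim (\<lambda>n. pn (s n + cscale c (t n)))"
    show "(\<lambda>n. sip (s n) (t n)) \<longlonglongrightarrow> (1/4) * (of_real ((lim (\<lambda>n. pn (s n + t n)))\<^sup>2) - of_real ((?L (-1))\<^sup>2)
        + \<i> * (of_real ((?L (-\<i>))\<^sup>2) - of_real ((?L \<i>)\<^sup>2)))"
      unfolding pol by (intro tendsto_intros pn_lim[OF K_add[OF s t]] pn_lim[OF K_add[OF s K_cscale[OF t]]])
  qed
  then show ?thesis using convergent_LIMSEQ_iff by blast
qed

text \<open>A Cauchy sequence is coded by the bounds on its limiting distances to the dense family, so that
  two sequences get the same code exactly if they differ by a null sequence.\<close>

definition code :: "(nat \<Rightarrow> 'a) \<Rightarrow> ('x, 'k) universe" where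
  "code s = {pairc (tc t) (natc m) |t m. lim (\<lambda>n. pn (s n - e t)) < 1 / real (Suc m)}"

lemma code_mem: "pairc (tc t) (natc m) \<in> code s \<longleftrightarrow> lim (\<lambda>n. pn (s n - e t)) < 1 / real (Suc m)"
  using inj_tc by (auto simp: code_def inj_eq)

lemma K_dense:
  assumes s: "s \<in> K" and \<epsilon>: "\<epsilon> > 0"
  shows "\<exists>t. lim (\<lambda>n. pn (s n - e t)) < \<epsilon>"
proof -
  obtain N where N: "\<forall>m\<ge>N. \<forall>n\<ge>N. pn (s m - s n) < \<epsilon> / 2"
    using s \<epsilon> unfolding K_def by (auto dest!: spec[of _ "\<epsilon>/2"])
  obtain t where t: "norm (s N - e t) < \<epsilon> / 4" using dense[OF K_Z[OF s], of "\<epsilon>/4" N] \<epsilon> by auto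
  have "lim (\<lambda>n. pn (s n - e t)) \<le> \<epsilon> / 2 + \<epsilon> / 4"
  proof (rule LIMSEQ_le_const2[OF pn_lim[OF K_diff[OF s K_const[OF e_Z]]]], intro exI allI impI)
    fix n assume "n \<ge> N"
    then show "pn (s n - e t) \<le> \<epsilon> / 2 + \<epsilon> / 4"
      using pn_diff_triangle[of "s n" "e t" "s N"] pn_le_norm[of "s N - e t"] t N by force
  qed
  then show ?thesis using \<epsilon> by (intro exI[of _ t]) linarith
qed

lemma code_eqI:
  assumes s: "s \<in> K" and t: "t \<in> K" and lim: "(\<lambda>n. pn (s n - t n)) \<longlonglongrightarrow> 0"
  shows "code s = code t"
proof -
  have "lim (\<lambda>n. pn (s n - e u)) = lim (\<lambda>n. pn (t n - e u))" for u
  proof -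
    have "(\<lambda>n. pn (s n - e u) - pn (t n - e u)) \<longlonglongrightarrow> 0"
    proof (rule Lim_null_comparison[OF always_eventually lim], rule allI)
      show "norm (pn (s n - e u) - pn (t n - e u)) \<le> pn (s n - t n)" for n
        using pn_diff_abs[of "s n - e u" "t n - e u"] by simp
    qed
    moreover have "(\<lambda>n. pn (s n - e u) - pn (t n - e u))
        \<longlonglongrightarrow> lim (\<lambda>n. pn (s n - e u)) - lim (\<lambda>n. pn (t n - e u))"
      by (intro tendsto_diff pn_lim K_diff s t K_const e_Z)
    ultimately show ?thesis using LIMSEQ_unique by fastforce
  qed
  then show ?thesis by (simp add: code_def)
qed

text \<open>A dense element close to \<open>s\<close> in the limit is recorded in the common code
  and therefore equally close to \<open>t\<close>; the triangle inequality does the rest.\<close>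

lemma code_eqD:
  assumes s: "s \<in> K" and t: "t \<in> K" and eq: "code s = code t"
  shows "(\<lambda>n. pn (s n - t n)) \<longlonglongrightarrow> 0"
proof -
  have "lim (\<lambda>n. pn (s n - t n)) \<le> \<epsilon>" if \<epsilon>: "\<epsilon> > 0" for \<epsilon>
  proof -
    obtain m where m: "1 / real (Suc m) < \<epsilon> / 2" using nat_approx_posE[of "\<epsilon>/2"] \<epsilon> by auto
    obtain u where u: "lim (\<lambda>n. pn (s n - e u)) < 1 / real (Suc m)" using K_dense[OF s, of "1 / real (Suc m)"] by auto
    have u': "lim (\<lambda>n. pn (t n - e u)) < 1 / real (Suc m)"
      using u code_mem[of u m s] code_mem[of u m t] eq by blast
    have "lim (\<lambda>n. pn (s n - t n)) \<le> lim (\<lambda>n. pn (s n - e u)) + lim (\<lambda>n. pn (t n - e u))"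
    proof (rule LIMSEQ_le[OF pn_lim[OF K_diff[OF s t]] tendsto_add])
      show "\<exists>N. \<forall>n\<ge>N. pn (s n - t n) \<le> pn (s n - e u) + pn (t n - e u)"
        using pn_diff_triangle[of "s _" "t _" "e u"] pn_diff_commute by metis
    qed (intro pn_lim K_diff s t K_const e_Z)+
    then show ?thesis using u u' m by linarith
  qed
  then have "lim (\<lambda>n. pn (s n - t n)) \<le> 0" by (rule dense_ge)
  moreover have "0 \<le> lim (\<lambda>n. pn (s n - t n))"
    by (rule LIMSEQ_le_const[OF pn_lim[OF K_diff[OF s t]]]) simp
  ultimately show ?thesis using pn_lim[OF K_diff[OF s t]] by simp
qed

text \<open>A chosen representative. It differs from the original sequence by a null sequence, so
  operations defined through it can be computed with any representative (\<open>GH_add\<close>,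
  \<open>GH_scale\<close>, \<open>GH_inner\<close>).\<close>

definition decode :: "('x, 'k) universe \<Rightarrow> nat \<Rightarrow> 'a" where
  "decode = inv_into K code"

lemma decode: "s \<in> K \<Longrightarrow> decode (code s) \<in> K" "s \<in> K \<Longrightarrow> code (decode (code s)) = code s"
  unfolding decode_def by (rule inv_into_into, rule imageI, assumption) (rule f_inv_into_f[of _ code K], rule imageI)

lemma decode_near: "s \<in> K \<Longrightarrow> (\<lambda>n. pn (decode (code s) n - s n)) \<longlonglongrightarrow> 0"
  by (rule code_eqD) (simp_all add: decode)

text \<open>Vectors are the codes themselves, so that this is a Hilbert space of exactly the type
  over which \<open>rfd_relation\<close> quantifies.\<close>

definition GH :: "('x, 'k) universe hilb" where
  "GH = \<lparr>vcarrier = code ` K,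
     vzero = code (\<lambda>_. 0),
     vadd = (\<lambda>u v. code (\<lambda>n. decode u n + decode v n)),
     vscale = (\<lambda>c u. code (\<lambda>n. cscale c (decode u n))),
     hinner = (\<lambda>u v. lim (\<lambda>n. sip (decode u n) (decode v n)))\<rparr>"

lemma GH_carrier: "vcarrier GH = code ` K" and GH_zero: "vzero GH = code (\<lambda>_. 0)"
  by (simp_all add: GH_def)

lemma GH_add: "s \<in> K \<Longrightarrow> t \<in> K \<Longrightarrow> vadd GH (code s) (code t) = code (\<lambda>n. s n + t n)"
proof -
  assume s: "s \<in> K" and t: "t \<in> K"
  have "(\<lambda>n. pn (decode (code s) n + decode (code t) n - (s n + t n))) \<longlonglongrightarrow> 0"
  proof (rule Lim_null_comparison[OF always_eventually], rule allI)
    show "norm (pn (decode (code s) n + decode (code t) n - (s n + t n)))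
        \<le> pn (decode (code s) n - s n) + pn (decode (code t) n - t n)" for n
      using pn_triangle[of "decode (code s) n - s n" "decode (code t) n - t n"] by (simp add: add_diff_add)
    show "(\<lambda>n. pn (decode (code s) n - s n) + pn (decode (code t) n - t n)) \<longlonglongrightarrow> 0"
      using tendsto_add[OF decode_near[OF s] decode_near[OF t]] by simp
  qed
  then show ?thesis unfolding GH_def by (simp, intro code_eqI K_add decode s t)
qed

lemma GH_scale: "s \<in> K \<Longrightarrow> vscale GH c (code s) = code (\<lambda>n. cscale c (s n))"
proof -
  assume s: "s \<in> K"
  have "pn (cscale c x - cscale c y) = cmod c * pn (x - y)" for x y
    using pn_cscale[of c "x - y"] by (simp add: cscale_def algebra_simps)
  then have "(\<lambda>n. pn (cscale c (decode (code s) n) - cscale c (s n))) \<longlonglongrightarrow> 0"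
    using tendsto_mult_left[OF decode_near[OF s], of "cmod c"] by simp
  then show ?thesis unfolding GH_def by (simp, intro code_eqI K_cscale decode s)
qed

lemma GH_inner:
  assumes s: "s \<in> K" and t: "t \<in> K"
  shows "hinner GH (code s) (code t) = lim (\<lambda>n. sip (s n) (t n))"
proof -
  let ?s = "decode (code s)" and ?t = "decode (code t)"
  have "(\<lambda>n. sip (?s n) (?t n) - sip (s n) (t n)) \<longlonglongrightarrow> 0"
  proof (rule Lim_null_comparison[OF always_eventually], rule allI)
    fix n
    have eq: "sip (?s n) (?t n) - sip (s n) (t n) = sip (?s n - s n) (?t n) + sip (s n) (?t n - t n)"
      by (simp add: sip_diff_left sip_diff_right)
    show "norm (sip (?s n) (?t n) - sip (s n) (t n))
        \<le> pn (?s n - s n) * pn (?t n) + pn (s n) * pn (?t n - t n)"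
      unfolding eq by (intro norm_triangle_mono sip_le)
  next
    show "(\<lambda>n. pn (?s n - s n) * pn (?t n) + pn (s n) * pn (?t n - t n)) \<longlonglongrightarrow> 0"
      using tendsto_add[OF tendsto_mult[OF decode_near[OF s] pn_lim[OF decode(1)[OF t]]]
          tendsto_mult[OF pn_lim[OF s] decode_near[OF t]]] by simp
  qed
  moreover have "(\<lambda>n. sip (?s n) (?t n) - sip (s n) (t n))
      \<longlonglongrightarrow> lim (\<lambda>n. sip (?s n) (?t n)) - lim (\<lambda>n. sip (s n) (t n))"
    by (intro tendsto_diff sip_convergent decode s t)
  ultimately show ?thesis using LIMSEQ_unique by (fastforce simp: GH_def)
qed

lemma GH_vdiff: "s \<in> K \<Longrightarrow> t \<in> K \<Longrightarrow> vdiff GH (code s) (code t) = code (\<lambda>n. s n - t n)"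
  by (simp add: vdiff_def GH_scale GH_add K_cscale del: cscale_minus_one) simp

lemma GH_norm:
  assumes s: "s \<in> K"
  shows "hnorm GH (code s) = lim (\<lambda>n. pn (s n))"
proof -
  have "(\<lambda>n. sqrt (Re (sip (s n) (s n)))) \<longlonglongrightarrow> sqrt (Re (lim (\<lambda>n. sip (s n) (s n))))"
    by (intro tendsto_real_sqrt tendsto_Re sip_convergent s)
  then have "lim (\<lambda>n. pn (s n)) = sqrt (Re (lim (\<lambda>n. sip (s n) (s n))))"
    unfolding pn_def by (rule limI)
  then show ?thesis by (simp add: hnorm_def GH_inner s)
qed

text \<open>A diagonal argument: \<open>N k\<close> is a position from which \<open>s k\<close>
  oscillates by less than 1/(k+1), and the limit is coded by the sequence of the entries
  \<open>s k (N k)\<close>.\<close>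

lemma GH_complete: "complete_wrt GH (hnorm GH)"
  unfolding complete_wrt_def
proof (intro allI impI, elim conjE)
  fix u :: "nat \<Rightarrow> ('x, 'k) universe"
  assume "\<forall>n. u n \<in> vcarrier GH"
    and C: "\<forall>\<epsilon>>0. \<exists>N. \<forall>m\<ge>N. \<forall>n\<ge>N. hnorm GH (vdiff GH (u m) (u n)) < \<epsilon>"
  then have "\<forall>k. \<exists>s. s \<in> K \<and> u k = code s" unfolding GH_carrier by blast
  from choice[OF this] obtain s where s: "\<And>k. s k \<in> K" and us: "\<And>k. u k = code (s k)" by blast
  have du: "hnorm GH (vdiff GH (u j) (u k)) = lim (\<lambda>n. pn (s j n - s k n))" for j k
    by (simp add: us GH_vdiff GH_norm K_diff s)
  have "\<forall>k. \<exists>N. \<forall>m\<ge>N. \<forall>n\<ge>N. pn (s k m - s k n) < 1 / real (Suc k)"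
  proof
    fix k
    have "1 / real (Suc k) > 0" by simp
    with s[of k] show "\<exists>N. \<forall>m\<ge>N. \<forall>n\<ge>N. pn (s k m - s k n) < 1 / real (Suc k)"
      unfolding K_def by blast
  qed
  from choice[OF this] obtain N where N: "\<And>k m n. m \<ge> N k \<Longrightarrow> n \<ge> N k \<Longrightarrow> pn (s k m - s k n) < 1 / real (Suc k)"
    by blast
  define l where "l k = s k (N k)" for k
  have l_near: "pn (s k n - l k) < 1 / real (Suc k)" if "n \<ge> N k" for k n
    using N[OF that, of "N k"] by (simp add: l_def)
  have dl: "pn (l j - l k) \<le> 1 / real (Suc j) + 1 / real (Suc k) + hnorm GH (vdiff GH (u j) (u k))" for j k
    unfolding du
  proof (rule LIMSEQ_le_const)
    show "(\<lambda>n. 1 / real (Suc j) + 1 / real (Suc k) + pn (s j n - s k n))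
        \<longlonglongrightarrow> 1 / real (Suc j) + 1 / real (Suc k) + lim (\<lambda>n. pn (s j n - s k n))"
      by (intro tendsto_add tendsto_const pn_lim K_diff s)
    show "\<exists>M. \<forall>n\<ge>M. pn (l j - l k) \<le> 1 / real (Suc j) + 1 / real (Suc k) + pn (s j n - s k n)"
    proof (intro exI allI impI)
      fix n assume "n \<ge> max (N j) (N k)"
      then have "pn (s j n - l j) < 1 / real (Suc j)" "pn (s k n - l k) < 1 / real (Suc k)"
        using l_near[of j n] l_near[of k n] by simp_all
      then show "pn (l j - l k) \<le> 1 / real (Suc j) + 1 / real (Suc k) + pn (s j n - s k n)"
        using pn_diff_triangle[of "l j" "l k" "s j n"] pn_diff_triangle[of "s j n" "l k" "s k n"]
          pn_diff_commute[of "l j" "s j n"] by linarith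
    qed
  qed
  have small: "\<exists>M. \<forall>k\<ge>M. 1 / real (Suc k) < \<epsilon>" if \<epsilon>: "\<epsilon> > 0" for \<epsilon> :: real
  proof -
    obtain M where M: "1 / real (Suc M) < \<epsilon>" using nat_approx_posE[OF \<epsilon>] by auto
    have "1 / real (Suc k) < \<epsilon>" if "k \<ge> M" for k
      using M that frac_le[of 1 1 "real (Suc M)" "real (Suc k)"] by simp
    then show ?thesis by blast
  qed
  have l: "l \<in> K"
    unfolding K_def
  proof (intro CollectI conjI allI impI)
    show "l k \<in> Z" for k by (simp add: l_def K_Z s)
    fix \<epsilon> :: real assume \<epsilon>: "\<epsilon> > 0"
    obtain M1 where M1: "\<forall>k\<ge>M1. 1 / real (Suc k) < \<epsilon> / 3" using small[of "\<epsilon>/3"] \<epsilon> by auto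
    obtain M2 where M2: "\<forall>m\<ge>M2. \<forall>n\<ge>M2. hnorm GH (vdiff GH (u m) (u n)) < \<epsilon> / 3"
      using C[rule_format, of "\<epsilon>/3"] \<epsilon> by auto
    have "pn (l j - l k) < \<epsilon>" if jk: "j \<ge> max M1 M2" "k \<ge> max M1 M2" for j k
    proof -
      have "1 / real (Suc j) < \<epsilon> / 3" "1 / real (Suc k) < \<epsilon> / 3" "hnorm GH (vdiff GH (u j) (u k)) < \<epsilon> / 3"
        using M1 M2 jk by simp_all
      then show ?thesis using dl[of j k] by linarith
    qed
    then show "\<exists>M. \<forall>j\<ge>M. \<forall>k\<ge>M. pn (l j - l k) < \<epsilon>" by blast
  qed
  have "(\<lambda>k. hnorm GH (vdiff GH (u k) (code l))) \<longlonglongrightarrow> 0"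
  proof (rule LIMSEQ_I)
    fix \<epsilon> :: real assume \<epsilon>: "\<epsilon> > 0"
    obtain M1 where M1: "\<forall>k\<ge>M1. 1 / real (Suc k) < \<epsilon> / 3" using small[of "\<epsilon>/3"] \<epsilon> by auto
    have "\<epsilon> / 3 > 0" using \<epsilon> by simp
    with l obtain M2 where M2: "\<forall>m\<ge>M2. \<forall>n\<ge>M2. pn (l m - l n) < \<epsilon> / 3"
      unfolding K_def by blast
    have "norm (hnorm GH (vdiff GH (u k) (code l)) - 0) < \<epsilon>" if k: "k \<ge> max M1 M2" for k
    proof -
      have kd: "hnorm GH (vdiff GH (u k) (code l)) = lim (\<lambda>n. pn (s k n - l n))"
        by (simp add: us GH_vdiff GH_norm K_diff s l)
      have "lim (\<lambda>n. pn (s k n - l n)) \<le> \<epsilon> / 3 + \<epsilon> / 3"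
      proof (rule LIMSEQ_le_const2[OF pn_lim[OF K_diff[OF s l]]], intro exI allI impI)
        fix n assume n: "n \<ge> max (N k) M2"
        have "pn (s k n - l k) < 1 / real (Suc k)" using n by (intro l_near) simp
        moreover have "1 / real (Suc k) < \<epsilon> / 3" "pn (l k - l n) < \<epsilon> / 3" using M1 M2 k n by simp_all
        ultimately show "pn (s k n - l n) \<le> \<epsilon> / 3 + \<epsilon> / 3"
          using pn_diff_triangle[of "s k n" "l n" "l k"] by linarith
      qed
      moreover have "0 \<le> lim (\<lambda>n. pn (s k n - l n))"
        by (rule LIMSEQ_le_const[OF pn_lim[OF K_diff[OF s l]]]) simp
      ultimately show ?thesis using \<epsilon> by (simp add: kd)
    qed
    then show "\<exists>M. \<forall>k\<ge>M. norm (hnorm GH (vdiff GH (u k) (code l)) - 0) < \<epsilon>" by blast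
  qed
  then show "\<exists>v\<in>vcarrier GH. (\<lambda>k. hnorm GH (vdiff GH (u k) v)) \<longlonglongrightarrow> 0"
    using l by (auto simp: GH_carrier)
qed

lemma GH_hilbert: "hilbert_space GH"
proof -
  note G = GH_add GH_scale GH_inner K_add K_cscale K_const[OF Z_zero] GH_carrier GH_zero
  have lim_add: "lim (\<lambda>n. sip (s n) (t n + u n)) = lim (\<lambda>n. sip (s n) (t n)) + lim (\<lambda>n. sip (s n) (u n))"
    if "s \<in> K" "t \<in> K" "u \<in> K" for s t u
    unfolding sip_add_right by (intro limI tendsto_add sip_convergent that)
  have lim_scale: "lim (\<lambda>n. sip (s n) (cscale c (t n))) = c * lim (\<lambda>n. sip (s n) (t n))"
    if "s \<in> K" "t \<in> K" for s t c
    unfolding sip_cscale_right by (intro limI tendsto_mult_left sip_convergent that)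
  have lim_commute: "lim (\<lambda>n. sip (t n) (s n)) = cnj (lim (\<lambda>n. sip (s n) (t n)))"
    if "s \<in> K" "t \<in> K" for s t
    unfolding sip_commute[of "t _" "s _"] by (intro limI tendsto_cnj sip_convergent that)
  have lim_pos: "0 \<le> Re (lim (\<lambda>n. sip (s n) (s n)))" if "s \<in> K" for s
    by (rule LIMSEQ_le_const[OF tendsto_Re[OF sip_convergent[OF that that]]])
      (simp add: sip_def func_pos)
  have definite: "code s = code (\<lambda>_. 0)" if s: "s \<in> K" and z: "lim (\<lambda>n. sip (s n) (s n)) = 0" for s
  proof -
    have "lim (\<lambda>n. pn (s n)) = 0" using GH_norm[OF s] z by (simp add: hnorm_def GH_inner s)
    then show ?thesis using pn_lim[OF s] by (intro code_eqI s K_const Z_zero) simp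
  qed
  show ?thesis
  proof unfold_locales
    show "complete_wrt GH (hnorm GH)" by (rule GH_complete)
    fix x y assume "x \<in> vcarrier GH" "y \<in> vcarrier GH"
    then obtain s t where "s \<in> K" "x = code s" "t \<in> K" "y = code t" by (auto simp: GH_carrier)
    then show "hinner GH y x = cnj (hinner GH x y)" by (simp add: GH_inner lim_commute[of s t])
  qed (auto simp: G lim_add lim_scale lim_pos definite cscale_add_right cscale_add_left cscale_cscale add_ac
      simp del: cscale_minus_one)
qed

sublocale GH: hilbert_space GH
  by (rule GH_hilbert)

text \<open>The family must run over the whole index type. At an index outside the range of
  \<open>tc\<close>, \<open>inv tc\<close> has some unspecified value, which still names a member of
  the family \<open>e\<close>.\<close>

lemma GH_dense: "dense_family GH (\<lambda>i. code (\<lambda>_. e (inv tc i)))"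
  unfolding dense_family_def
proof (intro conjI allI ballI impI)
  show "code (\<lambda>_. e (inv tc i)) \<in> vcarrier GH" for i by (simp add: GH_carrier K_const e_Z)
  fix x and \<epsilon> :: real assume "x \<in> vcarrier GH" and \<epsilon>: "\<epsilon> > 0"
  then obtain s where s: "s \<in> K" and x: "x = code s" by (auto simp: GH_carrier)
  obtain t where t: "lim (\<lambda>n. pn (s n - e t)) < \<epsilon>" using K_dense[OF s \<epsilon>] by blast
  show "\<exists>i. hnorm GH (vdiff GH x (code (\<lambda>_. e (inv tc i)))) < \<epsilon>"
    using t by (intro exI[of _ "tc t"]) (simp add: x GH_vdiff GH_norm K_diff s K_const e_Z inv_f_f[OF inj_tc])
qed

section \<open>The GNS representation by left multiplication\<close>

definition \<pi> :: "'a \<Rightarrow> ('x, 'k) universe \<Rightarrow> ('x, 'k) universe" where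
  "\<pi> a = (\<lambda>u\<in>vcarrier GH. code (\<lambda>n. a * decode u n))"

lemma pi_code:
  assumes a: "a \<in> Z" and s: "s \<in> K"
  shows "\<pi> a (code s) = code (\<lambda>n. a * s n)"
proof -
  have "(\<lambda>n. pn (a * decode (code s) n - a * s n)) \<longlonglongrightarrow> 0"
  proof (rule Lim_null_comparison[OF always_eventually], rule allI)
    show "norm (pn (a * decode (code s) n - a * s n)) \<le> norm a * pn (decode (code s) n - s n)" for n
      using pn_mult[of a "decode (code s) n - s n"] by (simp add: right_diff_distrib)
    show "(\<lambda>n. norm a * pn (decode (code s) n - s n)) \<longlonglongrightarrow> 0"
      using tendsto_mult_left[OF decode_near[OF s], of "norm a"] by simp
  qed
  then have "code (\<lambda>n. a * decode (code s) n) = code (\<lambda>n. a * s n)"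
    by (intro code_eqI K_mult a decode s)
  then show ?thesis using s by (simp add: \<pi>_def GH_carrier)
qed

lemma pi_bound:
  assumes a: "a \<in> Z" and x: "x \<in> vcarrier GH"
  shows "hnorm GH (\<pi> a x) \<le> norm a * hnorm GH x"
proof -
  obtain s where s: "s \<in> K" and x: "x = code s" using x by (auto simp: GH_carrier)
  have "lim (\<lambda>n. pn (a * s n)) \<le> norm a * lim (\<lambda>n. pn (s n))"
  proof (rule LIMSEQ_le[OF pn_lim[OF K_mult[OF a s]] tendsto_mult_left[OF pn_lim[OF s]]])
    show "\<exists>N. \<forall>n\<ge>N. pn (a * s n) \<le> norm a * pn (s n)" using pn_mult by blast
  qed
  then show ?thesis by (simp add: x pi_code a s GH_norm K_mult)
qed

lemma pi_closed: "a \<in> Z \<Longrightarrow> \<pi> a \<in> bounded_operators GH"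
proof (rule GH.bounded_operatorsI[OF _ _ _ pi_bound])
  assume a: "a \<in> Z"
  show "\<pi> a \<in> vcarrier GH \<rightarrow>\<^sub>E vcarrier GH"
    using a by (intro PiE_I) (auto simp: GH_carrier pi_code K_mult, auto simp: \<pi>_def GH_carrier)
  show "\<pi> a (vadd GH x y) = vadd GH (\<pi> a x) (\<pi> a y)" if "x \<in> vcarrier GH" "y \<in> vcarrier GH" for x y
    using a that by (auto simp: GH_carrier GH_add pi_code K_add K_mult distrib_left)
  show "\<pi> a (vscale GH c x) = vscale GH c (\<pi> a x)" if "x \<in> vcarrier GH" for x c
    using a that by (auto simp: GH_carrier GH_scale pi_code K_cscale K_mult mult_cscale)
qed

lemma pi_norm: "a \<in> Z \<Longrightarrow> anorm (BH GH) (\<pi> a) \<le> norm a"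
  by (rule GH.opnorm_least[OF norm_ge_zero pi_bound])

lemma pi_hom:
  assumes a: "a \<in> Z" and b: "b \<in> Z"
  shows "\<pi> (a + b) = vadd (BH GH) (\<pi> a) (\<pi> b)" "\<pi> (cscale c a) = vscale (BH GH) c (\<pi> a)"
    "\<pi> (a * b) = amult (BH GH) (\<pi> a) (\<pi> b)"
proof -
  note G = GH_carrier GH_add GH_scale pi_code K_add K_cscale K_mult Z_add Z_mult Z_cscale mult_cscale
  show "\<pi> (a + b) = vadd (BH GH) (\<pi> a) (\<pi> b)"
    using GH.op_add_closed[OF pi_closed[OF a] pi_closed[OF b]]
    by (intro GH.op_ext pi_closed Z_add a b) (auto simp: G a b distrib_right)
  show "\<pi> (cscale c a) = vscale (BH GH) c (\<pi> a)"
    using GH.op_scale_closed[OF pi_closed[OF a], of c]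
    by (intro GH.op_ext pi_closed Z_cscale a) (auto simp: G a)
  show "\<pi> (a * b) = amult (BH GH) (\<pi> a) (\<pi> b)"
    using GH.op_mult_closed[OF pi_closed[OF a] pi_closed[OF b]]
    by (intro GH.op_ext pi_closed Z_mult a b) (auto simp: G a b mult.assoc)
qed

text \<open>The adjoint of left multiplication is left multiplication by the star, already at the
  level of \<open>sip\<close>. Membership of \<open>star a\<close> is a hypothesis because the
  locale does not make \<open>Z\<close> closed under the star.\<close>

lemma pi_star:
  assumes a: "a \<in> Z" and sa: "star a \<in> Z"
  shows "\<pi> (star a) = adjoint_op GH (\<pi> a)"
proof (rule GH.adjoint_eqI[symmetric, OF pi_closed[OF a] pi_closed[OF sa]])
  fix x y assume "x \<in> vcarrier GH" "y \<in> vcarrier GH"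
  then obtain s t where s: "s \<in> K" "x = code s" and t: "t \<in> K" "y = code t" by (auto simp: GH_carrier)
  have "sip (star a * s n) (t n) = sip (s n) (a * t n)" for n by (simp add: sip_mult_left)
  then show "hinner GH (\<pi> (star a) x) y = hinner GH x (\<pi> a y)"
    using s t a sa by (simp add: pi_code GH_inner K_mult)
qed

text \<open>Obtained by applying both operators to the constant sequence z. This is the form in
  which \<open>separating_gns\<close> tests elements for being zero.\<close>

lemma pi_eqD:
  assumes a: "a \<in> Z" and b: "b \<in> Z" and eq: "\<pi> a = \<pi> b" and z: "z \<in> Z"
  shows "pn ((a - b) * z) = 0"
proof -
  have "code (\<lambda>_. a * z) = code (\<lambda>_. b * z)"
    using eq pi_code[OF a K_const[OF z]] pi_code[OF b K_const[OF z]] by simp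
  then have "(\<lambda>n::nat. pn (a * z - b * z)) \<longlonglongrightarrow> 0"
    using code_eqD[OF K_const[OF Z_mult[OF a z]] K_const[OF Z_mult[OF b z]]] by simp
  then show ?thesis by (simp add: LIMSEQ_const_iff left_diff_distrib)
qed

end

section \<open>Generated subalgebras\<close>

text \<open>There is no constant term, so values stay in the possibly non-unital algebra. Complex
  scalars are approximated by means of rational multiples and \<open>TIota\<close>.\<close>

datatype 'x trm = TVar 'x | TAdd "'x trm" "'x trm" | TMul "'x trm" "'x trm"
  | TStar "'x trm" | TIota "'x trm" | TScale nat "'x trm"

primrec tcode :: "'x trm \<Rightarrow> ('x, 'k) index" where
  "tcode (TVar x) = pairc (natc 0) (Inl x)"
| "tcode (TAdd s t) = pairc (natc 1) (pairc (tcode s) (tcode t))"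
| "tcode (TMul s t) = pairc (natc 2) (pairc (tcode s) (tcode t))"
| "tcode (TStar t) = pairc (natc 3) (tcode t)"
| "tcode (TIota t) = pairc (natc 4) (tcode t)"
| "tcode (TScale n t) = pairc (natc 5) (pairc (natc n) (tcode t))"

lemma inj_tcode: "inj tcode"
proof (rule injI)
  fix s t :: "'x trm"
  show "tcode s = tcode t \<Longrightarrow> s = t"
  proof (induction s arbitrary: t)
    case (TVar x) then show ?case by (cases t) auto
  next
    case (TAdd s1 s2) then show ?case by (cases t) auto
  next
    case (TMul s1 s2) then show ?case by (cases t) auto
  next
    case (TStar s) then show ?case by (cases t) auto
  next
    case (TIota s) then show ?case by (cases t) auto
  next
    case (TScale n s) then show ?case by (cases t) auto
  qed
qed

context unital_cstar
begin

text \<open>Rational scalars, coded by natural numbers, keep the set of values no larger than the index type.\<close>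

primrec teval :: "('x \<Rightarrow> 'b) \<Rightarrow> 'x trm \<Rightarrow> 'b" where
  "teval v (TVar x) = v x"
| "teval v (TAdd s t) = teval v s + teval v t"
| "teval v (TMul s t) = teval v s * teval v t"
| "teval v (TStar t) = star (teval v t)"
| "teval v (TIota t) = \<iota> * teval v t"
| "teval v (TScale n t) = of_rat (from_nat n) *\<^sub>R teval v t"

definition tclosure :: "('x \<Rightarrow> 'b) \<Rightarrow> 'b set" where
  "tclosure v = closure (range (teval v))"

lemma teval_tclosure: "teval v t \<in> tclosure v"
  unfolding tclosure_def by (rule subsetD[OF closure_subset]) simp

lemma closed_tclosure: "closed (tclosure v)"
  by (simp add: tclosure_def)

lemma tclosure_map:
  assumes "continuous_on UNIV h" "\<And>t. h (teval v t) \<in> tclosure v" "z \<in> tclosure v"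
  shows "h z \<in> tclosure v"
proof -
  have "h ` closure (range (teval v)) \<subseteq> tclosure v"
    by (rule image_closure_subset[OF continuous_on_subset[OF assms(1)] closed_tclosure])
      (use assms(2) in auto)
  then show ?thesis using assms(3) unfolding tclosure_def by blast
qed

text \<open>Separate continuity is enough: pass to the closure first in the second argument with a
  term value in the first, then in the first.\<close>

lemma tclosure_map2:
  assumes "\<And>x. continuous_on UNIV (\<lambda>y. h x y)" "\<And>y. continuous_on UNIV (\<lambda>x. h x y)"
    "\<And>s t. h (teval v s) (teval v t) \<in> tclosure v" "x \<in> tclosure v" "y \<in> tclosure v"
  shows "h x y \<in> tclosure v"
proof (rule tclosure_map[of "\<lambda>x. h x y"])
  show "h (teval v s) y \<in> tclosure v" for s
    by (rule tclosure_map[of "h (teval v s)"]) (use assms in auto)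
qed (use assms in auto)

lemma tclosure_add: "x \<in> tclosure v \<Longrightarrow> y \<in> tclosure v \<Longrightarrow> x + y \<in> tclosure v"
  by (rule tclosure_map2, (intro continuous_intros)+)
    (simp_all add: teval_tclosure flip: teval.simps(2))

lemma tclosure_mult: "x \<in> tclosure v \<Longrightarrow> y \<in> tclosure v \<Longrightarrow> x * y \<in> tclosure v"
  by (rule tclosure_map2, (intro continuous_intros)+)
    (simp_all add: teval_tclosure flip: teval.simps(3))

lemma tclosure_star: "x \<in> tclosure v \<Longrightarrow> star x \<in> tclosure v"
  by (rule tclosure_map, rule linear_continuous_on[OF bounded_linear_star])
    (simp_all add: teval_tclosure flip: teval.simps(4))

lemma tclosure_iota: "x \<in> tclosure v \<Longrightarrow> \<iota> * x \<in> tclosure v"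
  by (rule tclosure_map, intro continuous_intros)
    (simp_all add: teval_tclosure flip: teval.simps(5))

text \<open>Terms only have rational scalars; a real scalar is a limit of rationals, and the closure
  absorbs the limit.\<close>

lemma tclosure_scaleR:
  assumes x: "x \<in> tclosure v"
  shows "c *\<^sub>R x \<in> tclosure v"
proof -
  have rat: "of_rat q *\<^sub>R x \<in> tclosure v" for q
  proof (rule tclosure_map[of "\<lambda>x. of_rat q *\<^sub>R x", OF _ _ x])
    show "of_rat q *\<^sub>R teval v t \<in> tclosure v" for t
      using teval_tclosure[of v "TScale (to_nat q) t"] by simp
  qed (intro continuous_intros)
  have "\<exists>q. \<bar>of_rat q - c\<bar> < inverse (real (Suc n))" for n
  proof -
    obtain q where "c - inverse (real (Suc n)) < of_rat q" "of_rat q < c"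
      using of_rat_dense[of "c - inverse (real (Suc n))" c] by auto
    then show ?thesis by (intro exI[of _ q]) linarith
  qed
  then obtain q where q: "\<And>n. \<bar>of_rat (q n) - c\<bar> < inverse (real (Suc n))" by metis
  have "(\<lambda>n. of_rat (q n) - c) \<longlonglongrightarrow> 0"
    by (rule Lim_null_comparison[OF always_eventually LIMSEQ_inverse_real_of_nat], rule allI)
      (unfold real_norm_def, rule less_imp_le[OF q])
  then have "(\<lambda>n. of_rat (q n) *\<^sub>R x) \<longlonglongrightarrow> c *\<^sub>R x"
    by (intro tendsto_intros) (simp add: LIM_zero_iff)
  then show ?thesis by (rule closed_sequentially[OF closed_tclosure rat])
qed

lemma tclosure_zero: "0 \<in> tclosure v"
  using tclosure_scaleR[OF teval_tclosure[of v undefined], of 0] by simp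

lemma tclosure_cscale: "x \<in> tclosure v \<Longrightarrow> cscale c x \<in> tclosure v"
  unfolding cscale_def by (intro tclosure_add tclosure_scaleR tclosure_iota)

lemma tclosure_diff: "x \<in> tclosure v \<Longrightarrow> y \<in> tclosure v \<Longrightarrow> x - y \<in> tclosure v"
  using tclosure_add[of x v "(-1) *\<^sub>R y"] tclosure_scaleR[of y v "-1"] by simp

lemma tclosure_dense: "x \<in> tclosure v \<Longrightarrow> 0 < \<epsilon> \<Longrightarrow> \<exists>t. norm (x - teval v t) < \<epsilon>"
  unfolding tclosure_def closure_approachable by (fastforce simp: dist_norm norm_minus_commute)

lemma tclosure_gns:
  assumes "positive_functional star \<iota> \<Phi>"
  shows "gns star \<iota> \<Phi> (tclosure v) (teval v) tcode"
proof -
  interpret positive_functional star \<iota> \<Phi> by fact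
  show ?thesis
    by unfold_locales (auto intro: tclosure_zero tclosure_add tclosure_cscale tclosure_mult
        teval_tclosure tclosure_dense inj_tcode)
qed

text \<open>One norming functional per term suffices, because term values are dense, and it keeps
  the family within the size of the index type. For lack of a unit in the closure, y is tested at z
  = \<open>star y\<close>, which gives \<open>y * star y\<close> = 0.\<close>

lemma separating_gns:
  fixes v :: "'x \<Rightarrow> 'b"
  shows "\<exists>\<Phi> :: 'x trm \<Rightarrow> 'b \<Rightarrow> complex.
    (\<forall>t. gns star \<iota> (\<Phi> t) (tclosure v) (teval v) (tcode :: _ \<Rightarrow> ('x, 'k) index)) \<and>
    (\<forall>y\<in>tclosure v. (\<forall>t. \<forall>z\<in>tclosure v. positive_functional.pn star (\<Phi> t) (y * z) = 0) \<longrightarrow> y = 0)"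
proof -
  have "\<forall>t. \<exists>\<Phi>. positive_functional star \<iota> \<Phi> \<and> Re (\<Phi> (star (teval v t) * teval v t)) = (norm (teval v t))\<^sup>2"
    using norming_functional by metis
  from choice[OF this] obtain \<Phi> where \<Phi>: "\<And>t. positive_functional star \<iota> (\<Phi> t)"
    "\<And>t. Re (\<Phi> t (star (teval v t) * teval v t)) = (norm (teval v t))\<^sup>2" by blast
  show ?thesis
  proof (intro exI[of _ \<Phi>] conjI allI ballI impI tclosure_gns \<Phi>(1))
    fix y assume y: "y \<in> tclosure v"
      and pn0: "\<forall>t. \<forall>z\<in>tclosure v. positive_functional.pn star (\<Phi> t) (y * z) = 0"
    define w where "w = y * star y"
    have w: "w \<in> tclosure v" unfolding w_def by (intro tclosure_mult tclosure_star y)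
    have "norm w \<le> \<epsilon>" if \<epsilon>: "\<epsilon> > 0" for \<epsilon>
    proof -
      \<comment> \<open>The functional of \<open>t\<close> norms this approximation of w, so |w| is
        at most |w - t| + pn(t), while pn(t) <= pn(w) + |w - t| and pn(w) = 0.\<close>
      obtain t where t: "norm (w - teval v t) < \<epsilon> / 2" using tclosure_dense[OF w, of "\<epsilon>/2"] \<epsilon> by auto
      interpret positive_functional star \<iota> "\<Phi> t" by (rule \<Phi>)
      have "pn (teval v t) = norm (teval v t)" by (simp add: pn_def sip_def \<Phi>(2))
      moreover have "pn (teval v t) \<le> pn w + norm (w - teval v t)"
        using pn_triangle[of w "teval v t - w"] pn_le_norm[of "teval v t - w"]
        by (simp add: norm_minus_commute)
      moreover have "pn w = 0" unfolding w_def using pn0 tclosure_star[OF y] by blast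
      moreover have "norm w \<le> norm (w - teval v t) + norm (teval v t)"
        using norm_triangle_ineq[of "w - teval v t" "teval v t"] by simp
      ultimately show ?thesis using t by linarith
    qed
    then have "norm w \<le> 0" by (rule dense_ge)
    then have "star (star y) * star y = 0" by (simp add: w_def)
    then have "star y = 0" by (rule star_mult_self_eq_0)
    then show "y = 0" using star_star[of y] by simp
  qed
qed

end

text \<open>The closure is taken in \<open>all_alg\<close> and then pulled back. As the embedding is
  isometric, the preimage is norm closed in \<open>A\<close>.\<close>

lemma generated_subalgebra:
  fixes A :: "'a calg" and v :: "'x \<Rightarrow> 'a all_alg"
  assumes "cstar_algebra A"
  shows "cstar_algebra (A\<lparr>vcarrier := {a \<in> vcarrier A. embed_all A a \<in> unital.tclosure v}\<rparr>)"
proof -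
  interpret cstar_algebra A by fact
  note emb = embed_all_hom[OF assms]
  show ?thesis
  proof (rule cstar_subalgebra)
    show "vzero A \<in> {a \<in> vcarrier A. embed_all A a \<in> unital.tclosure v}"
      using norm_embed_all[OF assms zero_closed] unital.tclosure_zero zero_closed by (simp add: norm_zero)
  next
    fix s l assume s: "\<And>n::nat. s n \<in> {a \<in> vcarrier A. embed_all A a \<in> unital.tclosure v}"
      and l: "l \<in> vcarrier A" and lim: "(\<lambda>n. anorm A (vdiff A (s n) l)) \<longlonglongrightarrow> 0"
    have "norm (embed_all A (s n) - embed_all A l) = anorm A (vdiff A (s n) l)" for n
      using s[of n] l by (simp add: emb(5)[symmetric] norm_embed_all[OF assms] vdiff_closed)
    then have "(\<lambda>n. norm (embed_all A (s n) - embed_all A l)) \<longlonglongrightarrow> 0" using lim by simp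
    then have "(\<lambda>n. embed_all A (s n)) \<longlonglongrightarrow> embed_all A l"
      by (rule LIM_zero_cancel[OF tendsto_norm_zero_cancel])
    moreover have "embed_all A (s n) \<in> unital.tclosure v" for n using s by blast
    ultimately have "embed_all A l \<in> unital.tclosure v"
      by (rule closed_sequentially[OF unital.closed_tclosure, rotated])
    then show "l \<in> {a \<in> vcarrier A. embed_all A a \<in> unital.tclosure v}" using l by simp
  qed (auto simp: algebra_closed emb unital.tclosure_add unital.tclosure_mult unital.tclosure_star
      unital.tclosure_scaleR unital.tclosure_iota)
qed

text \<open>The theorem for algebras that already lie in the universe. Each GNS space of the
  generated algebra is handled by \<open>rfd_transfer\<close>, and the jointly faithful family of
  representations is reassembled by closedness and (R2).\<close>

lemma universe_transfer:
  fixes X :: "'x set" and R S :: "('x, 'k) relation" and A :: "('x, 'k) universe calg"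
  assumes R: "cstar_relation X R" and S: "cstar_relation X S"
    and rfd: "rfd_relation X R" and cl: "closed_relation X S"
    and fd: "\<And>(H :: ('x, 'k) universe hilb) f. \<lbrakk>hilbert_space H; is_representation R X (BH H) f;
      finite_dimensional X H f\<rbrakk> \<Longrightarrow> is_representation S X (BH H) f"
    and f: "is_representation R X A f"
  shows "is_representation S X A f"
proof -
  have A: "cstar_algebra A" and fE: "f \<in> X \<rightarrow>\<^sub>E vcarrier A" using f by (auto simp: is_representation_def)
  interpret A: cstar_algebra A by (rule A)
  note emb = embed_all_hom[OF A] and norm_emb = norm_embed_all[OF A]
  \<comment> \<open>Terms have variables for all of the type, not only for \<open>X\<close>; the
    value 0 outside \<open>X\<close> adds nothing to the generated algebra.\<close>
  define v where "v x = (if x \<in> X then embed_all A (f x) else 0)" for x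
  let ?Z = "unital.tclosure v" and ?j = "embed_all A"
  define A0 where "A0 = A\<lparr>vcarrier := {a \<in> vcarrier A. ?j a \<in> ?Z}\<rparr>"
  have A0: "cstar_algebra A0" unfolding A0_def by (rule generated_subalgebra[OF A])
  have A0_simps: "a \<in> vcarrier A0 \<longleftrightarrow> a \<in> vcarrier A \<and> ?j a \<in> ?Z" "vadd A0 = vadd A" "vscale A0 = vscale A"
    "amult A0 = amult A" "astar A0 = astar A" "anorm A0 = anorm A" for a
    by (simp_all add: A0_def)
  have incl: "star_hom (\<lambda>a. a) A0 A" by (auto simp: star_hom_def A0_simps)
  have fA0: "f \<in> X \<rightarrow>\<^sub>E vcarrier A0"
  proof -
    have "?j (f x) \<in> ?Z" if "x \<in> X" for x
      using unital.teval_tclosure[of v "TVar x"] that by (simp add: v_def)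
    then show ?thesis using fE by (auto simp: PiE_iff A0_simps)
  qed
  have f_id: "(\<lambda>x\<in>X. f x) = f" using fE by (auto simp: PiE_iff extensional_def fun_eq_iff)
  \<comment> \<open>(R2) for the inclusion carries \<open>R\<close> down to the generated algebra;
    at the end (R3) for the same inclusion carries \<open>S\<close> back up.\<close>
  have f0: "is_representation R X A0 f"
    by (rule is_representation_inj[OF R _ A0 incl _ fA0]) (simp_all add: f f_id)
  from unital.separating_gns[of v] obtain \<Phi> :: "'x trm \<Rightarrow> ('x, 'k) universe all_alg \<Rightarrow> complex"
    where gs: "(\<forall>t. gns all_star all_iota (\<Phi> t) ?Z (unital.teval v) (tcode :: _ \<Rightarrow> ('x, 'k) index)) \<and>
      (\<forall>y\<in>?Z. (\<forall>t. \<forall>z\<in>?Z. positive_functional.pn all_star (\<Phi> t) (y * z) = 0) \<longrightarrow> y = 0)" ..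
  note \<Phi> = gs[THEN conjunct1, THEN spec]
  have sep: "y = 0" if "y \<in> ?Z" "\<And>t z. z \<in> ?Z \<Longrightarrow> positive_functional.pn all_star (\<Phi> t) (y * z) = 0" for y
    by (rule gs[THEN conjunct2, THEN bspec, THEN mp, OF that(1)]) (intro allI ballI that(2))
  define H where "H t = gns.GH all_star all_iota (\<Phi> t) ?Z (unital.teval v) (tcode :: _ \<Rightarrow> ('x, 'k) index)" for t
  define \<rho> where "\<rho> t a = gns.\<pi> all_star all_iota (\<Phi> t) ?Z (unital.teval v) (tcode :: _ \<Rightarrow> ('x, 'k) index) (?j a)" for t a
  have H: "hilbert_space (H t)" for t unfolding H_def by (rule gns.GH_hilbert[OF \<Phi>])
  have dense: "\<exists>d :: ('x, 'k) index \<Rightarrow> _. dense_family (H t) d" for t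
    unfolding H_def using gns.GH_dense[OF \<Phi>] by blast
  have BH: "cstar_algebra (BH (H t))" for t by (rule hilbert_space.cstar_BH[OF H])
  have "\<exists>c :: _ \<Rightarrow> ('x, 'k) universe. inj_on c (vcarrier (BH (H t)))" for t
    using hilbert_space.BH_code[OF H] dense by (metis hilbert_space.BH_simps(1) H)
  then obtain c :: "_ \<Rightarrow> _ \<Rightarrow> ('x, 'k) universe" where c: "\<And>t. inj_on (c t) (vcarrier (BH (H t)))" by metis
  have \<rho>_hom: "star_hom (\<rho> t) A0 (BH (H t))" for t
  proof -
    interpret gns all_star all_iota "\<Phi> t" ?Z "unital.teval v" "tcode :: _ \<Rightarrow> ('x, 'k) index" by (rule \<Phi>)
    show ?thesis
      unfolding star_hom_def H_def \<rho>_def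
    proof (intro conjI ballI allI funcsetI)
      fix a assume a: "a \<in> vcarrier A0"
      then have ja: "?j a \<in> ?Z" and aA: "a \<in> vcarrier A" by (simp_all add: A0_simps)
      show "\<pi> (?j a) \<in> vcarrier (BH GH)" using pi_closed[OF ja] by simp
      show "\<pi> (?j (vscale A0 k a)) = vscale (BH GH) k (\<pi> (?j a))" for k
        using pi_hom(2)[OF ja ja, of k] by (simp add: A0_simps emb(4)[OF aA aA] unital.cscale_def del: GH.BH_simps)
      show "\<pi> (?j (astar A0 a)) = astar (BH GH) (\<pi> (?j a))"
        using pi_star[OF ja unital.tclosure_star[OF ja]] by (simp add: A0_simps emb(3)[OF aA aA])
      fix b assume b: "b \<in> vcarrier A0"
      then have jb: "?j b \<in> ?Z" and bA: "b \<in> vcarrier A" by (simp_all add: A0_simps)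
      show "\<pi> (?j (vadd A0 a b)) = vadd (BH GH) (\<pi> (?j a)) (\<pi> (?j b))"
        using pi_hom(1)[OF ja jb] by (simp add: A0_simps emb(1)[OF aA bA] del: GH.BH_simps)
      show "\<pi> (?j (amult A0 a b)) = amult (BH GH) (\<pi> (?j a)) (\<pi> (?j b))"
        using pi_hom(3)[OF ja jb] by (simp add: A0_simps emb(2)[OF aA bA] del: GH.BH_simps)
    qed
  qed
  have \<rho>_norm: "anorm (BH (H t)) (\<rho> t a) \<le> anorm A a" if "a \<in> vcarrier A0" for t a
    using gns.pi_norm[OF \<Phi>, of "?j a" t] that norm_emb[of a] by (simp add: H_def \<rho>_def A0_simps)
  have \<rho>_sep: "a = b" if a: "a \<in> vcarrier A0" and b: "b \<in> vcarrier A0" and eq: "\<And>t. \<rho> t a = \<rho> t b" for a b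
  proof -
    have ja: "?j a \<in> ?Z" "a \<in> vcarrier A" and jb: "?j b \<in> ?Z" "b \<in> vcarrier A" using a b by (simp_all add: A0_simps)
    have "?j a - ?j b = 0"
    proof (rule sep[OF unital.tclosure_diff[OF ja(1) jb(1)]])
      fix t z assume "z \<in> ?Z"
      then show "positive_functional.pn all_star (\<Phi> t) ((?j a - ?j b) * z) = 0"
        by (rule gns.pi_eqD[OF \<Phi> ja(1) jb(1) eq[of t, unfolded \<rho>_def]])
    qed
    then have "anorm A (vdiff A a b) = 0"
      using norm_emb[OF A.vdiff_closed[OF ja(2) jb(2)]] emb(5)[OF ja(2) jb(2)] by simp
    then show "a = b"
      using A.norm_eq_zero[OF A.vdiff_closed[OF ja(2) jb(2)]] A.vdiff_eq_zero_iff[OF ja(2) jb(2)] by simp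
  qed
  have repH: "is_representation S X (BH (H t)) (\<lambda>x\<in>X. \<rho> t (f x))" for t
  proof -
    obtain d :: "('x, 'k) index \<Rightarrow> _" where d: "dense_family (H t) d" using dense by blast
    show ?thesis
      by (rule rfd_transfer[OF S rfd cl _ H d is_representation_hom[OF R f0 BH \<rho>_hom c]]) (rule fd[OF H])
  qed
  define B where "B t = copy_alg (c t) (BH (H t))" for t
  have B: "cstar_algebra (B t)" and iso: "star_iso (c t) (BH (H t)) (B t)" for t
    using copy_alg[OF BH c] by (simp_all add: B_def)
  have h: "star_hom (\<lambda>a. c t (\<rho> t a)) A0 (B t)" for t
    by (rule star_hom_compose[OF \<rho>_hom star_iso_hom[OF iso]])
  have B_norm: "anorm (B t) (c t (\<rho> t a)) \<le> anorm A a" if "a \<in> vcarrier A0" for t a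
    using norm_copy_alg[OF c star_hom_closed[OF \<rho>_hom that]] \<rho>_norm[OF that] by (simp add: B_def)
  \<comment> \<open>As index sets come from the universe, a term is represented by the singleton of
    its code, and \<open>T\<close> recovers the term.\<close>
  define I :: "('x, 'k) universe set" where "I = range (\<lambda>t. {tcode t})"
  define T where "T i = inv tcode (the_elem i)" for i :: "('x, 'k) universe"
  have T: "T {tcode t} = t" for t by (simp add: T_def inv_f_f[OF inj_tcode])
  have I: "inj_on the_elem I" by (auto simp: I_def inj_on_def)
  let ?\<phi> = "\<lambda>a. \<lambda>i\<in>I. c (T i) (\<rho> (T i) a)"
  have "is_representation S X (prod_alg I (\<lambda>i. B (T i)))
      (\<lambda>x\<in>X. \<lambda>i\<in>I. (\<lambda>x\<in>X. c (T i) ((\<lambda>x\<in>X. \<rho> (T i) (f x)) x)) x)"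
  proof (rule closed_relationD[OF cl _ _ I])
    show "is_representation S X (B (T i)) (\<lambda>x\<in>X. c (T i) ((\<lambda>x\<in>X. \<rho> (T i) (f x)) x))" for i
      by (rule is_representation_hom[OF S repH B star_iso_hom[OF iso] inj_on_id])
    show "anorm (B (T i)) ((\<lambda>x\<in>X. c (T i) ((\<lambda>x\<in>X. \<rho> (T i) (f x)) x)) x) \<le> anorm A (f x)" if "x \<in> X" for x i
      using that B_norm PiE_mem[OF fA0 that] by simp
  qed
  also have "(\<lambda>x\<in>X. \<lambda>i\<in>I. (\<lambda>x\<in>X. c (T i) ((\<lambda>x\<in>X. \<rho> (T i) (f x)) x)) x) = (\<lambda>x\<in>X. ?\<phi> (f x))"
    by (auto simp: fun_eq_iff)
  finally have rep: "is_representation S X (prod_alg I (\<lambda>i. B (T i))) (\<lambda>x\<in>X. ?\<phi> (f x))" .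
  have "star_hom ?\<phi> A0 (prod_alg I (\<lambda>i. B (T i)))"
    unfolding star_hom_def
  proof (intro conjI ballI allI funcsetI)
    fix a assume a: "a \<in> vcarrier A0"
    show "?\<phi> a \<in> vcarrier (prod_alg I (\<lambda>i. B (T i)))"
      by (rule prod_alg_carrierI[where K = "anorm A a"]) (use a B_norm star_hom_closed[OF h] in auto)
  qed (use h in \<open>auto simp: star_hom_def fun_eq_iff\<close>)
  moreover have "inj_on ?\<phi> (vcarrier A0)"
  proof (rule inj_onI, rule \<rho>_sep)
    fix a b t assume a: "a \<in> vcarrier A0" and b: "b \<in> vcarrier A0" and eq: "?\<phi> a = ?\<phi> b"
    have "c t (\<rho> t a) = c t (\<rho> t b)" using fun_cong[OF eq, of "{tcode t}"] by (simp add: I_def T)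
    then show "\<rho> t a = \<rho> t b"
      using inj_onD[OF c] star_hom_closed[OF \<rho>_hom a] star_hom_closed[OF \<rho>_hom b] by blast
  qed
  ultimately have "is_representation S X A0 f"
    using is_representation_inj[OF S rep A0 _ _ fA0] by blast
  from is_representation_hom[OF S this A incl inj_on_id] show ?thesis by (simp add: f_id)
qed

theorem theorem3p6:
  fixes X :: "'x set"
    and R S :: "('x, 'k) relation"
  assumes "cstar_relation X R" and "cstar_relation X S"
    and "rfd_relation X R"
    and "closed_relation X S"
    and "\<And>(H :: ('x, 'k) universe hilb) f.
      \<lbrakk>hilbert_space H; is_representation R X (BH H) f; finite_dimensional X H f\<rbrakk>
      \<Longrightarrow> is_representation S X (BH H) f"
  shows "\<And>(A :: 'a calg) f. is_representation R X A f \<Longrightarrow> is_representation S X A f"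
proof -
  fix A :: "'a calg" and f
  assume f: "is_representation R X A f"
  then obtain A' :: "('x, 'k) universe calg" and \<psi> where A': "cstar_algebra A'" and \<psi>: "star_iso \<psi> A A'"
    and A: "cstar_algebra A" and fA: "f \<in> X \<rightarrow>\<^sub>E vcarrier A"
    by (auto simp: is_representation_def)
  \<comment> \<open>The copy \<open>A'\<close> from the definition of a representation moves the
    question into the universe; (R2) for the isomorphism brings the answer back to the type of
    \<open>A\<close>.\<close>
  have "is_representation R X A' (\<lambda>x\<in>X. \<psi> (f x))"
    by (rule is_representation_hom[OF assms(1) f A' star_iso_hom[OF \<psi>] inj_on_id])
  then have "is_representation S X A' (\<lambda>x\<in>X. \<psi> (f x))"
    by (rule universe_transfer[OF assms(1-4), rotated]) (rule assms(5))
  then show "is_representation S X A f"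
    by (rule is_representation_inj[OF assms(2) _ A star_iso_hom[OF \<psi>] star_iso_inj[OF \<psi>] fA])
qed

end
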